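(* A smooth fence $Y$ is homeomorphic to the Fraïssé fence $\mathbb F/R^{\mathbb F}$ if and only if for any two open sets $O,O'\subseteq Y$ which both meet a common connected component of $Y$, there is an arc component of $Y$ one of whose endpoints belongs to $O$ and the other to $O'$.
   Context: Let $\mathcal L_R=\{R,\le\}$. A topological $\mathcal L_R$-structure is a zero-dimensional compact metrizable space with closed interpretations of $R,\le$. An epimorphism is a continuous surjection $\varphi$ with $r^B=(\varphi\times\varphi)[r^A]$ for $r\in\{R,\le\}$; an automorphism is a bijective epimorphism of a structure onto itself. A finite Hasse forest is a finite $\mathcal L_R$-structure where $\le$ is a partial order, $a\,R\,b$ iff $a=b$ or one of $a,b$ is an immediate $\le$-successor of the other, and the Hasse diagram has no cycles; $\mathcal F$ is the family of finite Hasse forests. $\mathcal F$ has a projective Fraïssé limit $\mathbb F$, unique up to isomorphism: a topological $\mathcal L_R$-structure such that (L1) every $A\in\mathcal F$ is an epimorphic image of $\mathbb F$; (L2) every clopen cover of $\mathbb F$ is refined by the point-preimages of some epimorphism $\mathbb F\to A$, $A\in\mathcal F$; (L3) for any $A\in\mathcal F$ and epimorphisms $\varphi_1,\varphi_2:\mathbb F\to A$ there is an automorphism $\psi$ of $\mathbb F$ with $\varphi_2=\varphi_1\psi$. The relation $R^{\mathbb F}$ is a closed equivalence relation, and the Fraïssé fence is the quotient space $\mathbb F/R^{\mathbb F}$. A fence is a compact metrizable space whose connected components are points or arcs (arc components are the components that are arcs); it is smooth if it admits a closed partial order whose restriction to each connected component is total. *)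

theory Defs
  imports "HOL-Analysis.Analysis"
begin

section \<open>Topological structures in the language of the two binary relations\<close>

record 'a lr_structure =
  space_of :: "'a topology"
  rel_of :: "('a \<times> 'a) set"
  le_of :: "('a \<times> 'a) set"

definition zero_dimensional_space :: "'a topology \<Rightarrow> bool" where
  "zero_dimensional_space X \<longleftrightarrow>
     (\<forall>U x. openin X U \<and> x \<in> U \<longrightarrow> (\<exists>V. openin X V \<and> closedin X V \<and> x \<in> V \<and> V \<subseteq> U))"

definition topological_structure :: "'a lr_structure \<Rightarrow> bool" where
  "topological_structure A \<longleftrightarrow>
     zero_dimensional_space (space_of A) \<and> compact_space (space_of A) \<and>
     metrizable_space (space_of A) \<and>
     closedin (prod_topology (space_of A) (space_of A)) (rel_of A) \<and>
     closedin (prod_topology (space_of A) (space_of A)) (le_of A)"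

definition epimorphism :: "'a lr_structure \<Rightarrow> 'b lr_structure \<Rightarrow> ('a \<Rightarrow> 'b) \<Rightarrow> bool" where
  "epimorphism A B \<phi> \<longleftrightarrow>
     continuous_map (space_of A) (space_of B) \<phi> \<and>
     \<phi> ` topspace (space_of A) = topspace (space_of B) \<and>
     rel_of B = map_prod \<phi> \<phi> ` rel_of A \<and>
     le_of B = map_prod \<phi> \<phi> ` le_of A"

definition automorphism :: "'a lr_structure \<Rightarrow> ('a \<Rightarrow> 'a) \<Rightarrow> bool" where
  "automorphism A \<psi> \<longleftrightarrow>
     epimorphism A A \<psi> \<and> bij_betw \<psi> (topspace (space_of A)) (topspace (space_of A))"

section \<open>Finite Hasse forests and their projective Fraisse limit\<close>

definition immediate_successor :: "('a \<times> 'a) set \<Rightarrow> 'a \<Rightarrow> 'a \<Rightarrow> bool" where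
  "immediate_successor r a b \<longleftrightarrow>
     (a, b) \<in> r \<and> a \<noteq> b \<and> (\<nexists>c. (a, c) \<in> r \<and> (c, b) \<in> r \<and> c \<noteq> a \<and> c \<noteq> b)"

text \<open>The Hasse diagram is regarded as an undirected graph.\<close>

definition hasse_edge :: "('a \<times> 'a) set \<Rightarrow> 'a \<Rightarrow> 'a \<Rightarrow> bool" where
  "hasse_edge r a b \<longleftrightarrow> immediate_successor r a b \<or> immediate_successor r b a"

definition hasse_cycle :: "('a \<times> 'a) set \<Rightarrow> 'a list \<Rightarrow> bool" where
  "hasse_cycle r xs \<longleftrightarrow>
     length xs \<ge> 3 \<and> distinct xs \<and>
     (\<forall>i < length xs. hasse_edge r (xs ! i) (xs ! (Suc i mod length xs)))"

text \<open>Being compact metrizable, a finite structure automatically carries the discrete topology.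
  Hasse forests are nonempty: the empty structure is an epimorphic image of itself only, so
  admitting it would rule out a projective Fraisse limit.\<close>

definition finite_hasse_forest :: "'a lr_structure \<Rightarrow> bool" where
  "finite_hasse_forest A \<longleftrightarrow>
     topological_structure A \<and>
     finite (topspace (space_of A)) \<and> topspace (space_of A) \<noteq> {} \<and>
     partial_order_on (topspace (space_of A)) (le_of A) \<and>
     rel_of A = {(a, b). a \<in> topspace (space_of A) \<and> b \<in> topspace (space_of A) \<and>
                         (a = b \<or> hasse_edge (le_of A) a b)} \<and>
     (\<nexists>xs. hasse_cycle (le_of A) xs)"

text \<open>Every finite structure has an isomorphic copy whose points are natural numbers, so
  quantifying over forests on \<^typ>\<open>nat\<close> amounts to quantifying over all finite Hasse forests.
  The three quantified conjuncts are projective universality, refinement of clopen covers and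
  projective ultrahomogeneity.\<close>

definition projective_fraisse_limit :: "'a lr_structure \<Rightarrow> bool" where
  "projective_fraisse_limit F \<longleftrightarrow>
     topological_structure F \<and>
     (\<forall>A :: nat lr_structure. finite_hasse_forest A \<longrightarrow> (\<exists>\<phi>. epimorphism F A \<phi>)) \<and>
     (\<forall>\<U>. (\<forall>U \<in> \<U>. openin (space_of F) U \<and> closedin (space_of F) U) \<and>
           \<Union>\<U> = topspace (space_of F) \<longrightarrow>
        (\<exists>(A :: nat lr_structure) \<phi>. finite_hasse_forest A \<and> epimorphism F A \<phi> \<and>
           (\<forall>a \<in> topspace (space_of A). \<exists>U \<in> \<U>. {x \<in> topspace (space_of F). \<phi> x = a} \<subseteq> U))) \<and>
     (\<forall>(A :: nat lr_structure) \<phi>\<^sub>1 \<phi>\<^sub>2.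
        finite_hasse_forest A \<and> epimorphism F A \<phi>\<^sub>1 \<and> epimorphism F A \<phi>\<^sub>2 \<longrightarrow>
        (\<exists>\<psi>. automorphism F \<psi> \<and> (\<forall>x \<in> topspace (space_of F). \<phi>\<^sub>2 x = \<phi>\<^sub>1 (\<psi> x))))"

section \<open>The quotient space\<close>

definition quotient_space :: "'a topology \<Rightarrow> ('a \<times> 'a) set \<Rightarrow> 'a set topology" where
  "quotient_space X r =
     topology (\<lambda>U. U \<subseteq> topspace X // r \<and> openin X {x \<in> topspace X. r `` {x} \<in> U})"

lemma openin_quotient_space:
  "openin (quotient_space X r) U \<longleftrightarrow>
     U \<subseteq> topspace X // r \<and> openin X {x \<in> topspace X. r `` {x} \<in> U}"
proof -
  have "istopology (\<lambda>U. U \<subseteq> topspace X // r \<and> openin X {x \<in> topspace X. r `` {x} \<in> U})"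
    unfolding istopology_def
  proof (intro conjI allI impI)
    fix S T
    assume S: "S \<subseteq> topspace X // r \<and> openin X {x \<in> topspace X. r `` {x} \<in> S}"
      and T: "T \<subseteq> topspace X // r \<and> openin X {x \<in> topspace X. r `` {x} \<in> T}"
    show "S \<inter> T \<subseteq> topspace X // r" using S by blast
    have "{x \<in> topspace X. r `` {x} \<in> S \<inter> T} =
        {x \<in> topspace X. r `` {x} \<in> S} \<inter> {x \<in> topspace X. r `` {x} \<in> T}" by blast
    then show "openin X {x \<in> topspace X. r `` {x} \<in> S \<inter> T}" using S T by auto
  next
    fix \<K>
    assume K: "\<forall>S\<in>\<K>. S \<subseteq> topspace X // r \<and> openin X {x \<in> topspace X. r `` {x} \<in> S}"
    show "\<Union>\<K> \<subseteq> topspace X // r" using K by blast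
    have "{x \<in> topspace X. r `` {x} \<in> \<Union>\<K>} = (\<Union>S\<in>\<K>. {x \<in> topspace X. r `` {x} \<in> S})" by blast
    then show "openin X {x \<in> topspace X. r `` {x} \<in> \<Union>\<K>}" using K by auto
  qed
  then show ?thesis unfolding quotient_space_def by simp
qed

lemma topspace_quotient_space: "topspace (quotient_space X r) = topspace X // r"
proof
  show "topspace (quotient_space X r) \<subseteq> topspace X // r"
    using openin_quotient_space[of X r "topspace (quotient_space X r)"] by simp
  have "{x \<in> topspace X. r `` {x} \<in> topspace X // r} = topspace X"
    by (auto intro: quotientI)
  then have "openin (quotient_space X r) (topspace X // r)"
    by (simp add: openin_quotient_space)
  then show "topspace X // r \<subseteq> topspace (quotient_space X r)"
    by (rule openin_subset)
qed

lemma quotient_map_quotient_space: "quotient_map X (quotient_space X r) (\<lambda>x. r `` {x})"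
  unfolding quotient_map_def
  by (auto simp: topspace_quotient_space openin_quotient_space quotient_def)

definition fraisse_fence :: "'a lr_structure \<Rightarrow> 'a set topology" where
  "fraisse_fence F = quotient_space (space_of F) (rel_of F)"

section \<open>Fences\<close>

definition arc_component :: "'a topology \<Rightarrow> 'a set \<Rightarrow> bool" where
  "arc_component Y C \<longleftrightarrow>
     C \<in> connected_components_of Y \<and>
     subtopology Y C homeomorphic_space top_of_set {0..1::real}"

definition arc_endpoints :: "'a topology \<Rightarrow> 'a set \<Rightarrow> 'a \<Rightarrow> 'a \<Rightarrow> bool" where
  "arc_endpoints Y C p q \<longleftrightarrow>
     (\<exists>\<gamma>. homeomorphic_map (top_of_set {0..1::real}) (subtopology Y C) \<gamma> \<and> \<gamma> 0 = p \<and> \<gamma> 1 = q)"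

text \<open>Like the finite structures, fences are taken to be nonempty.\<close>

definition fence :: "'a topology \<Rightarrow> bool" where
  "fence Y \<longleftrightarrow>
     topspace Y \<noteq> {} \<and> compact_space Y \<and> metrizable_space Y \<and>
     (\<forall>C \<in> connected_components_of Y. (\<exists>y. C = {y}) \<or> arc_component Y C)"

definition smooth_fence :: "'a topology \<Rightarrow> bool" where
  "smooth_fence Y \<longleftrightarrow>
     fence Y \<and>
     (\<exists>r. closedin (prod_topology Y Y) r \<and> partial_order_on (topspace Y) r \<and>
          (\<forall>C \<in> connected_components_of Y. total_on C r))"

end

theory Submission
  imports Defs
begin

text \<open>A monotone version of Urysohn's lemma (Nachbin) yields, for a closed preorder on a compact
  metrizable space, a continuous strictly monotone real function. On a smooth fence it is injective
  on the components, so that a component becomes an interval. The condition on open sets then says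
  that the subintervals of the image of a component \<open>C\<close> are approximated, endpoint by endpoint, by
  the images of the arc components near \<open>C\<close>.

  Two fences with this property are homeomorphic by a back-and-forth argument: one matches the pieces
  of finer and finer finite clopen partitions so that matched pieces contain arc components with the
  same image, and so that this image almost exhausts the image of the piece. The closed relations
  ``in matched pieces and at almost the same height'' decrease to the graph of a homeomorphism.

  For the projective limit, universality and homogeneity imply that epimorphisms lift along
  epimorphisms of forests. Every Hasse forest is the image of a disjoint union of chains, hence
  \<open>R\<close> has classes of at most two points, comparability is an equivalence relation whose classes are the
  components of the quotient, and a chain joining two prescribed points of a forest produces the
  required arc component.\<close>

section \<open>Monotone functions on compact preordered spaces\<close>

text \<open>The heights of two fences bear no relation to each other, so every matched pair of
  pieces carries heights of its own, reparametrised at each stage. The obstacle is that the slopes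
  of these reparametrisations cannot be controlled: an arc may have to be matched with a much
  shorter one. Errors are therefore measured in the current heights, which are required to expand
  the original \<open>t\<close> and \<open>s\<close>; an error in a current height then bounds the
  error in the original one. Only one pair of arcs per piece is matched exactly, and the rest of the
  piece is controlled by its image alone. A stage thus yields a closed relation and not a map; the
  map appears only in the limit, by compactness.

  Points are separated by the height within a component and by countably many clopen sets across
  components. Countability, here and for the strictly monotone function, enters as a Lindelof
  property of the square of the space. In this form it passes to continuous images and so reaches
  the quotient of the limit without a metric on it.\<close>

lemma dyadic_between:
  fixes c d :: real
  assumes "0 \<le> c" "c < d" "d \<le> 1"
  obtains r where "r \<in> dyadics" "0 \<le> r" "r \<le> 1" "c < r" "r < d"
proof -
  have "d - c > 0" "(2::real) > 1" using assms by auto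
  then obtain n q r where r: "real q / 2 ^ n \<le> c" "c < real r / 2 ^ n" "\<bar>real q / 2 ^ n - real r / 2 ^ n\<bar> < d - c"
    by (rule padic_rational_approximation_straddle_pos_le[OF _ _ assms(1)])
  moreover have "real r / 2 ^ n \<in> dyadics" unfolding dyadics_def by blast
  moreover have "real r / 2 ^ n < d" using r by linarith
  ultimately show thesis using that[of "real r / 2 ^ n"] assms by linarith
qed

locale compact_preorder =
  fixes X :: "'a topology" and S :: "('a \<times> 'a) set"
  assumes comp: "compact_space X" and haus: "Hausdorff_space X"
    and closed_S: "closedin (prod_topology X X) S"
    and refl_S: "\<And>x. x \<in> topspace X \<Longrightarrow> (x, x) \<in> S"
    and trans_S: "\<And>x y z. (x, y) \<in> S \<Longrightarrow> (y, z) \<in> S \<Longrightarrow> (x, z) \<in> S"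
begin

lemma S_topspace:
  assumes "(x, y) \<in> S" shows "x \<in> topspace X" "y \<in> topspace X"
  using closedin_subset[OF closed_S] assms by auto

definition lower :: "'a set \<Rightarrow> bool" where
  "lower L \<longleftrightarrow> (\<forall>u v. (u, v) \<in> S \<longrightarrow> v \<in> L \<longrightarrow> u \<in> L)"

lemma closedin_down:
  assumes "closedin X K" shows "closedin X {u. \<exists>v\<in>K. (u, v) \<in> S}"
proof -
  have "closedin (prod_topology X X) (S \<inter> topspace X \<times> K)"
    using closed_S assms by (simp add: closedin_Int closedin_prod_Times_iff)
  then have "closedin X (fst ` (S \<inter> topspace X \<times> K))"
    using closed_map_fst[OF comp, of X] closed_map_def by blast
  moreover have "fst ` (S \<inter> topspace X \<times> K) = {u. \<exists>v\<in>K. (u, v) \<in> S}"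
    using S_topspace by (force simp: image_iff)
  ultimately show ?thesis by simp
qed

lemma closedin_up:
  assumes "closedin X K" shows "closedin X {v. \<exists>u\<in>K. (u, v) \<in> S}"
proof -
  have "closedin (prod_topology X X) (S \<inter> K \<times> topspace X)"
    using closed_S assms by (simp add: closedin_Int closedin_prod_Times_iff)
  then have "closedin X (snd ` (S \<inter> K \<times> topspace X))"
    using closed_map_snd[OF comp, of X] closed_map_def by blast
  moreover have "snd ` (S \<inter> K \<times> topspace X) = {v. \<exists>u\<in>K. (u, v) \<in> S}"
    using S_topspace by (force simp: image_iff)
  ultimately show ?thesis by simp
qed

text \<open>Normality separates \<open>D\<close> from the complement of \<open>V\<close> by open
  \<open>G\<close> and \<open>H\<close>. The largest lower subset of \<open>G\<close> is open
  because up-sets of closed sets are closed, and the down-set of the complement of \<open>H\<close>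
  is closed; these two make the intermediate sets lower.\<close>

lemma interpolate_lower:
  assumes D: "closedin X D" "lower D" and V: "openin X V" "lower V" and DV: "D \<subseteq> V"
  shows "\<exists>U K. openin X U \<and> lower U \<and> closedin X K \<and> lower K \<and> D \<subseteq> U \<and> U \<subseteq> K \<and> K \<subseteq> V"
proof -
  have "normal_space X" using comp haus compact_Hausdorff_or_regular_imp_normal_space by blast
  moreover have "closedin X (topspace X - V)" "disjnt D (topspace X - V)"
    using V(1) DV by (auto simp: disjnt_def)
  ultimately obtain G H where GH: "openin X G" "openin X H" "D \<subseteq> G" "topspace X - V \<subseteq> H" "disjnt G H"
    using D(1) unfolding normal_space_def by metis
  define U where "U = topspace X - {v. \<exists>u\<in>topspace X - G. (u, v) \<in> S}"
  define K where "K = {u. \<exists>v\<in>topspace X - H. (u, v) \<in> S}"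
  have "openin X U" unfolding U_def using closedin_up[of "topspace X - G"] GH(1) by blast
  moreover have "closedin X K" unfolding K_def using closedin_down[of "topspace X - H"] GH(2) by blast
  moreover have "lower U" unfolding U_def lower_def using trans_S S_topspace by blast
  moreover have "lower K" unfolding K_def lower_def using trans_S by blast
  moreover have "D \<subseteq> U"
    using closedin_subset[OF D(1)] D(2) GH(3) unfolding U_def lower_def by blast
  moreover have "U \<subseteq> K"
  proof
    fix z assume z: "z \<in> U"
    then have zX: "z \<in> topspace X" by (simp add: U_def)
    then have "z \<in> G" using z refl_S unfolding U_def by blast
    then have "z \<in> topspace X - H" using GH(5) zX by (auto simp: disjnt_iff)
    then show "z \<in> K" using refl_S[OF zX] unfolding K_def by blast
  qed
  moreover have "K \<subseteq> V"
  proof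
    fix z assume "z \<in> K"
    then obtain v where v: "v \<in> topspace X" "v \<notin> H" "(z, v) \<in> S" by (auto simp: K_def)
    then have "v \<in> V" using GH(4) by blast
    then show "z \<in> V" using V(2) v(3) by (auto simp: lower_def)
  qed
  ultimately show ?thesis by blast
qed

text \<open>Urysohn's construction over the dyadic rationals with all sets kept lower: a point below
  \<open>v\<close> lies in every set that contains \<open>v\<close>, so the infimum of the indices
  is monotone. The closed sets interpolated by \<open>R\<close> yield continuity.\<close>

lemma monotone_separation:
  assumes xy: "x \<in> topspace X" "y \<in> topspace X" "(y, x) \<notin> S"
  obtains f where "continuous_map X euclideanreal f" "\<And>u v. (u, v) \<in> S \<Longrightarrow> f u \<le> f v"
    "\<And>z. 0 \<le> f z \<and> f z \<le> 1" "f x = 0" "f y = (1::real)"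
proof -
  define V where "V = topspace X - {v. \<exists>u\<in>{y}. (u, v) \<in> S}"
  define D where "D = {u. \<exists>v\<in>{x}. (u, v) \<in> S}"
  define R where "R U W \<longleftrightarrow> openin X U \<and> openin X W \<and> lower U \<and> lower W \<and>
      (\<exists>K. closedin X K \<and> lower K \<and> U \<subseteq> K \<and> K \<subseteq> W)" for U W
  have cl: "closedin X {x}" "closedin X {y}"
    using xy haus by (simp_all add: closedin_Hausdorff_sing_eq)
  have V: "openin X V" "lower V"
    unfolding V_def lower_def using closedin_up[OF cl(2)] trans_S S_topspace by blast+
  have D: "closedin X D" "lower D"
    unfolding D_def lower_def using closedin_down[OF cl(1)] trans_S by blast+
  have "D \<subseteq> V" unfolding D_def V_def using xy(3) trans_S S_topspace by blast
  then obtain U K where UK: "openin X U" "lower U" "closedin X K" "lower K" "D \<subseteq> U" "U \<subseteq> K" "K \<subseteq> V"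
    using interpolate_lower[OF D V] by blast
  have "\<exists>G :: real \<Rightarrow> 'a set. G 0 = U \<and> G 1 = V \<and>
               (\<forall>x \<in> dyadics \<inter> {0..1}. \<forall>y \<in> dyadics \<inter> {0..1}. x < y \<longrightarrow> R (G x) (G y))"
  proof (rule recursion_on_dyadic_fractions)
    show "R U V" unfolding R_def using UK V by blast
    show "\<exists>C. R A C \<and> R C B" if AB: "R A B" for A B
    proof -
      obtain K where K: "openin X A" "openin X B" "lower A" "lower B" "closedin X K" "lower K" "A \<subseteq> K" "K \<subseteq> B"
        using AB unfolding R_def by blast
      obtain C L where "openin X C" "lower C" "closedin X L" "lower L" "K \<subseteq> C" "C \<subseteq> L" "L \<subseteq> B"
        using interpolate_lower[OF K(5,6,2,4,8)] by blast
      then show ?thesis unfolding R_def using K by blast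
    qed
    show "R A C" if "R A B" "R B C" for A B C
      using that unfolding R_def by (meson order_trans)
  qed
  then obtain G :: "real \<Rightarrow> 'a set" where G0: "G 0 = U" and G1: "G 1 = V"
    and G: "\<And>r q. r \<in> dyadics \<Longrightarrow> q \<in> dyadics \<Longrightarrow> 0 \<le> r \<Longrightarrow> r < q \<Longrightarrow> q \<le> 1 \<Longrightarrow> R (G r) (G q)"
    by (metis (no_types, lifting) IntI atLeastAtMost_iff less_imp_le order_trans)
  define Q where "Q = (dyadics :: real set) \<inter> {0..1}"
  have Q01: "0 \<in> Q" "1 \<in> Q" using real_in_dyadics[of 0] real_in_dyadics[of 1] by (auto simp: Q_def)
  have RQ: "R (G r) (G q)" if "r \<in> Q" "q \<in> Q" "r < q" for r q using that G by (auto simp: Q_def)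
  have subG: "G r \<subseteq> G q" if "r \<in> Q" "q \<in> Q" "r \<le> q" for r q
    using RQ[OF that(1,2)] that(3) unfolding R_def by (cases "r = q") auto
  have opG: "openin X (G r)" "lower (G r)" if "r \<in> Q" for r
  proof -
    have "r < 1 \<or> 0 < r" by linarith
    then have "R (G r) (G 1) \<or> R (G 0) (G r)"
      using RQ[OF that Q01(2)] RQ[OF Q01(1) that] by blast
    then show "openin X (G r)" "lower (G r)" unfolding R_def by auto
  qed
  \<comment> \<open>Inserting \<open>1\<close> gives the value \<open>1\<close> to points that lie
    in no \<open>G r\<close> and keeps the infimum over a nonempty set, also outside the
    space.\<close>
  define f where "f z = Inf (insert 1 {r \<in> Q. z \<in> G r})" for z
  have bdd: "bdd_below (insert 1 {r \<in> Q. z \<in> G r})" for z by (rule bdd_belowI[of _ 0]) (auto simp: Q_def)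
  have fle1: "f z \<le> 1" for z unfolding f_def by (rule cInf_lower[OF _ bdd]) simp
  have fle: "f z \<le> r" if "r \<in> Q" "z \<in> G r" for z r unfolding f_def by (rule cInf_lower[OF _ bdd]) (use that in simp)
  have fge: "c \<le> f z" if "c \<le> 1" "\<And>r. r \<in> Q \<Longrightarrow> z \<in> G r \<Longrightarrow> c \<le> r" for z c
    unfolding f_def by (rule cInf_greatest) (use that in auto)
  have f0: "0 \<le> f z" for z by (rule fge) (auto simp: Q_def)
  have fnot: "r \<le> f z" if "r \<in> Q" "z \<notin> G r" for z r
  proof (rule fge)
    show "r \<le> 1" using that by (simp add: Q_def)
    fix q assume "q \<in> Q" "z \<in> G q"
    then show "r \<le> q" using subG[of q r] that by force
  qed
  have dense: "\<exists>r\<in>Q. c < r \<and> r < d" if cd: "0 \<le> c" "c < d" "d \<le> 1" for c d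
  proof -
    obtain r where "r \<in> dyadics" "0 \<le> r" "r \<le> 1" "c < r" "r < d" by (rule dyadic_between[OF cd])
    then show ?thesis unfolding Q_def by auto
  qed
  have cont: "continuous_map X euclideanreal f"
    unfolding continuous_map_upper_lower_semicontinuous_lt
  proof (intro conjI allI)
    fix c :: real
    show "openin X {z \<in> topspace X. f z < c}"
    proof (cases "c > 1")
      case True
      then have "{z \<in> topspace X. f z < c} = topspace X" using fle1 by (auto intro: le_less_trans)
      then show ?thesis by simp
    next
      case False
      have "{z \<in> topspace X. f z < c} = (\<Union>r\<in>{r\<in>Q. r < c}. G r)"
      proof (intro equalityI subsetI)
        fix z assume "z \<in> {z \<in> topspace X. f z < c}"
        then have "f z < c" by simp
        then obtain r where "r \<in> Q" "f z < r" "r < c" using dense[OF f0, of z c] False by auto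
        moreover have "z \<in> G r" using fnot[of r z] calculation by force
        ultimately show "z \<in> (\<Union>r\<in>{r\<in>Q. r < c}. G r)" by blast
      next
        fix z assume "z \<in> (\<Union>r\<in>{r\<in>Q. r < c}. G r)"
        then obtain r where r: "r \<in> Q" "r < c" "z \<in> G r" by blast
        then have "z \<in> topspace X" using opG(1) openin_subset by blast
        then show "z \<in> {z \<in> topspace X. f z < c}" using fle[OF r(1,3)] r(2) by simp
      qed
      then show ?thesis using opG(1) by (auto intro!: openin_Union)
    qed
    show "openin X {z \<in> topspace X. c < f z}"
    proof (cases "c < 0")
      case True
      then have "{z \<in> topspace X. c < f z} = topspace X" using f0 by (auto intro: less_le_trans)
      then show ?thesis by simp
    next
      case False
      have "{z \<in> topspace X. c < f z} =
          \<Union>{topspace X - K | K r. closedin X K \<and> r \<in> Q \<and> c < r \<and> G r \<subseteq> K}"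
      proof (intro equalityI subsetI)
        fix z assume z: "z \<in> {z \<in> topspace X. c < f z}"
        then obtain r where r: "r \<in> Q" "c < r" "r < f z" using dense[of c "f z"] False fle1 by auto
        \<comment> \<open>The second index leaves room for a closed set between \<open>G r\<close>
          and \<open>G q\<close>; its complement is a neighbourhood of \<open>z\<close> on which
          \<open>f\<close> exceeds \<open>c\<close>.\<close>
        obtain q where q: "q \<in> Q" "r < q" "q < f z" using dense[of r "f z"] r fle1 by (auto simp: Q_def)
        obtain K where K: "closedin X K" "G r \<subseteq> K" "K \<subseteq> G q" using RQ[OF r(1) q(1,2)] unfolding R_def by blast
        have "z \<notin> K" using fle[OF q(1), of z] q(3) K(3) by force
        then show "z \<in> \<Union>{topspace X - K | K r. closedin X K \<and> r \<in> Q \<and> c < r \<and> G r \<subseteq> K}"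
          using z K r by blast
      next
        fix z assume "z \<in> \<Union>{topspace X - K | K r. closedin X K \<and> r \<in> Q \<and> c < r \<and> G r \<subseteq> K}"
        then obtain K r where "z \<in> topspace X" "z \<notin> K" "r \<in> Q" "c < r" "G r \<subseteq> K" by blast
        then show "z \<in> {z \<in> topspace X. c < f z}" using fnot[of r z] by force
      qed
      moreover have "openin X (\<Union>{topspace X - K | K r. closedin X K \<and> r \<in> Q \<and> c < r \<and> G r \<subseteq> K})"
        by (rule openin_Union) auto
      ultimately show ?thesis by simp
    qed
  qed
  have mono: "f u \<le> f v" if uv: "(u, v) \<in> S" for u v
  proof (rule fge[OF fle1])
    fix r assume r: "r \<in> Q" "v \<in> G r"
    then have "u \<in> G r" using opG(2) uv by (auto simp: lower_def)
    then show "f u \<le> r" by (rule fle[OF r(1)])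
  qed
  have "x \<in> D" unfolding D_def using refl_S xy by blast
  then have "f x \<le> 0" using fle[OF Q01(1)] G0 UK(5) by blast
  then have "f x = 0" using f0 by (simp add: antisym)
  have "y \<notin> V" unfolding V_def using refl_S xy by blast
  then have "1 \<le> f y" using fnot[OF Q01(2)] G1 by blast
  then have "f y = 1" using fle1 by (simp add: antisym)
  show thesis by (rule that[OF cont mono _ \<open>f x = 0\<close> \<open>f y = 1\<close>]) (use f0 fle1 in auto)
qed

text \<open>Each strict pair is separated by some monotone \<open>f\<close>, that is, it lies in the
  open set \<open>O' f\<close> of the square. \<open>Lin\<close> selects countably many of these
  sets, and a geometrically weighted sum of their functions increases strictly on every strict
  pair.\<close>

lemma strict_monotone_fun:
  assumes Lin: "\<And>\<U>. \<forall>U\<in>\<U>. openin (prod_topology X X) U \<Longrightarrow> \<exists>\<V>\<subseteq>\<U>. countable \<V> \<and> \<Union>\<V> = \<Union>\<U>"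
  obtains f where "continuous_map X euclideanreal f" "\<And>u v. (u, v) \<in> S \<Longrightarrow> f u \<le> f v"
    "\<And>u v. (u, v) \<in> S \<Longrightarrow> (v, u) \<notin> S \<Longrightarrow> f u < (f v :: real)"
proof -
  define \<F> where "\<F> = {f. continuous_map X euclideanreal f \<and> (\<forall>u v. (u, v) \<in> S \<longrightarrow> f u \<le> f v) \<and>
      (\<forall>z. 0 \<le> f z \<and> f z \<le> (1::real))}"
  define O' where "O' f = {z \<in> topspace (prod_topology X X). f (fst z) < f (snd z)}" for f :: "'a \<Rightarrow> real"
  have "openin (prod_topology X X) (O' f)" if "f \<in> \<F>" for f
  proof -
    have cf: "continuous_map X euclideanreal f" using that by (simp add: \<F>_def)
    have "continuous_map (prod_topology X X) euclideanreal (\<lambda>z. f (snd z) - f (fst z))"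
      by (intro continuous_intros continuous_map_compose[OF continuous_map_fst cf, unfolded o_def]
          continuous_map_compose[OF continuous_map_snd cf, unfolded o_def])
    then have "openin (prod_topology X X) {z \<in> topspace (prod_topology X X). f (snd z) - f (fst z) \<in> {0<..}}"
      by (rule openin_continuous_map_preimage) auto
    then show ?thesis by (simp add: O'_def)
  qed
  then obtain \<V> where V: "\<V> \<subseteq> O' ` \<F>" "countable \<V>" "\<Union>\<V> = \<Union>(O' ` \<F>)"
    using Lin[of "O' ` \<F>"] by blast
  obtain \<G> where G: "\<G> \<subseteq> \<F>" "countable \<G>" "\<V> = O' ` \<G>"
    using V(1,2) countable_subset_image[of \<V> O' \<F>] by auto
  \<comment> \<open>The zero function makes the family enumerated by \<open>from_nat_into\<close>
    nonempty and contributes nothing to the sum.\<close>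
  have "(\<lambda>z. 0) \<in> \<F>" by (simp add: \<F>_def)
  define h where "h = from_nat_into (insert (\<lambda>z. 0) \<G>)"
  have rh: "range h = insert (\<lambda>z. 0) \<G>"
    unfolding h_def using G(2) by (intro range_from_nat_into) auto
  have hF: "h n \<in> \<F>" for n using rh G(1) \<open>(\<lambda>z. 0) \<in> \<F>\<close> by (metis insert_iff rangeI subsetD)
  then have hc: "continuous_map X euclideanreal (h n)" and hm: "(u, v) \<in> S \<Longrightarrow> h n u \<le> h n v"
    and h01: "0 \<le> h n z" "h n z \<le> 1" for n u v z by (auto simp: \<F>_def)
  have strict: "\<exists>n. h n u < h n v" if uv: "(u, v) \<in> S" "(v, u) \<notin> S" for u v
  proof -
    have X: "u \<in> topspace X" "v \<in> topspace X" using S_topspace uv(1) by auto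
    obtain f where "continuous_map X euclideanreal f" "\<And>u v. (u, v) \<in> S \<Longrightarrow> f u \<le> f v"
       "\<And>z. 0 \<le> f z \<and> f z \<le> 1" "f u = 0" "f v = (1::real)"
      using monotone_separation[OF X uv(2)] by metis
    then have "f \<in> \<F>" "(u, v) \<in> O' f" using X by (auto simp: \<F>_def O'_def)
    then have "(u, v) \<in> \<Union>\<V>" unfolding V(3) by blast
    then obtain g where "g \<in> \<G>" "(u, v) \<in> O' g" unfolding G(3) by blast
    then show ?thesis using rh unfolding O'_def by (metis (mono_tags, lifting) fst_conv insertI2 mem_Collect_eq rangeE snd_conv)
  qed
  define t where "t z = (\<Sum>n. h n z * (1/2) ^ n)" for z
  have sm: "summable (\<lambda>n. h n z * (1/2) ^ n)" for z
  proof (rule summable_comparison_test)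
    show "\<exists>N. \<forall>n\<ge>N. norm (h n z * (1/2) ^ n) \<le> (1/2) ^ n"
      using h01 by (auto simp: abs_mult intro!: mult_left_le_one_le)
    show "summable (\<lambda>n. (1/2::real) ^ n)" by (rule summable_geometric) simp
  qed
  have mono: "t u \<le> t v" if "(u, v) \<in> S" for u v
    unfolding t_def by (rule suminf_le[OF _ sm sm]) (use hm[OF that] in \<open>simp add: mult_right_mono\<close>)
  have st: "t u < t v" if uv: "(u, v) \<in> S" "(v, u) \<notin> S" for u v
  proof -
    obtain m where m: "h m u < h m v" using strict[OF uv] by blast
    have "0 < (\<Sum>n. h n v * (1/2) ^ n - h n u * (1/2) ^ n)"
    proof (rule suminf_pos2[where i = m])
      show "summable (\<lambda>n. h n v * (1/2) ^ n - h n u * (1/2) ^ n)" by (rule summable_diff[OF sm sm])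
      show "0 \<le> h n v * (1/2) ^ n - h n u * (1/2) ^ n" for n
        using hm[OF uv(1), of n] by (simp add: mult_right_mono)
      show "0 < h m v * (1/2) ^ m - h m u * (1/2) ^ m" using m by simp
    qed
    also have "\<dots> = t v - t u" unfolding t_def by (rule suminf_diff[OF sm sm, symmetric])
    finally show ?thesis by simp
  qed
  have "continuous_map X euclideanreal t"
  proof -
    have "continuous_map X Met_TC.mtopology t"
    proof (rule Met_TC.continuous_map_uniform_limit[where F = sequentially and f = "\<lambda>N z. \<Sum>n<N. h n z * (1/2) ^ n"])
      show "\<forall>\<^sub>F N in sequentially. continuous_map X Met_TC.mtopology (\<lambda>z. \<Sum>n<N. h n z * (1/2) ^ n)"
        by (intro always_eventually allI) (simp add: hc continuous_map_sum continuous_map_real_mult_right)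
      fix e :: real assume "e > 0"
      have "uniform_limit (topspace X) (\<lambda>N z. \<Sum>n<N. h n z * (1/2) ^ n) t sequentially"
        unfolding t_def
      proof (rule Weierstrass_m_test)
        show "norm (h n z * (1/2) ^ n) \<le> (1/2) ^ n" for n z
          using h01 by (auto simp: abs_mult intro!: mult_left_le_one_le)
        show "summable (\<lambda>n. (1/2::real) ^ n)" by (rule summable_geometric) simp
      qed
      then show "\<forall>\<^sub>F N in sequentially. \<forall>z\<in>topspace X. t z \<in> UNIV \<and> dist (\<Sum>n<N. h n z * (1/2) ^ n) (t z) < e"
        using \<open>e > 0\<close> by (simp add: uniform_limit_iff)
    qed simp
    then show ?thesis by simp
  qed
  then show thesis using that[of t] mono st by blast
qed

end

section \<open>Clopen partitions and dense arcs\<close>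

abbreviation clopenin :: "'a topology \<Rightarrow> 'a set \<Rightarrow> bool" where
  "clopenin X U \<equiv> openin X U \<and> closedin X U"

text \<open>Components and quasi-components coincide in a compact Hausdorff space. The cited theorem
  separates the whole space into open \<open>U\<close> and \<open>V\<close>, so \<open>U\<close> is
  closed as well.\<close>

lemma clopen_nbhd_of_component:
  assumes "compact_space X" "Hausdorff_space X" "C \<in> connected_components_of X" "openin X W" "C \<subseteq> W"
  obtains U where "clopenin X U" "C \<subseteq> U" "U \<subseteq> W"
proof -
  have "compactin X C"
    using assms by (simp add: closedin_compact_space closedin_connected_components_of)
  then obtain U V where UV: "openin X U" "openin X V" "disjnt U V" "U \<union> V = topspace X" "C \<subseteq> U" "U \<subseteq> W"
    using wilder_locally_compact_component_thm[of X C W] assms compact_imp_locally_compact_space by blast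
  have "U = topspace X - V"
    using UV(3,4) by (auto simp: disjnt_def)
  then have "closedin X U"
    using UV(2) by blast
  then show thesis using UV that by blast
qed

lemma component_clopen_cases:
  assumes "C \<in> connected_components_of X" "clopenin X U"
  shows "C \<subseteq> U \<or> C \<inter> U = {}"
  using connectedin_clopen_cases[OF connectedin_connected_components_of[OF assms(1)], of U] assms(2)
  by (auto simp: disjnt_def)

lemma ex_component:
  assumes "x \<in> topspace X"
  obtains C where "C \<in> connected_components_of X" "x \<in> C"
  using assms by (metis UnionE Union_connected_components_of)

lemma components_disjoint:
  assumes "C \<in> connected_components_of X" "D \<in> connected_components_of X" "C \<noteq> D"
  shows "C \<inter> D = {}"
  using assms pairwise_disjoint_connected_components_of by (metis disjnt_def pairwiseD)

lemma component_image_interval: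
  fixes f :: "'a \<Rightarrow> real"
  assumes "compact_space X" "C \<in> connected_components_of X" "continuous_map X euclideanreal f"
  obtains a b where "a \<le> b" "f ` C = {a..b}"
proof -
  have "compactin X C"
    using assms by (simp add: closedin_compact_space closedin_connected_components_of)
  then have "compact (f ` C)"
    using assms(3) image_compactin compactin_euclidean_iff by blast
  moreover have "connected (f ` C)"
    using assms connectedin_continuous_map_image connectedin_connected_components_of connectedin_iff_connected by metis
  ultimately obtain a b where "f ` C = {a..b}"
    by (metis connected_compact_interval_1)
  moreover have "C \<noteq> {}" using assms(2) nonempty_connected_components_of by blast
  ultimately show thesis using that by (metis atLeastatMost_empty_iff2 image_is_empty)
qed

text \<open>Plain disjointification of the sets \<open>N D\<close> could remove a component
  \<open>D\<close> from the set that should contain it. Here \<open>D\<close> first receives a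
  clopen neighbourhood \<open>M\<close> missing the other listed components, and its piece gives up
  only those points of the other neighbourhoods that lie outside \<open>M\<close>.\<close>

lemma clopen_partition_aux:
  assumes X: "compact_space X" "Hausdorff_space X"
    and "finite \<D>" "\<D> \<subseteq> connected_components_of X"
    and "\<And>D. D \<in> \<D> \<Longrightarrow> clopenin X (N D) \<and> D \<subseteq> N D"
    and "clopenin X U" "\<Union>\<D> \<subseteq> U" "U \<subseteq> \<Union>(N ` \<D>)"
  shows "\<exists>W. (\<forall>D\<in>\<D>. clopenin X (W D) \<and> D \<subseteq> W D \<and> W D \<subseteq> N D \<inter> U) \<and>
             disjoint_family_on W \<D> \<and> \<Union>(W ` \<D>) = U"
  using assms(3-)
proof (induction \<D> arbitrary: U rule: finite_induct)
  case empty
  then show ?case by (auto simp: disjoint_family_on_def)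
next
  case (insert D \<D>)
  have cl: "closedin X (\<Union>\<D>)"
    using insert.prems(1) insert.hyps(1) closedin_connected_components_of by (metis closedin_Union insert_subset subsetD)
  have "D \<subseteq> topspace X - \<Union>\<D>"
    using insert.prems(1) insert.hyps(2) components_disjoint[of D X] connected_components_of_subset[of D X] by blast
  then obtain M where M: "clopenin X M" "D \<subseteq> M" "M \<subseteq> topspace X - \<Union>\<D>"
    using clopen_nbhd_of_component[OF X, of D "topspace X - \<Union>\<D>"] cl insert.prems(1) by blast
  define R where "R = \<Union>(N ` \<D>) - M"
  define W0 where "W0 = N D \<inter> U - R"
  have "clopenin X (\<Union>(N ` \<D>))"
    using insert.prems(2) insert.hyps(1) by (auto intro!: openin_Union closedin_Union)
  then have R: "clopenin X R" using M by (auto simp: R_def)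
  then have W0: "clopenin X W0"
    using insert.prems(2)[of D] insert.prems(3) by (auto simp: W0_def)
  have 1: "\<Union>\<D> \<subseteq> U - W0"
  proof
    fix x assume "x \<in> \<Union>\<D>"
    then obtain E where E: "E \<in> \<D>" "x \<in> E" by blast
    then have "x \<in> R" using M(3) insert.prems(2)[of E] unfolding R_def by blast
    moreover have "x \<in> U" using insert.prems(4) E by blast
    ultimately show "x \<in> U - W0" by (simp add: W0_def)
  qed
  have 2: "U - W0 \<subseteq> \<Union>(N ` \<D>)"
    using insert.prems(5) unfolding W0_def R_def by blast
  have 3: "clopenin X (U - W0)" using insert.prems(3) W0 by auto
  have 4: "\<D> \<subseteq> connected_components_of X" using insert.prems(1) by simp
  obtain W where W: "\<forall>D\<in>\<D>. clopenin X (W D) \<and> D \<subseteq> W D \<and> W D \<subseteq> N D \<inter> (U - W0)"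
      "disjoint_family_on W \<D>" "\<Union>(W ` \<D>) = U - W0"
    using insert.IH[OF 4 insert.prems(2) 3 1 2] by (metis insertI2)
  have DW: "D \<subseteq> W0"
    using insert.prems(2)[of D] insert.prems(4) M(2) unfolding W0_def R_def by blast
  show ?case
  proof (intro exI[of _ "W(D := W0)"] conjI ballI)
    fix E assume E: "E \<in> insert D \<D>"
    show "openin X ((W(D := W0)) E)" "closedin X ((W(D := W0)) E)" "E \<subseteq> (W(D := W0)) E"
      using E W(1) W0 DW by auto
    show "(W(D := W0)) E \<subseteq> N E \<inter> U"
    proof (cases "E = D")
      case True then show ?thesis unfolding W0_def by auto
    next
      case False then show ?thesis using W(1) E by auto
    qed
  next
    have "W E \<inter> W0 = {}" if "E \<in> \<D>" for E using W(1) that by blast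
    then show "disjoint_family_on (W(D := W0)) (insert D \<D>)"
      using W(2) insert.hyps(2) unfolding disjoint_family_on_def by auto
  next
    have "W0 \<subseteq> U" by (auto simp: W0_def)
    moreover have "(W(D := W0)) ` insert D \<D> = insert W0 (W ` \<D>)"
      using insert.hyps(2) by auto
    ultimately show "\<Union> ((W(D := W0)) ` insert D \<D>) = U"
      using W(3) by auto
  qed
qed

text \<open>\<open>C\<close> is put among the chosen components in advance: when a tile is refined,
  the arc component it was built around has to keep a piece of its own.\<close>

lemma clopen_partition:
  assumes X: "compact_space X" "Hausdorff_space X"
    and U: "clopenin X U" and C: "C \<in> connected_components_of X" "C \<subseteq> U"
    and N: "\<And>D. D \<in> connected_components_of X \<Longrightarrow> D \<subseteq> U \<Longrightarrow> clopenin X (N D) \<and> D \<subseteq> N D"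
  obtains \<D> W where "finite \<D>" "\<D> \<subseteq> {D \<in> connected_components_of X. D \<subseteq> U}" "C \<in> \<D>"
    "\<And>D. D \<in> \<D> \<Longrightarrow> clopenin X (W D) \<and> D \<subseteq> W D \<and> W D \<subseteq> N D \<inter> U"
    "disjoint_family_on W \<D>" "\<Union>(W ` \<D>) = U"
proof -
  let ?K = "{D \<in> connected_components_of X. D \<subseteq> U}"
  have "compactin X U" using X U closedin_compact_space by blast
  moreover have "U \<subseteq> \<Union>(N ` ?K)"
  proof
    fix x assume x: "x \<in> U"
    then obtain D where D: "D \<in> connected_components_of X" "x \<in> D"
      using U ex_component openin_subset by (metis subsetD)
    then have "D \<subseteq> U" using component_clopen_cases U x by blast
    then show "x \<in> \<Union>(N ` ?K)" using D N by blast
  qed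
  moreover have "\<forall>V \<in> N ` ?K. openin X V" using N by auto
  ultimately obtain \<F> where F: "finite \<F>" "\<F> \<subseteq> N ` ?K" "U \<subseteq> \<Union>\<F>"
    unfolding compactin_def by meson
  then obtain \<D>0 where D0: "finite \<D>0" "\<D>0 \<subseteq> ?K" "\<F> = N ` \<D>0"
    by (meson finite_subset_image)
  let ?D = "insert C \<D>0"
  have 1: "finite ?D" and 2: "?D \<subseteq> ?K" using D0 C by auto
  have 3: "?D \<subseteq> connected_components_of X" "\<Union>?D \<subseteq> U" using 2 by auto
  have 4: "\<And>D. D \<in> ?D \<Longrightarrow> clopenin X (N D) \<and> D \<subseteq> N D" using 2 N by blast
  have 5: "U \<subseteq> \<Union>(N ` ?D)" using F(3) D0(3) by auto
  obtain W where "\<forall>D\<in>?D. clopenin X (W D) \<and> D \<subseteq> W D \<and> W D \<subseteq> N D \<inter> U"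
     "disjoint_family_on W ?D" "\<Union>(W ` ?D) = U"
    using clopen_partition_aux[OF X 1 3(1) 4 U 3(2) 5] by metis
  then show thesis
    using that[OF 1 2, of W] by blast
qed

text \<open>The arc condition read through a height; \<open>dense_arcsI\<close> and
  \<open>joins_arcsI\<close> translate in both directions. The case \<open>x = y\<close> is
  included, so points are approximated by short arcs, which is how degenerate components are
  handled.\<close>

definition dense_arcs :: "'a topology \<Rightarrow> ('a \<Rightarrow> real) \<Rightarrow> bool" where
  "dense_arcs X f \<longleftrightarrow>
     (\<forall>C \<in> connected_components_of X. \<forall>x \<in> f ` C. \<forall>y \<in> f ` C. x \<le> y \<longrightarrow>
       (\<forall>U e. clopenin X U \<and> C \<subseteq> U \<and> e > 0 \<longrightarrow>
          (\<exists>D a b. D \<in> connected_components_of X \<and> D \<subseteq> U \<and> f ` D = {a..b} \<and> a < b \<and>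
                   \<bar>a - x\<bar> < e \<and> \<bar>b - y\<bar> < e)))"

lemma dense_arcsE:
  assumes "dense_arcs X f" "C \<in> connected_components_of X" "x \<in> f ` C" "y \<in> f ` C" "x \<le> y"
    "clopenin X U" "C \<subseteq> U" "e > 0"
  obtains D a b where "D \<in> connected_components_of X" "D \<subseteq> U" "f ` D = {a..b}" "a < b"
    "\<bar>a - x\<bar> < e" "\<bar>b - y\<bar> < e"
  using assms unfolding dense_arcs_def by (smt (verit, best))

lemma continuous_mono_image_interval:
  fixes G :: "real \<Rightarrow> real"
  assumes "continuous_on UNIV G" "mono G" "a \<le> b"
  shows "G ` {a..b} = {G a..G b}"
proof
  show "G ` {a..b} \<subseteq> {G a..G b}" using assms(2) by (auto simp: mono_def)
  show "{G a..G b} \<subseteq> G ` {a..b}"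
  proof
    fix y assume "y \<in> {G a..G b}"
    then have "\<exists>x\<ge>a. x \<le> b \<and> G x = y"
      using assms by (intro IVT') (auto intro: continuous_on_subset)
    then show "y \<in> G ` {a..b}" by auto
  qed
qed

lemma dense_arcs_compose:
  assumes f: "dense_arcs X f" and G: "continuous_on UNIV G" "strict_mono G"
  shows "dense_arcs X (\<lambda>x. G (f x))"
  unfolding dense_arcs_def
proof (intro ballI allI impI; elim conjE)
  fix C x y U and e :: real
  assume C: "C \<in> connected_components_of X" and x: "x \<in> (\<lambda>x. G (f x)) ` C" and y: "y \<in> (\<lambda>x. G (f x)) ` C"
    and xy: "x \<le> y" and U: "openin X U" "closedin X U" "C \<subseteq> U" and e: "0 < e"
  obtain x0 y0 where xy0: "x = G x0" "y = G y0" "x0 \<in> f ` C" "y0 \<in> f ` C"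
    using x y by blast
  then have "x0 \<le> y0" using xy G(2) by (simp add: strict_mono_less_eq)
  have "\<exists>d>0. \<forall>z. \<bar>z - w\<bar> < d \<longrightarrow> \<bar>G z - G w\<bar> < e" for w
    using G(1) e unfolding continuous_on_iff dist_real_def by (metis UNIV_I)
  then obtain d where d: "\<And>w. d w > 0" "\<And>w z. \<bar>z - w\<bar> < d w \<Longrightarrow> \<bar>G z - G w\<bar> < e" by metis
  obtain D a b where D: "D \<in> connected_components_of X" "D \<subseteq> U" "f ` D = {a..b}" "a < b"
    "\<bar>a - x0\<bar> < min (d x0) (d y0)" "\<bar>b - y0\<bar> < min (d x0) (d y0)"
    using dense_arcsE[OF f C xy0(3,4) \<open>x0 \<le> y0\<close> _ U(3)] U d(1) by (metis min_less_iff_conj)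
  have "(\<lambda>x. G (f x)) ` D = {G a..G b}"
    using D(3,4) continuous_mono_image_interval[OF G(1), of a b] G(2)
    by (metis image_image less_imp_le strict_mono_mono)
  then show "\<exists>D a b. D \<in> connected_components_of X \<and> D \<subseteq> U \<and> (\<lambda>x. G (f x)) ` D = {a..b} \<and> a < b \<and> \<bar>a - x\<bar> < e \<and> \<bar>b - y\<bar> < e"
  proof (intro exI conjI)
    show "G a < G b" using D(4) G(2) by (simp add: strict_mono_less)
    show "\<bar>G a - x\<bar> < e" using d(2)[of a x0] D(5) xy0(1) by simp
    show "\<bar>G b - y\<bar> < e" using d(2)[of b y0] D(6) xy0(2) by simp
  qed (use D in auto)
qed

text \<open>The target values are first pushed up to at least \<open>a + m\<close>. An arc whose
  lower end is within \<open>m\<close> of such a value starts above \<open>a\<close> and so is not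
  \<open>C\<close>. The push and the approximation each cost at most \<open>m\<close>, half of
  \<open>e\<close> at most.\<close>

lemma dense_arcs_avoid:
  assumes f: "dense_arcs X f" and C: "C \<in> connected_components_of X" "f ` C = {a..b}" "a < b"
    and xy: "a \<le> x" "x \<le> y" "y \<le> b" and U: "clopenin X U" "C \<subseteq> U" and e: "e > 0"
  obtains D u v where "D \<in> connected_components_of X" "D \<subseteq> U" "D \<noteq> C" "f ` D = {u..v}" "u < v"
    "\<bar>u - x\<bar> < e" "\<bar>v - y\<bar> < e"
proof -
  define m where "m = min e (b - a) / 2"
  have m: "m > 0" "2 * m \<le> e" "2 * m \<le> b - a" using e C(3) by (auto simp: m_def)
  define x' y' where "x' = max x (a + m)" and "y' = max y (a + m)"
  have "x' \<in> f ` C" "y' \<in> f ` C" "x' \<le> y'" "\<bar>x' - x\<bar> \<le> m" "\<bar>y' - y\<bar> \<le> m"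
    using xy m by (auto simp: x'_def y'_def C(2))
  with dense_arcsE[OF f C(1) this(1-3) U m(1)] obtain D u v where
    D: "D \<in> connected_components_of X" "D \<subseteq> U" "f ` D = {u..v}" "u < v" "\<bar>u - x'\<bar> < m" "\<bar>v - y'\<bar> < m"
    by metis
  have "a < u" using D(5) by (auto simp: x'_def)
  then have "D \<noteq> C" using C D by auto
  then show thesis
    using that[of D u v] D \<open>\<bar>x' - x\<bar> \<le> m\<close> \<open>\<bar>y' - y\<bar> \<le> m\<close> m by auto
qed

text \<open>The map is the identity plus a displacement interpolating linearly between
  \<open>u' - u\<close> and \<open>v' - v\<close>. Every displacement is a convex combination of the
  two, hence at most \<open>k\<close> in size, however steep or flat the map is in between.\<close>

lemma stretch_pair:
  fixes u v u' v' k :: real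
  assumes "u < v" "u' < v'" "\<bar>u - u'\<bar> \<le> k" "\<bar>v - v'\<bar> \<le> k"
  obtains \<phi> \<psi> :: "real \<Rightarrow> real" where
    "continuous_on UNIV \<phi>" "continuous_on UNIV \<psi>" "mono \<phi>" "mono \<psi>"
    "\<And>z. \<phi> (\<psi> z) = z" "\<And>x. \<bar>\<phi> x - x\<bar> \<le> k"
    "\<And>x. x \<le> u \<Longrightarrow> \<phi> x = x + (u' - u)" "\<And>x. v \<le> x \<Longrightarrow> \<phi> x = x + (v' - v)"
    "\<And>x. x \<le> u' \<Longrightarrow> \<psi> x = x + (u - u')" "\<And>x. v' \<le> x \<Longrightarrow> \<psi> x = x + (v - v')"
proof -
  \<comment> \<open>The clamped parameter makes \<open>P\<close> a translation on either side of the
    interval from \<open>p\<close> to \<open>q\<close>; exchanging the two intervals inverts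
    it.\<close>
  define P :: "real \<Rightarrow> real \<Rightarrow> real \<Rightarrow> real \<Rightarrow> real \<Rightarrow> real" where
    "P = (\<lambda>p q p' q' x. x + (p' - p) + ((q' - q) - (p' - p)) * max 0 (min 1 ((x - p) / (q - p))))"
  have P1: "P p q p' q' x = x + (p' - p)" if "p < q" "x \<le> p" for p q p' q' x
  proof -
    have "(x - p) / (q - p) \<le> 0" using that by (simp add: divide_nonpos_pos)
    then show ?thesis by (auto simp: P_def)
  qed
  have P2: "P p q p' q' x = x + (q' - q)" if "p < q" "q \<le> x" for p q p' q' x
  proof -
    have "(x - p) / (q - p) \<ge> 1" using that by simp
    then show ?thesis by (auto simp: P_def)
  qed
  have P3: "P p q p' q' x = p' + (x - p) * ((q' - p') / (q - p))" if "p < q" "p \<le> x" "x \<le> q" for p q p' q' x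
  proof -
    have "(x - p) / (q - p) \<le> 1" "(x - p) / (q - p) \<ge> 0" using that by simp_all
    then have "P p q p' q' x = x + (p' - p) + ((q' - q) - (p' - p)) * ((x - p) / (q - p))" by (auto simp: P_def)
    also have "\<dots> = p' + (x - p) * ((q' - p') / (q - p))"
      using that by (simp add: field_simps)
    finally show ?thesis .
  qed
  have cont: "continuous_on UNIV (P p q p' q')" if "p < q" for p q p' q'
    unfolding P_def using that by (intro continuous_intros) auto
  have mid: "p' \<le> P p q p' q' x \<and> P p q p' q' x \<le> q'" if "p < q" "p' < q'" "p \<le> x" "x \<le> q" for p q p' q' x
  proof -
    have "0 \<le> (x - p) / (q - p)" "(x - p) / (q - p) \<le> 1" using that by auto
    then have "0 \<le> ((x - p) / (q - p)) * (q' - p')" "((x - p) / (q - p)) * (q' - p') \<le> 1 * (q' - p')"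
      using that(2) by (metis diff_ge_0_iff_ge less_imp_le mult_nonneg_nonneg, metis diff_ge_0_iff_ge less_imp_le mult_right_mono)
    then show ?thesis using P3[OF that(1,3,4)] by simp
  qed
  have mono: "mono (P p q p' q')" if pq: "p < q" "p' < q'" for p q p' q'
  proof (rule monoI)
    fix x y :: real assume xy: "x \<le> y"
    consider "y \<le> p" | "q \<le> x" | "x \<le> p" "p \<le> y" "y \<le> q" | "x \<le> p" "q \<le> y" | "p \<le> x" "x \<le> q" "q \<le> y"
      | "p \<le> x" "y \<le> q" by linarith
    then show "P p q p' q' x \<le> P p q p' q' y"
    proof cases
      case 6
      then show ?thesis using P3[OF pq(1)] xy pq by (simp add: mult_right_mono divide_right_mono)
    next
      case 1 then show ?thesis using P1[OF pq(1)] xy by simp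
    next
      case 2 then show ?thesis using P2[OF pq(1)] xy by simp
    next
      case 3 then show ?thesis using P1[OF pq(1) 3(1), of p' q'] mid[OF pq 3(2,3)] by linarith
    next
      case 4 then show ?thesis using P1[OF pq(1) 4(1), of p' q'] P2[OF pq(1) 4(2), of p' q'] pq by linarith
    next
      case 5 then show ?thesis using P2[OF pq(1) 5(3), of p' q'] mid[OF pq 5(1,2)] by linarith
    qed
  qed
  have inv: "P p q p' q' (P p' q' p q z) = z" if pq: "p < q" "p' < q'" for p q p' q' z
  proof -
    consider "z \<le> p'" | "q' \<le> z" | "p' \<le> z" "z \<le> q'" by linarith
    then show ?thesis
    proof cases
      case 3
      let ?w = "P p' q' p q z"
      have w: "?w - p = (z - p') * ((q - p) / (q' - p'))" using P3[OF pq(2) 3] by simp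
      have "P p q p' q' ?w = p' + (?w - p) * ((q' - p') / (q - p))"
        using P3[OF pq(1)] mid[OF pq(2,1) 3] by blast
      also have "\<dots> = z" unfolding w using pq by simp
      finally show ?thesis .
    next
      case 1
      then have "P p' q' p q z = z + (p - p')" using P1[OF pq(2)] by simp
      then show ?thesis using P1[OF pq(1)] 1 by simp
    next
      case 2
      then have "P p' q' p q z = z + (q - q')" using P2[OF pq(2)] by simp
      then show ?thesis using P2[OF pq(1)] 2 by simp
    qed
  qed
  have near: "\<bar>P u v u' v' x - x\<bar> \<le> k" for x
  proof -
    define s where "s = max 0 (min 1 ((x - u) / (v - u)))"
    have s: "0 \<le> s" "s \<le> 1" by (auto simp: s_def)
    have eq: "P u v u' v' x - x = (1 - s) * (u' - u) + s * (v' - v)"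
      by (simp add: P_def s_def algebra_simps)
    have "\<bar>(1 - s) * (u' - u) + s * (v' - v)\<bar> \<le> (1 - s) * \<bar>u' - u\<bar> + s * \<bar>v' - v\<bar>"
      using s abs_triangle_ineq[of "(1 - s) * (u' - u)" "s * (v' - v)"] by (simp add: abs_mult)
    also have "\<dots> \<le> (1 - s) * k + s * k"
      using s assms by (intro add_mono mult_left_mono) auto
    finally show ?thesis by (simp add: eq algebra_simps)
  qed
  show thesis
    by (rule that[of "P u v u' v'" "P u' v' u v"])
      (rule cont mono inv near P1 P2 assms | assumption)+
qed

section \<open>The back-and-forth argument\<close>

definition spans :: "'a topology \<Rightarrow> ('a \<Rightarrow> real) \<Rightarrow> 'a set \<Rightarrow> real \<Rightarrow> real \<Rightarrow> bool" where
  "spans X f C a b \<longleftrightarrow> C \<in> connected_components_of X \<and> f ` C = {a..b} \<and> a < b"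

text \<open>The last clause allows an error in the current height to be read as an error in
  \<open>t\<close>, however often the height has been changed. This is what forces the limit
  relation to be a graph.\<close>

definition height :: "'a topology \<Rightarrow> ('a \<Rightarrow> real) \<Rightarrow> ('a \<Rightarrow> real) \<Rightarrow> bool" where
  "height X t f \<longleftrightarrow> continuous_map X euclideanreal f \<and> dense_arcs X f \<and>
     (\<forall>x\<in>topspace X. \<forall>y\<in>topspace X. t x \<le> t y \<longrightarrow> t y - t x \<le> f y - f x)"

lemma height_compose:
  assumes f: "height X t f" and G: "continuous_on UNIV G" "\<And>x y. x \<le> y \<Longrightarrow> y - x \<le> G y - G x"
  shows "height X t (\<lambda>x. G (f x))"
  unfolding height_def
proof (intro conjI ballI impI)
  have cf: "continuous_map X euclideanreal f" using f by (simp add: height_def)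
  have "continuous_map X euclideanreal (G \<circ> f)"
    by (rule continuous_map_compose[OF cf]) (use G in simp)
  then show "continuous_map X euclideanreal (\<lambda>x. G (f x))" by (simp add: o_def)
  have "G x < G y" if "x < y" for x y using G(2)[of x y] that by linarith
  then have "strict_mono G" by (simp add: strict_mono_def)
  then show "dense_arcs X (\<lambda>x. G (f x))"
    using dense_arcs_compose f G(1) by (auto simp: height_def)
  fix x y assume xy: "x \<in> topspace X" "y \<in> topspace X" "t x \<le> t y"
  then have "t y - t x \<le> f y - f x" using f by (simp add: height_def)
  moreover have "f y - f x \<le> G (f y) - G (f x)" using G(2)[of "f x" "f y"] xy(3) calculation by linarith
  ultimately show "t y - t x \<le> G (f y) - G (f x)" by linarith
qed

lemma spans_compose:
  assumes "spans X f C a b" "continuous_on UNIV G" "mono G" "G a < G b"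
  shows "spans X (\<lambda>x. G (f x)) C (G a) (G b)"
proof -
  have "(\<lambda>x. G (f x)) ` C = G ` {a..b}" using assms(1) by (metis image_image spans_def)
  also have "\<dots> = {G a..G b}"
    by (rule continuous_mono_image_interval) (use assms in \<open>auto simp: spans_def\<close>)
  finally show ?thesis using assms by (simp add: spans_def)
qed

lemma height_abs:
  assumes "height X t f" "x \<in> topspace X" "y \<in> topspace X"
  shows "\<bar>t x - t y\<bar> \<le> \<bar>f x - f y\<bar>"
  using assms unfolding height_def by (smt (verit, best))

lemma compact_decreasing:
  assumes "compact_space W" "\<And>n. closedin W (K n)" "\<And>n. K n \<noteq> {}" "\<And>n::nat. K (Suc n) \<subseteq> K n"
  shows "\<exists>z. \<forall>n. z \<in> K n"
proof -
  have "decseq K" by (rule decseq_SucI) (rule assms(4))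
  then show ?thesis using compact_space_imp_nest[of W K] assms(1-3) by blast
qed

section \<open>Matched clopen sets and their refinement\<close>

locale fence_pair =
  fixes X :: "'a topology" and t :: "'a \<Rightarrow> real" and Y :: "'b topology" and s :: "'b \<Rightarrow> real"
  assumes compX: "compact_space X" and hausX: "Hausdorff_space X"
    and compY: "compact_space Y" and hausY: "Hausdorff_space Y"
begin

text \<open>In a tile the clopen sets \<open>U\<close> and \<open>V\<close> are matched, and each contains an arc component whose image
  under the current height function is \<open>{a..b}\<close> and fills the image of the whole set up to the tolerance.\<close>

definition tile :: "real \<Rightarrow> real \<Rightarrow> 'a set \<times> 'b set \<times> ('a \<Rightarrow> real) \<times> ('b \<Rightarrow> real) \<Rightarrow> bool" where
  "tile \<delta> \<delta>' = (\<lambda>(U, V, f, g). clopenin X U \<and> clopenin Y V \<and> height X t f \<and> height Y s g \<and>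
     (\<exists>C D a b. spans X f C a b \<and> C \<subseteq> U \<and> spans Y g D a b \<and> D \<subseteq> V \<and>
                f ` U \<subseteq> {a - \<delta>..b + \<delta>} \<and> g ` V \<subseteq> {a - \<delta>'..b + \<delta>'}))"

definition tiling :: "'a set \<Rightarrow> 'b set \<Rightarrow> ('a set \<times> 'b set \<times> ('a \<Rightarrow> real) \<times> ('b \<Rightarrow> real)) set \<Rightarrow> bool" where
  "tiling U V S \<longleftrightarrow> finite S \<and> (\<Union>p\<in>S. fst p) = U \<and> (\<Union>p\<in>S. fst (snd p)) = V \<and>
     (\<forall>p\<in>S. \<forall>q\<in>S. p \<noteq> q \<longrightarrow> fst p \<inter> fst q = {} \<and> fst (snd p) \<inter> fst (snd q) = {})"

definition close :: "real \<Rightarrow> 'a set \<times> 'b set \<times> ('a \<Rightarrow> real) \<times> ('b \<Rightarrow> real) \<Rightarrow> 'a \<Rightarrow> 'b \<Rightarrow> bool" where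
  "close e = (\<lambda>(U, V, f, g) x y. x \<in> U \<and> y \<in> V \<and> \<bar>f x - g y\<bar> \<le> e)"

definition corr :: "('a set \<times> 'b set \<times> ('a \<Rightarrow> real) \<times> ('b \<Rightarrow> real)) set \<Rightarrow> real \<Rightarrow> ('a \<times> 'b) set" where
  "corr S e = {(x, y). \<exists>p\<in>S. close e p x y}"

lemma tilingD:
  assumes "tiling U V S"
  shows "finite S" "(\<Union>p\<in>S. fst p) = U" "(\<Union>p\<in>S. fst (snd p)) = V"
    "\<And>p q. p \<in> S \<Longrightarrow> q \<in> S \<Longrightarrow> p \<noteq> q \<Longrightarrow> fst p \<inter> fst q = {} \<and> fst (snd p) \<inter> fst (snd q) = {}"
  using assms by (auto simp: tiling_def)

lemma tiling_insert:
  assumes S: "tiling U V S" and q: "fst q \<inter> U = {}" "fst (snd q) \<inter> V = {}"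
  shows "tiling (fst q \<union> U) (fst (snd q) \<union> V) (insert q S)"
proof -
  have "fst q \<inter> fst p = {} \<and> fst (snd q) \<inter> fst (snd p) = {}" if "p \<in> S" for p
    using tilingD(2,3)[OF S] q that by blast
  then show ?thesis using tilingD[OF S] by (auto simp: tiling_def Int_commute)
qed

text \<open>The new heights are \<open>f + \<phi> \<circ> f\<close> and \<open>g + \<psi> \<circ> g\<close>, where \<open>\<phi>\<close> carries the image of \<open>E\<close> onto that
  of a suitable component in \<open>V\<close> and \<open>\<psi>\<close> is its inverse. Adding the old heights keeps the new ones
  expanding over \<open>t\<close> and \<open>s\<close> although \<open>\<phi>\<close> and \<open>\<psi>\<close> may contract. Both maps are translations outside the
  given intervals, so that the tolerances are only doubled, however steep the maps are inside.\<close>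

lemma split_off:
  assumes f: "height X t f" and g: "height Y s g"
    and C: "spans X f C a b" and D: "spans Y g D a b" "D \<subseteq> V" "clopenin Y V"
    and fE: "f ` E \<subseteq> {a - \<delta>..b + \<delta>}"
    and W: "clopenin X W" "E \<subseteq> W" "spans X f E u v" "f ` W \<subseteq> {u - \<eta>..v + \<eta>}"
    and \<eta>: "\<eta> > 0" and \<delta>: "\<delta> > 0"
  shows "\<exists>N f' g'. clopenin Y N \<and> N \<subseteq> V \<and> D \<inter> N = {} \<and> tile (2 * \<eta>) (2 * \<eta>) (W, N, f', g') \<and>
     (\<forall>x y e. \<bar>f' x - g' y\<bar> \<le> e \<longrightarrow> \<bar>f x - g y\<bar> \<le> e + \<delta> + \<eta>)"
proof -
  have ab: "a < b" and gD: "g ` D = {a..b}" and Dc: "D \<in> connected_components_of Y"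
    using D by (auto simp: spans_def)
  have uv: "u < v" and fEuv: "f ` E = {u..v}" and Ec: "E \<in> connected_components_of X"
    using W by (auto simp: spans_def)
  have uvab: "a - \<delta> \<le> u" "v \<le> b + \<delta>" using fE uv unfolding fEuv by auto
  \<comment> \<open>The image of \<open>E\<close> may overshoot that of \<open>C\<close> by
    \<open>\<delta>\<close>. Clamping its ends moves them by at most \<open>\<delta>\<close> and
    puts them into the image of \<open>D\<close>, where \<open>dense_arcs_avoid\<close>
    applies.\<close>
  define x where "x = max a (min u b)"
  define y where "y = max a (min v b)"
  have xy: "a \<le> x" "x \<le> y" "y \<le> b" "\<bar>x - u\<bar> \<le> \<delta>" "\<bar>y - v\<bar> \<le> \<delta>"
    using uvab uv ab \<delta> by (auto simp: x_def y_def)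
  have dg: "dense_arcs Y g" and cg: "continuous_map Y euclideanreal g" using g by (auto simp: height_def)
  obtain D' u' v' where D': "D' \<in> connected_components_of Y" "D' \<subseteq> V" "D' \<noteq> D" "g ` D' = {u'..v'}" "u' < v'"
    "\<bar>u' - x\<bar> < \<eta>" "\<bar>v' - y\<bar> < \<eta>"
    by (rule dense_arcs_avoid[OF dg Dc gD ab xy(1-3) D(3,2) \<eta>])
  define k where "k = \<delta> + \<eta>"
  have k: "\<bar>u - u'\<bar> \<le> k" "\<bar>v - v'\<bar> \<le> k" using xy D' by (auto simp: k_def)
  \<comment> \<open>Excluding \<open>D\<close> keeps it in the remainder of \<open>V\<close>, from
    which further pieces are split off.\<close>
  define O' where "O' = {z \<in> topspace Y. g z \<in> {u' - \<eta><..<v' + \<eta>}} \<inter> V \<inter> (topspace Y - D)"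
  have "openin Y {z \<in> topspace Y. g z \<in> {u' - \<eta><..<v' + \<eta>}}"
    by (rule openin_continuous_map_preimage[OF cg]) auto
  moreover have "closedin Y D" using Dc by (rule closedin_connected_components_of)
  ultimately have O': "openin Y O'" unfolding O'_def using D(3) by blast
  have "g z \<in> {u' - \<eta><..<v' + \<eta>}" if "z \<in> D'" for z
    using D'(4) \<eta> that by force
  moreover have "D' \<subseteq> topspace Y" using D'(1) by (rule connected_components_of_subset)
  moreover have "D' \<inter> D = {}" using components_disjoint[OF D'(1) Dc D'(3)] .
  ultimately have "D' \<subseteq> O'" unfolding O'_def using D'(2) by blast
  then obtain N where N: "clopenin Y N" "D' \<subseteq> N" "N \<subseteq> O'"
    using clopen_nbhd_of_component[OF compY hausY D'(1) O'] by blast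
  obtain \<phi> \<psi> :: "real \<Rightarrow> real" where
    c: "continuous_on UNIV \<phi>" "continuous_on UNIV \<psi>" and m: "mono \<phi>" "mono \<psi>" and
    inv: "\<And>z. \<phi> (\<psi> z) = z" and near: "\<And>x. \<bar>\<phi> x - x\<bar> \<le> k" and
    tr: "\<And>x. x \<le> u \<Longrightarrow> \<phi> x = x + (u' - u)" "\<And>x. v \<le> x \<Longrightarrow> \<phi> x = x + (v' - v)"
    "\<And>x. x \<le> u' \<Longrightarrow> \<psi> x = x + (u - u')" "\<And>x. v' \<le> x \<Longrightarrow> \<psi> x = x + (v - v')"
    using stretch_pair[OF uv D'(5) k] by metis
  define G where "G = (\<lambda>x. x + \<phi> x)"
  define H where "H = (\<lambda>x. x + \<psi> x)"
  have cG: "continuous_on UNIV G" "continuous_on UNIV H"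
    unfolding G_def H_def by (intro continuous_intros c)+
  have eG: "y - x \<le> G y - G x" "y - x \<le> H y - H x" if "x \<le> y" for x y
    using monoD[OF m(1) that] monoD[OF m(2) that] by (auto simp: G_def H_def)
  have mG: "mono G" "mono H"
    using eG by (smt (verit) monoI)+
  have Guv: "G u = u + u'" "G v = v + v'" "H u' = u + u'" "H v' = v + v'"
    using tr by (auto simp: G_def H_def)
  have s1: "spans X (\<lambda>x. G (f x)) E (u + u') (v + v')"
    using spans_compose[OF W(3) cG(1) mG(1)] Guv uv D'(5) by simp
  have "spans Y g D' u' v'" using D' by (simp add: spans_def)
  then have s2: "spans Y (\<lambda>x. H (g x)) D' (u + u') (v + v')"
    using spans_compose[OF _ cG(2) mG(2)] Guv uv D'(5) by fastforce
  have t1: "(\<lambda>x. G (f x)) ` W \<subseteq> {u + u' - 2 * \<eta>..v + v' + 2 * \<eta>}"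
  proof (rule image_subsetI)
    fix x assume "x \<in> W"
    then have fx: "u - \<eta> \<le> f x" "f x \<le> v + \<eta>" using W(4) by auto
    have "G (u - \<eta>) = u + u' - 2 * \<eta>" "G (v + \<eta>) = v + v' + 2 * \<eta>"
      using tr(1)[of "u - \<eta>"] tr(2)[of "v + \<eta>"] \<eta> by (auto simp: G_def)
    then show "G (f x) \<in> {u + u' - 2 * \<eta>..v + v' + 2 * \<eta>}"
      using monoD[OF mG(1) fx(1)] monoD[OF mG(1) fx(2)] by auto
  qed
  have t2: "(\<lambda>x. H (g x)) ` N \<subseteq> {u + u' - 2 * \<eta>..v + v' + 2 * \<eta>}"
  proof (rule image_subsetI)
    fix x assume "x \<in> N"
    then have "x \<in> O'" using N by blast
    then have fx: "u' - \<eta> \<le> g x" "g x \<le> v' + \<eta>" by (auto simp: O'_def)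
    have "H (u' - \<eta>) = u + u' - 2 * \<eta>" "H (v' + \<eta>) = v + v' + 2 * \<eta>"
      using tr(3)[of "u' - \<eta>"] tr(4)[of "v' + \<eta>"] \<eta> by (auto simp: H_def)
    then show "H (g x) \<in> {u + u' - 2 * \<eta>..v + v' + 2 * \<eta>}"
      using monoD[OF mG(2) fx(1)] monoD[OF mG(2) fx(2)] by auto
  qed
  \<comment> \<open>For \<open>w = \<psi> (g y)\<close> one has \<open>H (g y) = G w\<close>. As the
    identity and \<open>\<phi>\<close> are both monotone, the distance of \<open>G (f x)\<close> and
    \<open>G w\<close> bounds that of \<open>\<phi> (f x)\<close> and \<open>\<phi> w = g y\<close>;
    replacing \<open>\<phi> (f x)\<close> by \<open>f x\<close> costs at most
    \<open>k\<close>.\<close>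
  have E: "\<bar>f x - g y\<bar> \<le> e + \<delta> + \<eta>" if e: "\<bar>G (f x) - H (g y)\<bar> \<le> e" for x y e
  proof -
    define w where "w = \<psi> (g y)"
    have w: "\<phi> w = g y" by (simp add: w_def inv)
    have H: "H (g y) = G w" by (simp add: G_def H_def w) (simp add: w_def)
    have "\<bar>\<phi> (f x) - \<phi> w\<bar> \<le> \<bar>G (f x) - G w\<bar>"
      using monoD[OF m(1), of "f x" w] monoD[OF m(1), of w "f x"] by (cases "f x \<le> w") (auto simp: G_def)
    then have "\<bar>\<phi> (f x) - g y\<bar> \<le> e" using e H w by simp
    then show ?thesis using near[of "f x"] by (simp add: k_def)
  qed
  have "tile (2 * \<eta>) (2 * \<eta>) (W, N, \<lambda>x. G (f x), \<lambda>x. H (g x))"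
    unfolding tile_def prod.case
    using W(1,2) N(1,2) height_compose[OF f cG(1) eG(1)] height_compose[OF g cG(2) eG(2)] s1 s2 t1 t2
    by blast
  moreover have "N \<subseteq> V" "D \<inter> N = {}" using N(3) by (auto simp: O'_def)
  ultimately show ?thesis using N(1) E by blast
qed

text \<open>Pieces are split off one at a time from what is left of \<open>V\<close>. The remainder
  \<open>R\<close> always contains \<open>D\<close>, so \<open>split_off\<close> stays applicable,
  and the final remainder is available as the partner of the piece of \<open>C\<close>.\<close>

lemma split_off_all:
  assumes f: "height X t f" and g: "height Y s g"
    and C: "spans X f C a b" and D: "spans Y g D a b" "D \<subseteq> V" "clopenin Y V"
    and \<eta>: "\<eta> > 0" and \<delta>: "\<delta> > 0" and fin: "finite \<W>"
    and W: "\<And>W. W \<in> \<W> \<Longrightarrow> clopenin X W \<and> f ` W \<subseteq> {a - \<delta>..b + \<delta>} \<and>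
              (\<exists>E u v. E \<subseteq> W \<and> spans X f E u v \<and> f ` W \<subseteq> {u - \<eta>..v + \<eta>})"
    and disj: "\<And>W W'. W \<in> \<W> \<Longrightarrow> W' \<in> \<W> \<Longrightarrow> W \<noteq> W' \<Longrightarrow> W \<inter> W' = {}"
  shows "\<exists>S R. tiling (\<Union>\<W>) (V - R) S \<and> clopenin Y R \<and> D \<subseteq> R \<and> R \<subseteq> V \<and>
     (\<forall>p\<in>S. tile (2 * \<eta>) (2 * \<eta>) p \<and> fst p \<in> \<W> \<and>
        (\<forall>x y e. close e p x y \<longrightarrow> \<bar>f x - g y\<bar> \<le> e + \<delta> + \<eta>))"
  using fin W disj
proof (induction \<W> rule: finite_induct)
  case empty
  have "tiling (\<Union>{}) (V - V) {}" by (simp add: tiling_def)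
  then show ?case using D by blast
next
  case (insert W \<W>)
  have "\<exists>S R. tiling (\<Union>\<W>) (V - R) S \<and> clopenin Y R \<and> D \<subseteq> R \<and> R \<subseteq> V \<and>
     (\<forall>p\<in>S. tile (2 * \<eta>) (2 * \<eta>) p \<and> fst p \<in> \<W> \<and>
        (\<forall>x y e. close e p x y \<longrightarrow> \<bar>f x - g y\<bar> \<le> e + \<delta> + \<eta>))"
    by (rule insert.IH) (use insert.prems in auto)
  then obtain S R where S: "tiling (\<Union>\<W>) (V - R) S" and R: "clopenin Y R" "D \<subseteq> R" "R \<subseteq> V"
    and p: "\<And>p. p\<in>S \<Longrightarrow> tile (2 * \<eta>) (2 * \<eta>) p \<and> fst p \<in> \<W> \<and>
        (\<forall>x y e. close e p x y \<longrightarrow> \<bar>f x - g y\<bar> \<le> e + \<delta> + \<eta>)" by (metis (no_types, lifting))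
  have W: "clopenin X W" "f ` W \<subseteq> {a - \<delta>..b + \<delta>}" using insert.prems(1)[of W] by auto
  obtain E u v where E: "E \<subseteq> W" "spans X f E u v" "f ` W \<subseteq> {u - \<eta>..v + \<eta>}"
    using insert.prems(1)[of W] by auto
  have fE: "f ` E \<subseteq> {a - \<delta>..b + \<delta>}" using W(2) E(1) by blast
  obtain N f' g' where N: "clopenin Y N" "N \<subseteq> R" "D \<inter> N = {}" "tile (2 * \<eta>) (2 * \<eta>) (W, N, f', g')"
     and fg: "\<And>x y e. \<bar>f' x - g' y\<bar> \<le> e \<Longrightarrow> \<bar>f x - g y\<bar> \<le> e + \<delta> + \<eta>"
    using split_off[OF f g C D(1) R(2,1) fE W(1) E(1,2,3) \<eta> \<delta>] by metis
  define q where "q = (W, N, f', g')"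
  have "W \<inter> \<Union>\<W> = {}" using insert.prems(2)[of W] insert.hyps(2) by blast
  moreover have NR: "N \<inter> (V - R) = {}" using N(2) by blast
  ultimately have "tiling (W \<union> \<Union>\<W>) (N \<union> (V - R)) (insert q S)"
    using tiling_insert[OF S, of q] NR by (simp add: q_def)
  moreover have "N \<union> (V - R) = V - (R - N)" using N(2) R(3) by blast
  ultimately have "tiling (\<Union>(insert W \<W>)) (V - (R - N)) (insert q S)" by simp
  moreover have "clopenin Y (R - N)" "D \<subseteq> R - N" "R - N \<subseteq> V" using R N by auto
  moreover have "tile (2 * \<eta>) (2 * \<eta>) p \<and> fst p \<in> insert W \<W> \<and>
        (\<forall>x y e. close e p x y \<longrightarrow> \<bar>f x - g y\<bar> \<le> e + \<delta> + \<eta>)" if "p \<in> insert q S" for p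
  proof (cases "p = q")
    case True
    then show ?thesis using N(4) fg by (auto simp: q_def close_def)
  next
    case False
    then show ?thesis using p[of p] that by auto
  qed
  ultimately show ?case by metis
qed

lemma tileE:
  assumes "tile \<delta> \<delta>' (U, V, f, g)"
  obtains C D a b where "clopenin X U" "clopenin Y V" "height X t f" "height Y s g"
    "spans X f C a b" "C \<subseteq> U" "spans Y g D a b" "D \<subseteq> V"
    "f ` U \<subseteq> {a - \<delta>..b + \<delta>}" "g ` V \<subseteq> {a - \<delta>'..b + \<delta>'}"
  using assms unfolding tile_def prod.case
  by (elim conjE exE) (rule that; (intro conjI)?; assumption)

lemma tile_mono:
  assumes "tile \<delta> \<delta>' p" "\<delta> \<le> \<epsilon>" "\<delta>' \<le> \<epsilon>'"
  shows "tile \<epsilon> \<epsilon>' p"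
proof -
  obtain U V f g where p: "p = (U, V, f, g)" by (cases p)
  obtain C D a b where 1: "clopenin X U" "clopenin Y V" "height X t f" "height Y s g"
    and 2: "spans X f C a b" "C \<subseteq> U" "spans Y g D a b" "D \<subseteq> V"
    "f ` U \<subseteq> {a - \<delta>..b + \<delta>}" "g ` V \<subseteq> {a - \<delta>'..b + \<delta>'}"
    using assms(1) unfolding p by (rule tileE)
  have "{a - \<delta>..b + \<delta>} \<subseteq> {a - \<epsilon>..b + \<epsilon>}" "{a - \<delta>'..b + \<delta>'} \<subseteq> {a - \<epsilon>'..b + \<epsilon>'}"
    using assms(2,3) by auto
  then have "f ` U \<subseteq> {a - \<epsilon>..b + \<epsilon>}" "g ` V \<subseteq> {a - \<epsilon>'..b + \<epsilon>'}"
    using 2(5,6) by blast+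
  then show ?thesis unfolding tile_def p prod.case using 1 2(1-4) by blast
qed

text \<open>The piece around \<open>C\<close> stays matched with the remainder around
  \<open>D\<close> under the old heights; every other piece receives a freshly split-off partner. In
  the former tile only the \<open>X\<close> side becomes tighter, since the remainder of
  \<open>V\<close> is not cut to measure. Hence tiles carry two tolerances.\<close>

lemma refine_tile:
  assumes tl: "tile \<delta> \<delta>' (U, V, f, g)" and \<eta>: "0 < \<eta>" "\<eta> \<le> \<delta>'" and \<delta>: "0 < \<delta>"
    and A: "clopenin X A"
  shows "\<exists>S. tiling U V S \<and> (\<forall>p\<in>S. tile \<eta> \<delta>' p \<and> (fst p \<subseteq> A \<or> fst p \<inter> A = {}) \<and>
           (\<forall>x y e. close e p x y \<longrightarrow> close (e + \<delta> + \<eta>) (U, V, f, g) x y))"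
proof -
  obtain C D a b where U: "clopenin X U" and V: "clopenin Y V" and f: "height X t f" and g: "height Y s g"
    and C: "spans X f C a b" "C \<subseteq> U" and D: "spans Y g D a b" "D \<subseteq> V"
    and fU: "f ` U \<subseteq> {a - \<delta>..b + \<delta>}" and gV: "g ` V \<subseteq> {a - \<delta>'..b + \<delta>'}"
    using tl by (rule tileE)
  have cf: "continuous_map X euclideanreal f" and df: "dense_arcs X f" using f by (auto simp: height_def)
  have Cc: "C \<in> connected_components_of X" and fC: "f ` C = {a..b}" using C by (auto simp: spans_def)
  \<comment> \<open>A piece fits the image of its component up to \<open>h\<close>, an arc inside
    the piece misses the ends of this image by another \<open>h\<close>, and
    \<open>split_off\<close> doubles the resulting \<open>2 * h\<close>. The total
    \<open>4 * h\<close> is below \<open>\<eta>\<close>.\<close>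
  define h where "h = \<eta> / 8"
  have h: "h > 0" using \<eta> by (simp add: h_def)
  have "\<exists>N. clopenin X N \<and> E \<subseteq> N \<and> (N \<subseteq> A \<or> N \<inter> A = {}) \<and>
            (\<forall>l r. f ` E = {l..r} \<longrightarrow> f ` N \<subseteq> {l - h..r + h})"
    if E: "E \<in> connected_components_of X" for E
  proof -
    obtain l r where lr: "l \<le> r" "f ` E = {l..r}"
      using component_image_interval[OF compX E cf] by metis
    \<comment> \<open>Taking the complement of \<open>A\<close> when \<open>E\<close> is not inside
      \<open>A\<close> puts every piece on one side of \<open>A\<close>.\<close>
    define B where "B = (if E \<subseteq> A then A else topspace X - A)"
    define O' where "O' = {z \<in> topspace X. f z \<in> {l - h<..<r + h}} \<inter> B"
    have EX: "E \<subseteq> topspace X" by (rule connected_components_of_subset[OF E])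
    have "openin X {z \<in> topspace X. f z \<in> {l - h<..<r + h}}"
      by (rule openin_continuous_map_preimage[OF cf]) auto
    moreover have "openin X B" using A by (auto simp: B_def)
    ultimately have O': "openin X O'" unfolding O'_def by blast
    have "E \<subseteq> B" using component_clopen_cases[OF E A] EX by (auto simp: B_def)
    moreover have "f z \<in> {l - h<..<r + h}" if "z \<in> E" for z using lr h that by force
    ultimately have "E \<subseteq> O'" using EX unfolding O'_def by blast
    then obtain N where N: "clopenin X N" "E \<subseteq> N" "N \<subseteq> O'"
      using clopen_nbhd_of_component[OF compX hausX E O'] by blast
    have "N \<subseteq> A \<or> N \<inter> A = {}" using N(3) by (auto simp: O'_def B_def split: if_splits)
    moreover have "f ` N \<subseteq> {l' - h..r' + h}" if "f ` E = {l'..r'}" for l' r'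
    proof -
      have "l' = l \<and> r' = r" using that lr by (simp add: Icc_eq_Icc)
      moreover have "f ` O' \<subseteq> {l - h..r + h}" unfolding O'_def by auto
      ultimately show ?thesis using N(3) by blast
    qed
    ultimately show ?thesis using N by blast
  qed
  then obtain N where N: "\<And>E. E \<in> connected_components_of X \<Longrightarrow> clopenin X (N E) \<and> E \<subseteq> N E \<and>
      (N E \<subseteq> A \<or> N E \<inter> A = {}) \<and> (\<forall>l r. f ` E = {l..r} \<longrightarrow> f ` N E \<subseteq> {l - h..r + h})"
    by metis
  have Nc: "clopenin X (N E) \<and> E \<subseteq> N E" if "E \<in> connected_components_of X" "E \<subseteq> U" for E
    using N[OF that(1)] by simp
  obtain \<D> W where fin: "finite \<D>" and DU: "\<D> \<subseteq> {D \<in> connected_components_of X. D \<subseteq> U}" and CD: "C \<in> \<D>"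
    and W: "\<And>D. D \<in> \<D> \<Longrightarrow> clopenin X (W D) \<and> D \<subseteq> W D \<and> W D \<subseteq> N D \<inter> U"
    and dW: "disjoint_family_on W \<D>" and UW: "\<Union>(W ` \<D>) = U"
    by (rule clopen_partition[OF compX hausX U Cc C(2) Nc], assumption, assumption, rule that)
  have fW: "f ` W E \<subseteq> {l - h..r + h}" if "E \<in> \<D>" "f ` E = {l..r}" for E l r
  proof -
    have "f ` N E \<subseteq> {l - h..r + h}" using N[of E] that DU by blast
    then show ?thesis using W[OF that(1)] by blast
  qed
  have WA: "W E \<subseteq> A \<or> W E \<inter> A = {}" if "E \<in> \<D>" for E
    using N[of E] W[OF that] that DU by blast
  define \<W> where "\<W> = W ` (\<D> - {C})"
  have "finite \<W>" using fin by (simp add: \<W>_def)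
  have split: "\<exists>S R. tiling (\<Union>\<W>) (V - R) S \<and> clopenin Y R \<and> D \<subseteq> R \<and> R \<subseteq> V \<and>
     (\<forall>p\<in>S. tile (2 * (2 * h)) (2 * (2 * h)) p \<and> fst p \<in> \<W> \<and>
        (\<forall>x y e. close e p x y \<longrightarrow> \<bar>f x - g y\<bar> \<le> e + \<delta> + 2 * h))"
  proof (rule split_off_all[OF f g C(1) D V _ \<delta> \<open>finite \<W>\<close>])
    show "0 < 2 * h" using h by simp
    fix W1 assume "W1 \<in> \<W>"
    then obtain E where E: "E \<in> \<D>" "E \<noteq> C" "W1 = W E" by (auto simp: \<W>_def)
    have Ec: "E \<in> connected_components_of X" using E DU by blast
    have EW: "clopenin X (W E)" "E \<subseteq> W E" "W E \<subseteq> U" using W[OF E(1)] by blast+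
    obtain l r where lr: "l \<le> r" "f ` E = {l..r}"
      using component_image_interval[OF compX Ec cf] by metis
    \<comment> \<open>\<open>E\<close> may be a single point, which spans nothing. An arc component
      \<open>F\<close> inside its piece with almost the same image takes its place.\<close>
    then have "l \<in> f ` E" "r \<in> f ` E" by auto
    then obtain F u v where F: "F \<in> connected_components_of X" "F \<subseteq> W E" "f ` F = {u..v}" "u < v"
        "\<bar>u - l\<bar> < h" "\<bar>v - r\<bar> < h"
      by (rule dense_arcsE[OF df Ec _ _ lr(1) EW(1,2) h])
    have "f ` W E \<subseteq> {l - h..r + h}" using fW[OF E(1) lr(2)] .
    moreover have "{l - h..r + h} \<subseteq> {u - 2 * h..v + 2 * h}" using F(5,6) by auto
    ultimately have "f ` W E \<subseteq> {u - 2 * h..v + 2 * h}" by blast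
    moreover have "spans X f F u v" using F by (simp add: spans_def)
    moreover have "f ` W E \<subseteq> {a - \<delta>..b + \<delta>}" using EW(3) fU by blast
    ultimately show "clopenin X W1 \<and> f ` W1 \<subseteq> {a - \<delta>..b + \<delta>} \<and>
              (\<exists>E u v. E \<subseteq> W1 \<and> spans X f E u v \<and> f ` W1 \<subseteq> {u - 2 * h..v + 2 * h})"
      unfolding E(3) using EW(1) F(2) by blast
  next
    fix W1 W2 assume "W1 \<in> \<W>" "W2 \<in> \<W>" "W1 \<noteq> W2"
    then obtain E1 E2 where "E1 \<in> \<D>" "W1 = W E1" "E2 \<in> \<D>" "W2 = W E2" "E1 \<noteq> E2" by (auto simp: \<W>_def)
    then show "W1 \<inter> W2 = {}" using dW by (simp add: disjoint_family_on_def)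
  qed
  obtain S R where S: "tiling (\<Union>\<W>) (V - R) S" and R: "clopenin Y R" "D \<subseteq> R" "R \<subseteq> V"
    and p: "\<And>p. p\<in>S \<Longrightarrow> tile (2 * (2 * h)) (2 * (2 * h)) p \<and> fst p \<in> \<W> \<and>
        (\<forall>x y e. close e p x y \<longrightarrow> \<bar>f x - g y\<bar> \<le> e + \<delta> + 2 * h)"
    using split by (metis (no_types, lifting))
  define q where "q = (W C, R, f, g)"
  have "W C \<inter> \<Union>\<W> = {}"
    using dW CD unfolding \<W>_def disjoint_family_on_def by blast
  then have "tiling (W C \<union> \<Union>\<W>) (R \<union> (V - R)) (insert q S)"
    using tiling_insert[OF S, of q] by (auto simp: q_def)
  moreover have "W C \<union> \<Union>\<W> = U" using UW CD by (auto simp: \<W>_def)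
  moreover have "R \<union> (V - R) = V" using R(3) by blast
  ultimately have til: "tiling U V (insert q S)" by simp
  have tq: "tile \<eta> \<delta>' q"
  proof -
    have "f ` W C \<subseteq> {a - h..b + h}" using fW[OF CD fC] .
    moreover have "{a - h..b + h} \<subseteq> {a - \<eta>..b + \<eta>}" using \<eta> by (auto simp: h_def)
    ultimately have "f ` W C \<subseteq> {a - \<eta>..b + \<eta>}" by blast
    moreover have "g ` R \<subseteq> {a - \<delta>'..b + \<delta>'}" using gV R(3) by blast
    ultimately show ?thesis
      unfolding q_def tile_def prod.case using W[OF CD] R f g C(1) D(1) by blast
  qed
  have fin: "tile \<eta> \<delta>' p \<and> (fst p \<subseteq> A \<or> fst p \<inter> A = {}) \<and>
           (\<forall>x y e. close e p x y \<longrightarrow> close (e + \<delta> + \<eta>) (U, V, f, g) x y)" if pS: "p \<in> insert q S" for p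
  proof -
    have pU: "fst p \<subseteq> U" "fst (snd p) \<subseteq> V" using til pS unfolding tiling_def by blast+
    have cl: "x \<in> fst p" "y \<in> fst (snd p)" if "close e p x y" for e x y
      using that by (auto simp: close_def split: prod.splits)
    show ?thesis
    proof (cases "p = q")
      case True
      have "close (e + \<delta> + \<eta>) (U, V, f, g) x y" if "close e p x y" for e x y
        using that cl[OF that] pU \<delta> \<eta> unfolding True by (auto simp: close_def q_def)
      then show ?thesis using tq WA[OF CD] by (simp add: True q_def)
    next
      case False
      then have pS: "p \<in> S" using pS by simp
      have "tile \<eta> \<delta>' p" by (rule tile_mono[where \<delta> = "2 * (2 * h)" and \<delta>' = "2 * (2 * h)"]) (use p[OF pS] \<eta> in \<open>auto simp: h_def\<close>)
      moreover obtain E where "E \<in> \<D>" "fst p = W E" using p[OF pS] by (auto simp: \<W>_def)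
      moreover have "close (e + \<delta> + \<eta>) (U, V, f, g) x y" if c: "close e p x y" for e x y
      proof -
        have "\<bar>f x - g y\<bar> \<le> e + \<delta> + 2 * h" using p[OF pS] c by blast
        then show ?thesis using cl[OF c] pU \<eta> by (auto simp: close_def h_def)
      qed
      ultimately show ?thesis using WA by metis
    qed
  qed
  show ?thesis using til fin by blast
qed

text \<open>A tile inside an old one stays on the side of every clopen set that the old one has
  chosen; \<open>refine_tiling_both\<close> relies on this inclusion when it refines a second
  time.\<close>

lemma refine_tiling:
  assumes S: "tiling (topspace X) (topspace Y) S" "\<And>p. p \<in> S \<Longrightarrow> tile \<delta> \<delta>' p"
    and \<eta>: "0 < \<eta>" "\<eta> \<le> \<delta>'" and \<delta>: "0 < \<delta>" and A: "clopenin X A"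
  shows "\<exists>T. tiling (topspace X) (topspace Y) T \<and>
           (\<forall>p\<in>T. tile \<eta> \<delta>' p \<and> (fst p \<subseteq> A \<or> fst p \<inter> A = {}) \<and>
              (\<exists>q\<in>S. fst p \<subseteq> fst q \<and> fst (snd p) \<subseteq> fst (snd q))) \<and>
           (\<forall>e. corr T e \<subseteq> corr S (e + \<delta> + \<eta>))"
proof -
  have "\<exists>T. tiling (fst q) (fst (snd q)) T \<and> (\<forall>p\<in>T. tile \<eta> \<delta>' p \<and> (fst p \<subseteq> A \<or> fst p \<inter> A = {}) \<and>
           (\<forall>x y e. close e p x y \<longrightarrow> close (e + \<delta> + \<eta>) q x y))" if "q \<in> S" for q
  proof -
    obtain U V f g where q: "q = (U, V, f, g)" by (cases q)
    show ?thesis using refine_tile[of \<delta> \<delta>' U V f g \<eta> A] S(2)[OF that] \<eta> \<delta> A unfolding q by simp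
  qed
  then obtain T where T: "\<And>q. q \<in> S \<Longrightarrow> tiling (fst q) (fst (snd q)) (T q)"
     and Tp: "\<And>q p. q \<in> S \<Longrightarrow> p \<in> T q \<Longrightarrow> tile \<eta> \<delta>' p \<and> (fst p \<subseteq> A \<or> fst p \<inter> A = {}) \<and>
           (\<forall>x y e. close e p x y \<longrightarrow> close (e + \<delta> + \<eta>) q x y)" by metis
  note Sd = tilingD[OF S(1)]
  note Td = tilingD[OF T]
  have sub: "fst p \<subseteq> fst q" "fst (snd p) \<subseteq> fst (snd q)" if "q \<in> S" "p \<in> T q" for p q
    using Td(2,3)[OF that(1)] that(2) by blast+
  let ?T = "\<Union>(T ` S)"
  have "tiling (topspace X) (topspace Y) ?T"
    unfolding tiling_def
  proof (intro conjI ballI impI)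
    show "finite ?T" using Sd Td by simp
    have "(\<Union>p\<in>?T. fst p) = (\<Union>q\<in>S. \<Union>p\<in>T q. fst p)" by simp
    also have "\<dots> = (\<Union>q\<in>S. fst q)" using Td(2) by (intro SUP_cong) auto
    finally show "(\<Union>p\<in>?T. fst p) = topspace X" using Sd(2) by simp
    have "(\<Union>p\<in>?T. fst (snd p)) = (\<Union>q\<in>S. \<Union>p\<in>T q. fst (snd p))" by simp
    also have "\<dots> = (\<Union>q\<in>S. fst (snd q))" using Td(3) by (intro SUP_cong) auto
    finally show "(\<Union>p\<in>?T. fst (snd p)) = topspace Y" using Sd(3) by simp
    fix p p' assume "p \<in> ?T" "p' \<in> ?T" and ne: "p \<noteq> p'"
    then obtain q q' where q: "q \<in> S" "p \<in> T q" "q' \<in> S" "p' \<in> T q'" by blast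
    have "fst p \<inter> fst p' = {} \<and> fst (snd p) \<inter> fst (snd p') = {}"
    proof (cases "q = q'")
      case True then show ?thesis using Td(4)[OF q(1,2)] q ne by blast
    next
      case False
      then show ?thesis using Sd(4)[OF q(1,3)] sub[OF q(1,2)] sub[OF q(3,4)] by blast
    qed
    then show "fst p \<inter> fst p' = {}" "fst (snd p) \<inter> fst (snd p') = {}" by auto
  qed
  moreover have "tile \<eta> \<delta>' p \<and> (fst p \<subseteq> A \<or> fst p \<inter> A = {}) \<and>
              (\<exists>q\<in>S. fst p \<subseteq> fst q \<and> fst (snd p) \<subseteq> fst (snd q))" if "p \<in> ?T" for p
  proof -
    obtain q where q: "q \<in> S" "p \<in> T q" using \<open>p \<in> ?T\<close> by blast
    show ?thesis using Tp[OF q] sub[OF q] q(1) by blast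
  qed
  moreover have "corr ?T e \<subseteq> corr S (e + \<delta> + \<eta>)" for e
  proof (rule subsetI)
    fix z assume "z \<in> corr ?T e"
    then obtain x y p q where "z = (x, y)" "close e p x y" "q \<in> S" "p \<in> T q" by (auto simp: corr_def)
    then show "z \<in> corr S (e + \<delta> + \<eta>)" using Tp[of q p] by (auto simp: corr_def)
  qed
  ultimately show ?thesis by blast
qed

lemma swap: "fence_pair Y X"
  using compX hausX compY hausY by (simp add: fence_pair_def)

end

section \<open>Exchanging the two spaces\<close>

definition flip :: "'a set \<times> 'b set \<times> ('a \<Rightarrow> real) \<times> ('b \<Rightarrow> real) \<Rightarrow> 'b set \<times> 'a set \<times> ('b \<Rightarrow> real) \<times> ('a \<Rightarrow> real)" where
  "flip = (\<lambda>(U, V, f, g). (V, U, g, f))"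

lemma flip_flip [simp]: "flip (flip p) = p"
  by (auto simp: flip_def split: prod.splits)

lemma fst_flip [simp]: "fst (flip p) = fst (snd p)" "fst (snd (flip p)) = fst p"
  by (auto simp: flip_def split: prod.splits)

context fence_pair begin

lemma tile_flip: "fence_pair.tile Y s X t \<delta>' \<delta> (flip p) \<longleftrightarrow> tile \<delta> \<delta>' p"
  unfolding tile_def fence_pair.tile_def[OF swap] flip_def by (auto split: prod.splits)

lemma tiling_flip: "fence_pair.tiling V U (flip ` S) \<longleftrightarrow> tiling U V S"
proof -
  have inj: "flip p = flip q \<longleftrightarrow> p = q" for p q :: "'a set \<times> 'b set \<times> ('a \<Rightarrow> real) \<times> ('b \<Rightarrow> real)"
    by (metis flip_flip)
  then have "inj_on flip S" by (auto simp: inj_on_def)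
  then have "finite (flip ` S) \<longleftrightarrow> finite S" by (rule finite_image_iff)
  then show ?thesis
    unfolding tiling_def fence_pair.tiling_def[OF swap] by (simp add: inj conj_ac)
qed

lemma close_flip: "fence_pair.close e (flip p) y x \<longleftrightarrow> close e p x y"
  unfolding close_def fence_pair.close_def[OF swap]
  by (cases p) (auto simp: flip_def abs_minus_commute)

lemma corr_flip: "(y, x) \<in> fence_pair.corr (flip ` S) e \<longleftrightarrow> (x, y) \<in> corr S e"
  unfolding corr_def fence_pair.corr_def[OF swap] by (simp add: close_flip)

text \<open>One pass on each side turns the tolerances \<delta>, \<delta> into \<eta>, \<delta> and
  then into \<eta>, \<eta>. Each pass costs \<open>\<delta> + \<eta>\<close> in the
  relation.\<close>

lemma refine_tiling_both:
  assumes S: "tiling (topspace X) (topspace Y) S" "\<And>p. p \<in> S \<Longrightarrow> tile \<delta> \<delta> p"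
    and \<eta>: "0 < \<eta>" "\<eta> \<le> \<delta>" and A: "clopenin X A" and B: "clopenin Y B"
  shows "\<exists>T. tiling (topspace X) (topspace Y) T \<and>
           (\<forall>p\<in>T. tile \<eta> \<eta> p \<and> (fst p \<subseteq> A \<or> fst p \<inter> A = {}) \<and>
              (fst (snd p) \<subseteq> B \<or> fst (snd p) \<inter> B = {})) \<and>
           (\<forall>e. corr T e \<subseteq> corr S (e + 2 * \<delta> + 2 * \<eta>))"
proof -
  interpret sw: fence_pair Y s X t by (rule swap)
  obtain T where T: "tiling (topspace X) (topspace Y) T"
    "\<And>p. p \<in> T \<Longrightarrow> tile \<eta> \<delta> p" "\<And>p. p \<in> T \<Longrightarrow> fst p \<subseteq> A \<or> fst p \<inter> A = {}"
    "\<And>e. corr T e \<subseteq> corr S (e + \<delta> + \<eta>)"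
    using refine_tiling[OF S \<eta> _ A] \<eta> by (metis (no_types, lifting) less_le_trans)
  have 1: "sw.tiling (topspace Y) (topspace X) (flip ` T)" using T(1) by (simp add: tiling_flip)
  have 2: "sw.tile \<delta> \<eta> p" if "p \<in> flip ` T" for p using that T(2) by (auto simp: tile_flip)
  obtain R where R: "sw.tiling (topspace Y) (topspace X) R"
    "\<And>p. p \<in> R \<Longrightarrow> sw.tile \<eta> \<eta> p" "\<And>p. p \<in> R \<Longrightarrow> fst p \<subseteq> B \<or> fst p \<inter> B = {}"
    "\<And>p. p \<in> R \<Longrightarrow> \<exists>q\<in>flip ` T. fst p \<subseteq> fst q \<and> fst (snd p) \<subseteq> fst (snd q)"
    "\<And>e. sw.corr R e \<subseteq> sw.corr (flip ` T) (e + \<delta> + \<eta>)"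
    using sw.refine_tiling[OF 1 2 \<eta>(1) order_refl _ B] \<eta> by (metis (no_types, lifting) less_le_trans)
  have RR: "R = flip ` (flip ` R)" by (simp add: image_image)
  show ?thesis
  proof (intro exI[of _ "flip ` R"] conjI ballI allI)
    show "tiling (topspace X) (topspace Y) (flip ` R)" using R(1) RR by (metis tiling_flip)
    fix p assume "p \<in> flip ` R"
    then obtain r where r: "r \<in> R" "p = flip r" by blast
    have "sw.tile \<eta> \<eta> (flip p)" using R(2)[OF r(1)] r(2) by simp
    then show "tile \<eta> \<eta> p" by (simp add: tile_flip)
    show "fst (snd p) \<subseteq> B \<or> fst (snd p) \<inter> B = {}" using R(3)[OF r(1)] r(2) by simp
    obtain q where q: "q \<in> T" "fst (snd r) \<subseteq> fst q" using R(4)[OF r(1)] by auto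
    then show "fst p \<subseteq> A \<or> fst p \<inter> A = {}" using T(3)[OF q(1)] r(2) by auto
  next
    fix e
    show "corr (flip ` R) e \<subseteq> corr S (e + 2 * \<delta> + 2 * \<eta>)"
    proof clarify
      fix x y assume "(x, y) \<in> corr (flip ` R) e"
      then have "(y, x) \<in> sw.corr R e" using corr_flip[of y x "flip ` R" e] RR by simp
      then have "(y, x) \<in> sw.corr (flip ` T) (e + \<delta> + \<eta>)" using R(5) by blast
      then have "(x, y) \<in> corr T (e + \<delta> + \<eta>)" by (simp add: corr_flip)
      then have "(x, y) \<in> corr S (e + \<delta> + \<eta> + \<delta> + \<eta>)" using T(4) by blast
      then show "(x, y) \<in> corr S (e + 2 * \<delta> + 2 * \<eta>)" by (simp add: algebra_simps)
    qed
  qed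
qed

section \<open>The matching relations and their limit\<close>

lemma tile_closedin:
  assumes "tile \<delta> \<delta>' p"
  shows "closedin (prod_topology X Y) {(x, y). close e p x y}"
proof -
  obtain U V f g where p: "p = (U, V, f, g)" by (cases p)
  have UV: "clopenin X U" "clopenin Y V" "height X t f" "height Y s g"
    using assms tileE unfolding p by metis+
  have cf: "continuous_map X euclideanreal f" "continuous_map Y euclideanreal g"
    using UV by (auto simp: height_def)
  have "continuous_map (prod_topology X Y) euclideanreal (\<lambda>z. \<bar>f (fst z) - g (snd z)\<bar>)"
    by (intro continuous_intros continuous_map_compose[OF continuous_map_fst cf(1), unfolded o_def]
        continuous_map_compose[OF continuous_map_snd cf(2), unfolded o_def])
  then have "closedin (prod_topology X Y) {z \<in> topspace (prod_topology X Y). \<bar>f (fst z) - g (snd z)\<bar> \<in> {..e}}"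
    by (rule closedin_continuous_map_preimage) auto
  moreover have "closedin (prod_topology X Y) (U \<times> V)"
    using UV by (simp add: closedin_prod_Times_iff)
  ultimately have "closedin (prod_topology X Y)
      ((U \<times> V) \<inter> {z \<in> topspace (prod_topology X Y). \<bar>f (fst z) - g (snd z)\<bar> \<in> {..e}})"
    by (rule closedin_Int[rotated])
  moreover have "(U \<times> V) \<inter> {z \<in> topspace (prod_topology X Y). \<bar>f (fst z) - g (snd z)\<bar> \<in> {..e}}
      = {(x, y). close e p x y}"
  proof -
    have "U \<subseteq> topspace X" "V \<subseteq> topspace Y" using UV(1,2) openin_subset by blast+
    then show ?thesis by (auto simp: close_def p)
  qed
  ultimately show ?thesis by simp
qed

lemma corr_closedin:
  assumes "finite S" "\<And>p. p \<in> S \<Longrightarrow> tile \<delta> \<delta>' p"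
  shows "closedin (prod_topology X Y) (corr S e)"
proof -
  have "corr S e = (\<Union>p\<in>S. {(x, y). close e p x y})" by (auto simp: corr_def)
  moreover have "closedin (prod_topology X Y) (\<Union>p\<in>S. {(x, y). close e p x y})"
  proof (rule closedin_Union)
    fix K assume "K \<in> (\<lambda>p. {(x, y). close e p x y}) ` S"
    then obtain p where "p \<in> S" "K = {(x, y). close e p x y}" by blast
    then show "closedin (prod_topology X Y) K" using tile_closedin[OF assms(2)] by simp
  qed (use assms(1) in simp)
  ultimately show ?thesis by simp
qed

text \<open>The height of \<open>x\<close> leaves \<open>{a..b}\<close> by at most
  \<open>\<delta>\<close>, and \<open>D\<close> attains every value of this interval; a partner of
  \<open>x\<close> is found in \<open>D\<close> at the clamped height.\<close>

lemma corr_total: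
  assumes S: "tiling (topspace X) (topspace Y) S" "\<And>p. p \<in> S \<Longrightarrow> tile \<delta> \<delta>' p"
    and "\<delta> \<ge> 0" "\<delta> \<le> e" and x: "x \<in> topspace X"
  shows "\<exists>y. (x, y) \<in> corr S e"
proof -
  have "x \<in> (\<Union>p\<in>S. fst p)" using S(1) x by (simp add: tiling_def)
  then obtain p where p: "p \<in> S" "x \<in> fst p" by blast
  obtain U V f g where pe: "p = (U, V, f, g)" by (cases p)
  have "tile \<delta> \<delta>' (U, V, f, g)" using S(2)[OF p(1)] pe by simp
  then obtain D a b where D: "spans Y g D a b" "D \<subseteq> V" and f: "f ` U \<subseteq> {a - \<delta>..b + \<delta>}"
    by (rule tileE)
  have fx: "a - \<delta> \<le> f x" "f x \<le> b + \<delta>" using f p(2) by (auto simp: pe)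
  have gD: "g ` D = {a..b}" "a < b" using D by (auto simp: spans_def)
  have "max a (min b (f x)) \<in> g ` D" using gD by auto
  then obtain y where y: "y \<in> D" "g y = max a (min b (f x))" by (metis imageE)
  have "\<bar>f x - g y\<bar> \<le> e" using fx gD(2) assms(3,4) by (auto simp: y(2))
  then have "close e p x y" using p(2) y(1) D(2) by (auto simp: close_def pe)
  then show ?thesis using p(1) by (auto simp: corr_def)
qed

text \<open>By disjointness both pairs lie in one tile, so \<open>y\<close> and \<open>y'\<close>
  are compared in a single height \<open>g\<close>, which expands \<open>s\<close>.\<close>

lemma corr_unique:
  assumes S: "tiling (topspace X) (topspace Y) S" "\<And>p. p \<in> S \<Longrightarrow> tile \<delta> \<delta>' p \<and>
        (fst (snd p) \<subseteq> B \<or> fst (snd p) \<inter> B = {})"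
    and xy: "(x, y) \<in> corr S e" "(x, y') \<in> corr S e"
  shows "\<bar>s y - s y'\<bar> \<le> 2 * e" "y \<in> B \<longleftrightarrow> y' \<in> B"
proof -
  obtain p q where pq: "p \<in> S" "q \<in> S" "close e p x y" "close e q x y'" using xy by (auto simp: corr_def)
  have "x \<in> fst p" "x \<in> fst q" using pq by (auto simp: close_def split: prod.splits)
  then have [simp]: "q = p" using S(1) pq(1,2) unfolding tiling_def by blast
  obtain U V f g where pe: "p = (U, V, f, g)" by (cases p)
  have "tile \<delta> \<delta>' (U, V, f, g)" using S(2)[OF pq(1)] pe by simp
  then have g: "height Y s g" "clopenin Y V" using tileE by metis+
  have y: "y \<in> V" "y' \<in> V" "\<bar>f x - g y\<bar> \<le> e" "\<bar>f x - g y'\<bar> \<le> e"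
    using pq(3,4) by (auto simp: close_def pe)
  have "y \<in> topspace Y" "y' \<in> topspace Y" using g(2) y(1,2) openin_subset by blast+
  then have "\<bar>s y - s y'\<bar> \<le> \<bar>g y - g y'\<bar>" by (rule height_abs[OF g(1)])
  then show "\<bar>s y - s y'\<bar> \<le> 2 * e" using y by linarith
  show "y \<in> B \<longleftrightarrow> y' \<in> B" using S(2)[OF pq(1)] y by (auto simp: pe)
qed

lemma initial_tile:
  assumes ct: "continuous_map X euclideanreal t" and dt: "dense_arcs X t" and ne: "topspace X \<noteq> {}"
    and cs: "continuous_map Y euclideanreal s" and ds: "dense_arcs Y s" and neY: "topspace Y \<noteq> {}"
  shows "\<exists>\<delta> f g. \<delta> > 0 \<and> tile \<delta> \<delta> (topspace X, topspace Y, f, g)"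
proof -
  have span: "\<exists>C a b. spans Z h C a b"
    if dZ: "dense_arcs Z h" and "topspace Z \<noteq> {}" for Z :: "'z topology" and h
  proof -
    obtain x where "x \<in> topspace Z" using \<open>topspace Z \<noteq> {}\<close> by blast
    then obtain C where C: "C \<in> connected_components_of Z" "x \<in> C" by (rule ex_component)
    have hx: "h x \<in> h ` C" using C by blast
    obtain D a b where "D \<in> connected_components_of Z" "h ` D = {a..b}" "a < b"
      by (rule dense_arcsE[OF dZ C(1) hx hx order_refl conjI[OF openin_topspace closedin_topspace]
            connected_components_of_subset[OF C(1)] zero_less_one])
    then show ?thesis unfolding spans_def by blast
  qed
  obtain C a b where C: "spans X t C a b" using span[OF dt ne] by blast
  obtain D c d where D: "spans Y s D c d" using span[OF ds neY] by blast
  have ab: "a < b" "c < d" using C D by (auto simp: spans_def)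
  \<comment> \<open>Scaling both arcs to the larger of their lengths gives both affine maps slope at
    least 1, as \<open>height_compose\<close> demands.\<close>
  define m where "m = max (b - a) (d - c)"
  have m: "m > 0" "b - a \<le> m" "d - c \<le> m" using ab by (auto simp: m_def)
  define k where "k = m / (b - a)"
  define l where "l = m / (d - c)"
  define G where "G = (\<lambda>x. (x - a) * k)"
  define H where "H = (\<lambda>x. (x - c) * l)"
  have k: "1 \<le> k" "1 \<le> l" using m ab by (auto simp: k_def l_def)
  have eG: "y - x \<le> G y - G x" "y - x \<le> H y - H x" if "x \<le> y" for x y
  proof -
    have "(y - x) * 1 \<le> (y - x) * k" "(y - x) * 1 \<le> (y - x) * l"
      using k that by (intro mult_left_mono; simp)+
    then show "y - x \<le> G y - G x" "y - x \<le> H y - H x" by (simp_all add: G_def H_def algebra_simps)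
  qed
  have cG: "continuous_on UNIV G" "continuous_on UNIV H" unfolding G_def H_def by (intro continuous_intros)+
  have mG: "mono G" "mono H"
    using eG by (smt (verit) monoI)+
  have hX: "height X t t" and hY: "height Y s s" using assms by (auto simp: height_def)
  have GH: "G a = 0" "G b = m" "H c = 0" "H d = m" using ab by (auto simp: G_def H_def k_def l_def)
  have "spans X (\<lambda>x. G (t x)) C 0 m" using spans_compose[OF C cG(1) mG(1)] GH m(1) by simp
  moreover have "spans Y (\<lambda>x. H (s x)) D 0 m" using spans_compose[OF D cG(2) mG(2)] GH m(1) by simp
  moreover have h1: "height X t (\<lambda>x. G (t x))" by (rule height_compose[OF hX cG(1) eG(1)])
  moreover have h2: "height Y s (\<lambda>x. H (s x))" by (rule height_compose[OF hY cG(2) eG(2)])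
  moreover have bdd: "\<exists>K. \<forall>x\<in>topspace Z. \<bar>h x\<bar> \<le> K"
    if "compact_space Z" "continuous_map Z euclideanreal h" for Z :: "'z topology" and h
  proof -
    have "compact (h ` topspace Z)"
      using that image_compactin compact_space_def compactin_euclidean_iff by metis
    then show ?thesis using compact_imp_bounded bounded_iff by (metis imageI real_norm_def)
  qed
  obtain K where K: "\<forall>x\<in>topspace X. \<bar>G (t x)\<bar> \<le> K"
    using bdd[OF compX, of "\<lambda>x. G (t x)"] h1 by (auto simp: height_def)
  obtain L where L: "\<forall>x\<in>topspace Y. \<bar>H (s x)\<bar> \<le> L"
    using bdd[OF compY, of "\<lambda>x. H (s x)"] h2 by (auto simp: height_def)
  \<comment> \<open>The first tile is everything, so its tolerance is just a bound for both images;
    the 1 makes it positive.\<close>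
  define \<delta> where "\<delta> = max 1 (max K L)"
  have iX: "(\<lambda>x. G (t x)) ` topspace X \<subseteq> {0 - \<delta>..m + \<delta>}"
    using K m by (force simp: \<delta>_def)
  have iY: "(\<lambda>x. H (s x)) ` topspace Y \<subseteq> {0 - \<delta>..m + \<delta>}"
    using L m by (force simp: \<delta>_def)
  have "C \<subseteq> topspace X" "D \<subseteq> topspace Y"
    using C D by (auto simp: spans_def connected_components_of_subset)
  ultimately have "tile \<delta> \<delta> (topspace X, topspace Y, \<lambda>x. G (t x), \<lambda>x. H (s x))"
    unfolding tile_def prod.case using iX iY by (metis openin_topspace closedin_topspace)
  moreover have "\<delta> > 0" by (simp add: \<delta>_def)
  ultimately show ?thesis by blast
qed

text \<open>Stage \<open>n + 1\<close> puts each tile on one side of \<open>A n\<close> and of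
  \<open>B n\<close>. Two points related to the same point at all stages therefore agree in the
  original height and in all these clopen sets, and coincide.\<close>

theorem homeomorphic:
  assumes ct: "continuous_map X euclideanreal t" and dt: "dense_arcs X t" and neX: "topspace X \<noteq> {}"
    and cs: "continuous_map Y euclideanreal s" and ds: "dense_arcs Y s" and neY: "topspace Y \<noteq> {}"
    and A: "\<And>n::nat. clopenin X (A n)" and B: "\<And>n::nat. clopenin Y (B n)"
    and sepX: "\<And>x x'. x \<in> topspace X \<Longrightarrow> x' \<in> topspace X \<Longrightarrow> t x = t x' \<Longrightarrow> (\<And>n. x \<in> A n \<longleftrightarrow> x' \<in> A n) \<Longrightarrow> x = x'"
    and sepY: "\<And>y y'. y \<in> topspace Y \<Longrightarrow> y' \<in> topspace Y \<Longrightarrow> s y = s y' \<Longrightarrow> (\<And>n. y \<in> B n \<longleftrightarrow> y' \<in> B n) \<Longrightarrow> y = y'"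
  shows "X homeomorphic_space Y"
proof -
  interpret sw: fence_pair Y s X t by (rule swap)
  obtain \<delta>0 f0 g0 where \<delta>0: "\<delta>0 > 0" and t0: "tile \<delta>0 \<delta>0 (topspace X, topspace Y, f0, g0)"
    using initial_tile[OF ct dt neX cs ds neY] by blast
  \<comment> \<open>The ratio 3 and the radius \<open>4 * \<delta> n\<close> are fitted to the loss
    in \<open>refine_tiling_both\<close>: from \<open>\<delta> n = 3 * \<delta> (Suc n)\<close>
    follows \<open>4 * \<delta> (Suc n) + 2 * \<delta> n + 2 * \<delta> (Suc n) = 4 * \<delta>
    n\<close>, so the relations decrease.\<close>
  define \<delta> :: "nat \<Rightarrow> real" where "\<delta> = (\<lambda>n. \<delta>0 / 3 ^ n)"
  have \<delta>: "\<delta> n > 0" "\<delta> n = 3 * \<delta> (Suc n)" for n using \<delta>0 by (auto simp: \<delta>_def)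
  define P where "P n S \<longleftrightarrow> tiling (topspace X) (topspace Y) S \<and> (\<forall>p\<in>S. tile (\<delta> n) (\<delta> n) p)" for n S
  define Q where "Q n S T \<longleftrightarrow> corr T (4 * \<delta> (Suc n)) \<subseteq> corr S (4 * \<delta> n) \<and>
      (\<forall>p\<in>T. (fst p \<subseteq> A n \<or> fst p \<inter> A n = {}) \<and> (fst (snd p) \<subseteq> B n \<or> fst (snd p) \<inter> B n = {}))" for n S T
  have "\<exists>S. \<forall>n. P n (S n) \<and> Q n (S n) (S (Suc n))"
  proof (rule dependent_nat_choice)
    have "P 0 {(topspace X, topspace Y, f0, g0)}" using t0 by (simp add: P_def tiling_def \<delta>_def)
    then show "\<exists>S. P 0 S" by blast
    fix S n assume S: "P n S"
    have e: "4 * \<delta> (Suc n) + 2 * \<delta> n + 2 * \<delta> (Suc n) = 4 * \<delta> n" using \<delta>(2)[of n] by simp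
    have le: "\<delta> (Suc n) \<le> \<delta> n" using \<delta>[of n] \<delta>(1)[of "Suc n"] by simp
    obtain T where T: "tiling (topspace X) (topspace Y) T"
       and Tp: "\<forall>p\<in>T. tile (\<delta> (Suc n)) (\<delta> (Suc n)) p \<and> (fst p \<subseteq> A n \<or> fst p \<inter> A n = {}) \<and>
              (fst (snd p) \<subseteq> B n \<or> fst (snd p) \<inter> B n = {})"
       and Te: "\<forall>e. corr T e \<subseteq> corr S (e + 2 * \<delta> n + 2 * \<delta> (Suc n))"
      using refine_tiling_both[of S "\<delta> n" "\<delta> (Suc n)" "A n" "B n"] S \<delta>(1) le A B unfolding P_def by metis
    have "corr T (4 * \<delta> (Suc n)) \<subseteq> corr S (4 * \<delta> n)" using Te e by metis
    then have "P (Suc n) T \<and> Q n S T" unfolding P_def Q_def using T Tp by blast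
    then show "\<exists>T. P (Suc n) T \<and> Q n S T" by blast
  qed
  then obtain S where S: "\<And>n. P n (S n)" "\<And>n. Q n (S n) (S (Suc n))" by blast
  have til: "tiling (topspace X) (topspace Y) (S n)" for n using S(1) by (simp add: P_def)
  have tl: "tile (\<delta> n) (\<delta> n) p" if "p \<in> S n" for n p using S(1) that by (simp add: P_def)
  have fin: "finite (S n)" for n using til[of n] by (simp add: tiling_def)
  define E where "E n = corr (S n) (4 * \<delta> n)" for n
  have clE: "closedin (prod_topology X Y) (E n)" for n
    unfolding E_def by (rule corr_closedin[OF fin tl])
  have decE: "E (Suc n) \<subseteq> E n" for n using S(2)[of n] by (simp add: E_def Q_def)
  have EXY: "x \<in> topspace X" "y \<in> topspace Y" if "(x, y) \<in> E n" for x y n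
    using closedin_subset[OF clE] that by auto
  have tot: "\<exists>y. (x, y) \<in> E n" if "x \<in> topspace X" for x n
    unfolding E_def by (rule corr_total[OF til tl _ _ that]) (use \<delta>(1)[of n] in auto)
  have tot': "\<exists>x. (x, y) \<in> E n" if "y \<in> topspace Y" for y n
  proof -
    have 1: "sw.tiling (topspace Y) (topspace X) (flip ` S n)" using til by (simp add: tiling_flip)
    have 2: "sw.tile (\<delta> n) (\<delta> n) p" if "p \<in> flip ` S n" for p using that tl by (auto simp: tile_flip)
    have "\<exists>x. (y, x) \<in> sw.corr (flip ` S n) (4 * \<delta> n)"
      by (rule sw.corr_total[OF 1 2 _ _ that]) (use \<delta>(1)[of n] in auto)
    then show ?thesis by (simp add: corr_flip E_def)
  qed
  have lim: "c = d" if "\<And>n. \<bar>c - d\<bar> \<le> 2 * (4 * \<delta> n)" for c d :: real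
  proof -
    have "(\<lambda>n. 2 * (4 * (\<delta>0 * (1 / 3) ^ n))) \<longlonglongrightarrow> 2 * (4 * (\<delta>0 * 0))"
      by (intro tendsto_intros LIMSEQ_realpow_zero) auto
    then have "\<bar>c - d\<bar> \<le> 0"
      by (intro LIMSEQ_le_const[where X = "\<lambda>n. 2 * (4 * (\<delta>0 * (1 / 3) ^ n))"])
        (use that in \<open>auto simp: \<delta>_def power_one_over\<close>)
    then show ?thesis by simp
  qed
  have uniq: "y = y'" if xy: "\<And>n. (x, y) \<in> E n" "\<And>n. (x, y') \<in> E n" for x y y'
  proof (rule sepY)
    show "y \<in> topspace Y" "y' \<in> topspace Y" using EXY xy by blast+
    show "s y = s y'"
    proof (rule lim)
      fix n
      \<comment> \<open>Every tile is on one side of the empty set; with it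
        \<open>corr_unique\<close> yields the estimate of heights at stage \<open>n\<close>.\<close>
      have a: "tile (\<delta> n) (\<delta> n) p \<and> (fst (snd p) \<subseteq> {} \<or> fst (snd p) \<inter> {} = {})" if "p \<in> S n" for p
        using tl[OF that] by simp
      show "\<bar>s y - s y'\<bar> \<le> 2 * (4 * \<delta> n)"
        using corr_unique(1)[OF til a] xy unfolding E_def by blast
    qed
    fix n
    have a: "tile (\<delta> (Suc n)) (\<delta> (Suc n)) p \<and> (fst (snd p) \<subseteq> B n \<or> fst (snd p) \<inter> B n = {})"
      if "p \<in> S (Suc n)" for p
      using tl[OF that] S(2)[of n] that by (simp add: Q_def)
    show "y \<in> B n \<longleftrightarrow> y' \<in> B n"
      using corr_unique(2)[OF til a] xy unfolding E_def by blast
  qed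
  have uniq': "x = x'" if xy: "\<And>n. (x, y) \<in> E n" "\<And>n. (x', y) \<in> E n" for x x' y
  proof (rule sepX)
    have ti: "sw.tiling (topspace Y) (topspace X) (flip ` S n)" for n using til by (simp add: tiling_flip)
    have yx: "(y, x) \<in> sw.corr (flip ` S n) (4 * \<delta> n)" "(y, x') \<in> sw.corr (flip ` S n) (4 * \<delta> n)" for n
      using xy[of n] by (simp_all add: corr_flip E_def)
    show "x \<in> topspace X" "x' \<in> topspace X" using EXY xy by blast+
    show "t x = t x'"
    proof (rule lim)
      fix n
      have a: "sw.tile (\<delta> n) (\<delta> n) p \<and> (fst (snd p) \<subseteq> {} \<or> fst (snd p) \<inter> {} = {})" if "p \<in> flip ` S n" for p
        using that tl by (auto simp: tile_flip)
      show "\<bar>t x - t x'\<bar> \<le> 2 * (4 * \<delta> n)"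
        using sw.corr_unique(1)[OF ti a yx] by blast
    qed
    fix n
    have a: "sw.tile (\<delta> (Suc n)) (\<delta> (Suc n)) p \<and> (fst (snd p) \<subseteq> A n \<or> fst (snd p) \<inter> A n = {})"
      if p: "p \<in> flip ` S (Suc n)" for p
    proof -
      obtain q where q: "q \<in> S (Suc n)" "p = flip q" using p by blast
      then show ?thesis using tl[OF q(1)] S(2)[of n] by (simp add: Q_def tile_flip)
    qed
    show "x \<in> A n \<longleftrightarrow> x' \<in> A n"
      using sw.corr_unique(2)[OF ti a yx] by blast
  qed
  have ex: "\<exists>y. \<forall>n. (x, y) \<in> E n" if x: "x \<in> topspace X" for x
  proof -
    \<comment> \<open>The sections of the relations at \<open>x\<close> are closed, nonempty and
      decreasing, so compactness gives a common point.\<close>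
    have "\<exists>y. \<forall>n. y \<in> {y \<in> topspace Y. (x, y) \<in> E n}"
    proof (rule compact_decreasing[OF compY])
      show "closedin Y {y \<in> topspace Y. (x, y) \<in> E n}" for n
        by (rule closedin_continuous_map_preimage[OF _ clE]) (use x in \<open>simp add: continuous_map_pairedI\<close>)
      show "{y \<in> topspace Y. (x, y) \<in> E n} \<noteq> {}" for n using tot[OF x, of n] EXY by blast
    qed (use decE in blast)
    then show ?thesis by auto
  qed
  have ex': "\<exists>x. \<forall>n. (x, y) \<in> E n" if y: "y \<in> topspace Y" for y
  proof -
    have "\<exists>x. \<forall>n. x \<in> {x \<in> topspace X. (x, y) \<in> E n}"
    proof (rule compact_decreasing[OF compX])
      show "closedin X {x \<in> topspace X. (x, y) \<in> E n}" for n
        by (rule closedin_continuous_map_preimage[OF _ clE]) (use y in \<open>simp add: continuous_map_pairedI\<close>)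
      show "{x \<in> topspace X. (x, y) \<in> E n} \<noteq> {}" for n using tot'[OF y, of n] EXY by blast
    qed (use decE in blast)
    then show ?thesis by auto
  qed
  obtain h where h: "\<And>x n. x \<in> topspace X \<Longrightarrow> (x, h x) \<in> E n" using ex by metis
  have hY: "h x \<in> topspace Y" if "x \<in> topspace X" for x using h[OF that, of 0] EXY by blast
  \<comment> \<open>The graph of \<open>h\<close> is the intersection of all \<open>E n\<close>,
    hence closed, and projection along the compact \<open>Y\<close> is a closed map.\<close>
  have "closedin X {x \<in> topspace X. h x \<in> K}" if K: "closedin Y K" for K
  proof -
    have "closedin (prod_topology X Y) ((\<Inter>n. E n) \<inter> topspace X \<times> K)"
      using clE K by (intro closedin_Int closedin_INT) (auto simp: closedin_prod_Times_iff)
    then have "closedin X (fst ` ((\<Inter>n. E n) \<inter> topspace X \<times> K))"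
      using closed_map_fst[OF compY, of X] closed_map_def by blast
    moreover have "fst ` ((\<Inter>n. E n) \<inter> topspace X \<times> K) = {x \<in> topspace X. h x \<in> K}"
    proof (intro equalityI subsetI)
      fix x assume "x \<in> fst ` ((\<Inter>n. E n) \<inter> topspace X \<times> K)"
      then obtain y where y: "\<And>n. (x, y) \<in> E n" "x \<in> topspace X" "y \<in> K" by force
      then have "y = h x" using uniq h by metis
      then show "x \<in> {x \<in> topspace X. h x \<in> K}" using y by simp
    next
      fix x assume x: "x \<in> {x \<in> topspace X. h x \<in> K}"
      then have "(x, h x) \<in> (\<Inter>n. E n) \<inter> topspace X \<times> K" using h by auto
      then show "x \<in> fst ` ((\<Inter>n. E n) \<inter> topspace X \<times> K)" by force
    qed
    ultimately show ?thesis by simp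
  qed
  then have "continuous_map X Y h" using hY by (auto simp: continuous_map_closedin)
  moreover have "h ` topspace X = topspace Y"
  proof
    show "topspace Y \<subseteq> h ` topspace X"
    proof
      fix y assume "y \<in> topspace Y"
      then obtain x where x: "\<And>n. (x, y) \<in> E n" using ex' by blast
      then have xX: "x \<in> topspace X" using EXY by blast
      then have "h x = y" using uniq h x by metis
      then show "y \<in> h ` topspace X" using xX by blast
    qed
  qed (use hY in auto)
  moreover have "inj_on h (topspace X)"
  proof (rule inj_onI)
    fix x x' assume xx: "x \<in> topspace X" "x' \<in> topspace X" "h x = h x'"
    show "x = x'" by (rule uniq'[of _ "h x"]) (use h xx in metis)+
  qed
  ultimately have "homeomorphic_map X Y h" by (intro continuous_imp_homeomorphic_map compX hausY)
  then show ?thesis by (rule homeomorphic_map_imp_homeomorphic_space)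
qed

end

section \<open>Fences with a height function\<close>

lemma compact_metrizable_imp_second_countable:
  assumes "compact_space X" "metrizable_space X"
  shows "second_countable X"
proof -
  obtain M d where "Metric_space M d" and X: "X = Metric_space.mtopology M d"
    using assms(2) by (auto simp: metrizable_space_def)
  then interpret Metric_space M d by simp
  have "mtotally_bounded M"
    using assms(1) compact_space_eq_mcomplete_mtotally_bounded unfolding X by blast
  then have "\<exists>K. finite K \<and> K \<subseteq> M \<and> M \<subseteq> (\<Union>x\<in>K. mball x (inverse (Suc n)))" for n
    unfolding mtotally_bounded_def by simp
  then obtain K where K: "\<And>n. finite (K n)" "\<And>n. K n \<subseteq> M"
      "\<And>n. M \<subseteq> (\<Union>x\<in>K n. mball x (inverse (Suc n)))" by metis
  let ?B = "\<Union>n. (\<lambda>x. mball x (inverse (Suc n))) ` K n"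
  have "\<exists>V\<in>?B. x \<in> V \<and> V \<subseteq> U" if U: "openin mtopology U" "x \<in> U" for U x
  proof -
    obtain e where e: "e > 0" "mball x e \<subseteq> U" "x \<in> M" using U openin_mtopology by (metis subsetD)
    obtain n where n: "inverse (Suc n) < e / 2" using reals_Archimedean[of "e / 2"] e(1) by auto
    obtain k where k: "k \<in> K n" "x \<in> mball k (inverse (Suc n))" using K(3) e(3) by blast
    have "mball k (inverse (Suc n)) \<subseteq> mball x e"
    proof
      fix z assume z: "z \<in> mball k (inverse (Suc n))"
      have "d x z \<le> d x k + d k z" using z k(2) by (intro triangle) auto
      also have "\<dots> < e" using z k(2) n by (auto simp: commute)
      finally show "z \<in> mball x e" using z e(3) by simp
    qed
    moreover have "mball k (inverse (Suc n)) \<in> ?B" by (rule UN_I[where a = n], simp, rule imageI[OF k(1)])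
    ultimately show ?thesis using k(2) e(2) by (meson order_trans)
  qed
  moreover have "countable ?B" using K(1) by (simp add: countable_finite)
  moreover have "\<forall>V\<in>?B. openin mtopology V" by auto
  ultimately show ?thesis unfolding second_countable_def X by (intro exI[of _ ?B]) simp
qed

lemma second_countable_subcover:
  assumes "second_countable X" "\<forall>U\<in>\<U>. openin X U"
  shows "\<exists>\<V>\<subseteq>\<U>. countable \<V> \<and> \<Union>\<V> = \<Union>\<U>"
proof -
  obtain \<B> where B: "countable \<B>" "\<And>U x. openin X U \<Longrightarrow> x \<in> U \<Longrightarrow> \<exists>V\<in>\<B>. x \<in> V \<and> V \<subseteq> U"
    using assms(1) unfolding second_countable_def by metis
  define \<B>' where "\<B>' = {V \<in> \<B>. \<exists>U\<in>\<U>. V \<subseteq> U}"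
  have "\<forall>V\<in>\<B>'. \<exists>U. U \<in> \<U> \<and> V \<subseteq> U" by (auto simp: \<B>'_def)
  then obtain u where u: "\<And>V. V \<in> \<B>' \<Longrightarrow> u V \<in> \<U> \<and> V \<subseteq> u V" by metis
  show ?thesis
  proof (intro exI[of _ "u ` \<B>'"] conjI)
    show "countable (u ` \<B>')" using B(1) by (simp add: \<B>'_def)
    show sub: "u ` \<B>' \<subseteq> \<U>" using u by blast
    show "\<Union>(u ` \<B>') = \<Union>\<U>"
    proof
      show "\<Union>\<U> \<subseteq> \<Union>(u ` \<B>')"
      proof
        fix x assume "x \<in> \<Union>\<U>"
        then obtain U where U: "U \<in> \<U>" "x \<in> U" by blast
        then obtain V where V: "V \<in> \<B>" "x \<in> V" "V \<subseteq> U" using B(2) assms(2) by blast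
        then have "V \<in> \<B>'" using U(1) by (auto simp: \<B>'_def)
        then show "x \<in> \<Union>(u ` \<B>')" using u V(2) by blast
      qed
    qed (use sub in blast)
  qed
qed

lemma compact_metrizable_subcover:
  assumes "compact_space X" "metrizable_space X" "\<forall>U\<in>\<U>. openin (prod_topology X X) U"
  shows "\<exists>\<V>\<subseteq>\<U>. countable \<V> \<and> \<Union>\<V> = \<Union>\<U>"
proof (rule second_countable_subcover[OF _ assms(3)])
  show "second_countable (prod_topology X X)"
    using assms by (intro compact_metrizable_imp_second_countable)
      (simp_all add: compact_space_prod_topology metrizable_space_prod_topology)
qed

text \<open>Two points of different components form a pair in the product of a clopen set with its
  complement. These products are open in the square, so countably many clopen sets serve all such
  pairs.\<close>

lemma countable_clopen_separation:
  assumes X: "compact_space X" "Hausdorff_space X"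
    and Lin: "\<And>\<U>. \<forall>U\<in>\<U>. openin (prod_topology X X) U \<Longrightarrow> \<exists>\<V>\<subseteq>\<U>. countable \<V> \<and> \<Union>\<V> = \<Union>\<U>"
  obtains A :: "nat \<Rightarrow> 'a set" where "\<And>n. clopenin X (A n)"
    "\<And>C D x y. C \<in> connected_components_of X \<Longrightarrow> D \<in> connected_components_of X \<Longrightarrow> C \<noteq> D \<Longrightarrow>
       x \<in> C \<Longrightarrow> y \<in> D \<Longrightarrow> \<exists>n. x \<in> A n \<and> y \<notin> A n"
proof -
  define P where "P U = U \<times> (topspace X - U)" for U
  let ?K = "{U. clopenin X U}"
  have "\<forall>O'\<in>P ` ?K. openin (prod_topology X X) O'"
    by (auto simp: P_def openin_prod_Times_iff)
  then obtain \<V> where V: "\<V> \<subseteq> P ` ?K" "countable \<V>" "\<Union>\<V> = \<Union>(P ` ?K)"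
    using Lin[of "P ` ?K"] by blast
  obtain \<G> where G: "\<G> \<subseteq> ?K" "countable \<G>" "\<V> = P ` \<G>"
    using V(1,2) countable_subset_image[of \<V> P ?K] by auto
  \<comment> \<open>The empty set makes the enumerated family nonempty.\<close>
  define A where "A = from_nat_into (insert {} \<G>)"
  have rA: "range A = insert {} \<G>"
    unfolding A_def using G(2) by (intro range_from_nat_into) auto
  show thesis
  proof (rule that[of A])
    fix n
    have "A n \<in> insert {} \<G>" using rA by blast
    then show "clopenin X (A n)" using G(1) by auto
  next
    fix C D x y
    assume CD: "C \<in> connected_components_of X" "D \<in> connected_components_of X" "C \<noteq> D" "x \<in> C" "y \<in> D"
    have "closedin X D" by (rule closedin_connected_components_of[OF CD(2)])
    moreover have "C \<subseteq> topspace X - D"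
      using components_disjoint[OF CD(1-3)] connected_components_of_subset[OF CD(1)] by blast
    ultimately obtain U where U: "clopenin X U" "C \<subseteq> U" "U \<subseteq> topspace X - D"
      using clopen_nbhd_of_component[OF X CD(1), of "topspace X - D"] by blast
    have "y \<in> topspace X" using CD connected_components_of_subset by blast
    then have "(x, y) \<in> P U" using U CD by (auto simp: P_def)
    then have "(x, y) \<in> \<Union>(P ` ?K)" using U(1) by blast
    then have "(x, y) \<in> \<Union>\<V>" using V(3) by simp
    then obtain U' where "U' \<in> \<G>" "(x, y) \<in> P U'" unfolding G(3) by blast
    then show "\<exists>n. x \<in> A n \<and> y \<notin> A n" using rA unfolding P_def
      by (metis DiffD2 insertI2 mem_Sigma_iff rangeE)
  qed
qed

text \<open>The condition of the theorem, isolated so that it can be transported along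
  homeomorphisms.\<close>

definition joins_arcs :: "'a topology \<Rightarrow> bool" where
  "joins_arcs Y \<longleftrightarrow>
    (\<forall>U V. openin Y U \<and> openin Y V \<and>
           (\<exists>C \<in> connected_components_of Y. C \<inter> U \<noteq> {} \<and> C \<inter> V \<noteq> {}) \<longrightarrow>
       (\<exists>K p q. arc_component Y K \<and> arc_endpoints Y K p q \<and> p \<in> U \<and> q \<in> V))"

text \<open>The common interface for smooth fences and for the quotient of the limit; injectivity on
  components stands in for the partial order.\<close>

locale fence_height =
  fixes Y :: "'a topology" and t :: "'a \<Rightarrow> real"
  assumes comp: "compact_space Y" and haus: "Hausdorff_space Y"
    and cont: "continuous_map Y euclideanreal t"
    and inj: "\<And>C. C \<in> connected_components_of Y \<Longrightarrow> inj_on t C"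
begin

text \<open>The height along a parametrisation is continuous and injective on \<open>{0..1}\<close>,
  hence monotone, so the endpoints have the extreme heights. \<open>min\<close> and
  \<open>max\<close> reflect that the parametrisation may run downward.\<close>

lemma arc_image:
  assumes K: "K \<in> connected_components_of Y" and g: "arc_endpoints Y K p q"
  shows "p \<in> K" "q \<in> K" "t p \<noteq> t q" "t ` K = {min (t p) (t q)..max (t p) (t q)}"
proof -
  obtain \<gamma> where hm: "homeomorphic_map (top_of_set {0..1::real}) (subtopology Y K) \<gamma>" and \<gamma>: "\<gamma> 0 = p" "\<gamma> 1 = q"
    using g by (auto simp: arc_endpoints_def)
  have KY: "K \<subseteq> topspace Y" by (rule connected_components_of_subset[OF K])
  have im: "\<gamma> ` {0..1} = K"
    using homeomorphic_imp_surjective_map[OF hm] KY by (simp add: Int_absorb1)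
  show pq: "p \<in> K" "q \<in> K" using im \<gamma> by force+
  have inj\<gamma>: "inj_on \<gamma> {0..1}" using homeomorphic_imp_injective_map[OF hm] by simp
  have "p \<noteq> q" using inj_onD[OF inj\<gamma>, of 0 1] \<gamma> by auto
  then show ne: "t p \<noteq> t q" using inj[OF K] pq by (auto simp: inj_on_def)
  have "continuous_map (top_of_set {0..1::real}) euclideanreal (t \<circ> \<gamma>)"
    using continuous_map_compose[OF homeomorphic_imp_continuous_map[OF hm] continuous_map_from_subtopology[OF cont]] .
  then have c: "continuous_on {0..1} (\<lambda>z. t (\<gamma> z))" by (simp add: o_def)
  have i: "inj_on (\<lambda>z. t (\<gamma> z)) {0..1}"
    using comp_inj_on[of \<gamma> "{0..1}" t] inj\<gamma> inj[OF K] im by (simp add: o_def)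
  have btw: "min (t p) (t q) \<le> t (\<gamma> z) \<and> t (\<gamma> z) \<le> max (t p) (t q)" if "z \<in> {0..1}" for z
  proof (cases "z = 0 \<or> z = 1")
    case True then show ?thesis using \<gamma> by auto
  next
    case False
    then have "0 < z" "z < 1" using that by auto
    then show ?thesis using continuous_inj_imp_mono[OF _ _ c i, of z] \<gamma> by auto
  qed
  obtain a b where ab: "a \<le> b" "t ` K = {a..b}" by (rule component_image_interval[OF comp K cont])
  show "t ` K = {min (t p) (t q)..max (t p) (t q)}"
  proof
    show "t ` K \<subseteq> {min (t p) (t q)..max (t p) (t q)}" using btw im by auto
    have "t p \<in> {a..b}" "t q \<in> {a..b}" using ab(2) pq by blast+
    then show "{min (t p) (t q)..max (t p) (t q)} \<subseteq> t ` K" using ab by auto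
  qed
qed

lemma dense_arcsI:
  assumes "joins_arcs Y"
  shows "dense_arcs Y t"
  unfolding dense_arcs_def
proof (intro ballI allI impI; elim conjE)
  fix C x y W and e :: real
  assume C: "C \<in> connected_components_of Y" and x: "x \<in> t ` C" and y: "y \<in> t ` C"
    and xy: "x \<le> y" and W: "openin Y W" "closedin Y W" "C \<subseteq> W" and e: "0 < e"
  obtain u v where uv: "u \<in> C" "t u = x" "v \<in> C" "t v = y" using x y by blast
  \<comment> \<open>For \<open>x < y\<close> the windows of radius \<open>d\<close> around the two
    values are disjoint, so the arc rises from \<open>p\<close> to \<open>q\<close>; for
    \<open>x = y\<close> its direction does not matter.\<close>
  define d where "d = (if x < y then min e ((y - x) / 2) else e)"
  have d: "0 < d" "d \<le> e" "x < y \<Longrightarrow> 2 * d \<le> y - x" using e by (auto simp: d_def min_def)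
  define N where "N w = W \<inter> {z \<in> topspace Y. t z \<in> {w - d<..<w + d}}" for w
  have N: "openin Y (N w)" for w
    unfolding N_def by (intro openin_Int W openin_continuous_map_preimage[OF cont]) auto
  have CY: "C \<subseteq> topspace Y" by (rule connected_components_of_subset[OF C])
  have "u \<in> N x" "v \<in> N y" using uv W(3) CY d(1) by (auto simp: N_def)
  then have "C \<inter> N x \<noteq> {}" "C \<inter> N y \<noteq> {}" using uv by blast+
  then obtain K p q where K: "arc_component Y K" "arc_endpoints Y K p q" "p \<in> N x" "q \<in> N y"
    using assms N C unfolding joins_arcs_def by metis
  have Kc: "K \<in> connected_components_of Y" using K(1) by (simp add: arc_component_def)
  note im = arc_image[OF Kc K(2)]
  have p: "p \<in> W" "\<bar>t p - x\<bar> < d" "\<bar>t q - y\<bar> < d" using K(3,4) by (auto simp: N_def)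
  have KW: "K \<subseteq> W" using component_clopen_cases[OF Kc, of W] W p(1) im(1) by blast
  have "\<bar>min (t p) (t q) - x\<bar> < e \<and> \<bar>max (t p) (t q) - y\<bar> < e"
  proof (cases "x < y")
    case True
    then have "t p < t q" using p d(3) by auto
    then show ?thesis using p d(2) by auto
  next
    case False
    then show ?thesis using xy p d(2) by auto
  qed
  moreover have "min (t p) (t q) < max (t p) (t q)" using im(3) by auto
  ultimately show "\<exists>D a b. D \<in> connected_components_of Y \<and> D \<subseteq> W \<and> t ` D = {a..b} \<and> a < b \<and> \<bar>a - x\<bar> < e \<and> \<bar>b - y\<bar> < e"
    using Kc KW im(4) by blast
qed

text \<open>Injectivity keeps \<open>t c\<close> away from the compact set of heights of
  \<open>C - U\<close>. So \<open>C\<close> lies in the union of \<open>U\<close> with the points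
  whose height is far from \<open>t c\<close>, and a clopen neighbourhood of \<open>C\<close> inside
  this union is the required \<open>W\<close>.\<close>

lemma tube:
  assumes C: "C \<in> connected_components_of Y" "c \<in> C" and U: "openin Y U" "c \<in> U"
  obtains W e where "clopenin Y W" "C \<subseteq> W" "e > 0" "\<And>z. z \<in> W \<Longrightarrow> \<bar>t z - t c\<bar> < e \<Longrightarrow> z \<in> U"
proof -
  have CY: "C \<subseteq> topspace Y" by (rule connected_components_of_subset[OF C(1)])
  have "closedin Y (C - U)" using closedin_connected_components_of[OF C(1)] U(1) by blast
  then have "compactin Y (C - U)" using comp closedin_compact_space by blast
  then have "compact (t ` (C - U))"
    using image_compactin[OF _ cont] compactin_euclidean_iff by blast
  then have "open (- (t ` (C - U)))" by (simp add: compact_imp_closed open_Compl)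
  moreover have "t c \<in> - (t ` (C - U))" using inj[OF C(1)] C(2) U(2) by (auto simp: inj_on_def)
  ultimately obtain e where e: "e > 0" "ball (t c) e \<subseteq> - (t ` (C - U))" by (meson open_contains_ball)
  define O' where "O' = U \<union> {z \<in> topspace Y. t z \<in> - cball (t c) (e / 2)}"
  have "openin Y O'"
    unfolding O'_def by (intro openin_Un U openin_continuous_map_preimage[OF cont]) auto
  moreover have "C \<subseteq> O'"
  proof
    fix z assume z: "z \<in> C"
    show "z \<in> O'"
    proof (cases "z \<in> U")
      case False
      then have "t z \<notin> ball (t c) e" using e(2) z by blast
      then have "t z \<notin> cball (t c) (e / 2)" using e(1) by auto
      then show ?thesis using z CY unfolding O'_def by blast
    qed (simp add: O'_def)
  qed
  ultimately obtain W where W: "clopenin Y W" "C \<subseteq> W" "W \<subseteq> O'"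
    using clopen_nbhd_of_component[OF comp haus C(1)] by blast
  have "z \<in> U" if "z \<in> W" "\<bar>t z - t c\<bar> < e / 2" for z
  proof -
    have "t z \<in> cball (t c) (e / 2)" using that(2) by (simp add: dist_real_def abs_minus_commute)
    then show ?thesis using W(3) that(1) unfolding O'_def by blast
  qed
  then show thesis using that[OF W(1,2), of "e / 2"] e(1) by simp
qed

text \<open>On the compact \<open>D\<close> the injective height is an embedding; an increasing and
  a decreasing affine map then give parametrisations in both directions.\<close>

lemma arc_endpointsI:
  assumes D: "D \<in> connected_components_of Y" "t ` D = {a..b}" "a < b"
    and pq: "p \<in> D" "q \<in> D" "t p = a" "t q = b"
  shows "arc_component Y D" "arc_endpoints Y D p q" "arc_endpoints Y D q p"
proof -
  have DY: "D \<subseteq> topspace Y" by (rule connected_components_of_subset[OF D(1)])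
  have ctD: "continuous_map (subtopology Y D) euclideanreal t" by (rule continuous_map_from_subtopology[OF cont])
  have ends: "\<exists>\<gamma>. homeomorphic_map (top_of_set {0..1::real}) (subtopology Y D) \<gamma> \<and> \<gamma> 0 = p' \<and> \<gamma> 1 = q'"
    if u: "continuous_on UNIV u" "inj u" "u ` {a..b} = {0..1}" "u (t p') = 0" "u (t q') = 1" "p' \<in> D" "q' \<in> D"
    for u :: "real \<Rightarrow> real" and p' q'
  proof -
    have im: "(u \<circ> t) ` D = {0..1}" using D(2) u(3) by (metis image_comp)
    have "continuous_map (subtopology Y D) euclideanreal (u \<circ> t)"
      by (rule continuous_map_compose[OF ctD]) (use u(1) in simp)
    then have "continuous_map (subtopology Y D) (top_of_set {0..1}) (u \<circ> t)"
      unfolding continuous_map_in_subtopology using im DY by auto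
    then have hm: "homeomorphic_map (subtopology Y D) (top_of_set {0..1}) (u \<circ> t)"
    proof (rule continuous_imp_homeomorphic_map)
      show "compact_space (subtopology Y D)"
        using closedin_connected_components_of[OF D(1)] comp
        by (simp add: closedin_compact_space compact_space_subtopology)
      show "(u \<circ> t) ` topspace (subtopology Y D) = topspace (top_of_set {0..1})"
        using im DY by (simp add: Int_absorb1)
      show "inj_on (u \<circ> t) (topspace (subtopology Y D))"
        using DY inj[OF D(1)] u(2) by (simp add: Int_absorb1 comp_inj_on inj_on_subset)
    qed (auto simp: Hausdorff_space_subtopology)
    then obtain \<gamma> where g: "homeomorphic_maps (subtopology Y D) (top_of_set {0..1}) (u \<circ> t) \<gamma>"
      by (auto simp: homeomorphic_map_maps)
    have "homeomorphic_map (top_of_set {0..1}) (subtopology Y D) \<gamma>"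
      using g homeomorphic_maps_sym homeomorphic_map_maps by blast
    moreover have "\<gamma> ((u \<circ> t) z) = z" if "z \<in> D" for z
      using g that DY by (auto simp: homeomorphic_maps_def)
    ultimately show ?thesis using u by (metis comp_apply)
  qed
  have "\<exists>\<gamma>. homeomorphic_map (top_of_set {0..1::real}) (subtopology Y D) \<gamma> \<and> \<gamma> 0 = p \<and> \<gamma> 1 = q"
  proof (rule ends[where u = "\<lambda>x. (x - a) / (b - a)"])
    show "(\<lambda>x. (x - a) / (b - a)) ` {a..b} = {0..1}"
      using continuous_mono_image_interval[of "\<lambda>x. (x - a) / (b - a)" a b] D(3)
      by (simp add: monoI divide_right_mono continuous_intros)
  qed (use D(3) pq in \<open>auto intro!: continuous_intros injI\<close>)
  then show e: "arc_endpoints Y D p q" by (simp add: arc_endpoints_def)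
  have "\<exists>\<gamma>. homeomorphic_map (top_of_set {0..1::real}) (subtopology Y D) \<gamma> \<and> \<gamma> 0 = q \<and> \<gamma> 1 = p"
  proof (rule ends[where u = "\<lambda>x. (b - x) / (b - a)"])
    have "(\<lambda>x. (b - x) / (b - a)) = (\<lambda>x. 1 - x) \<circ> (\<lambda>x. (x - a) / (b - a))"
      using D(3) by (auto simp: field_simps)
    then have "(\<lambda>x. (b - x) / (b - a)) ` {a..b} = (\<lambda>x. 1 - x) ` (\<lambda>x. (x - a) / (b - a)) ` {a..b}"
      by (metis image_comp)
    also have "(\<lambda>x. (x - a) / (b - a)) ` {a..b} = {0..1}"
      using continuous_mono_image_interval[of "\<lambda>x. (x - a) / (b - a)" a b] D(3)
      by (simp add: monoI divide_right_mono continuous_intros)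
    finally show "(\<lambda>x. (b - x) / (b - a)) ` {a..b} = {0..1}" by simp
  qed (use D(3) pq in \<open>auto intro!: continuous_intros injI\<close>)
  then show "arc_endpoints Y D q p" by (simp add: arc_endpoints_def)
  show "arc_component Y D"
    using e D(1) unfolding arc_component_def arc_endpoints_def
    by (meson homeomorphic_map_imp_homeomorphic_space homeomorphic_space_sym)
qed

text \<open>Neighbourhoods of points of \<open>C\<close> are replaced by tubes, in which a height
  close to the given one suffices. \<open>dense_arcs\<close> needs the lower value first, so the arc
  is found in that order and its parametrisation reversed if need be.\<close>

lemma joins_arcsI:
  assumes "dense_arcs Y t"
  shows "joins_arcs Y"
  unfolding joins_arcs_def
proof (intro allI impI; elim conjE bexE)
  have main: "\<exists>K p q. arc_component Y K \<and> arc_endpoints Y K p q \<and> arc_endpoints Y K q p \<and> p \<in> U \<and> q \<in> V"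
    if U: "openin Y U" "openin Y V" and C: "C \<in> connected_components_of Y"
      and cd: "c \<in> C" "c \<in> U" "d \<in> C" "d \<in> V" "t c \<le> t d" for U V C c d
  proof -
    obtain W e where W: "clopenin Y W" "C \<subseteq> W" "e > 0" "\<And>z. z \<in> W \<Longrightarrow> \<bar>t z - t c\<bar> < e \<Longrightarrow> z \<in> U"
      using tube[OF C cd(1) U(1) cd(2)] by metis
    obtain W' e' where W': "clopenin Y W'" "C \<subseteq> W'" "e' > 0" "\<And>z. z \<in> W' \<Longrightarrow> \<bar>t z - t d\<bar> < e' \<Longrightarrow> z \<in> V"
      using tube[OF C cd(3) U(2) cd(4)] by metis
    have 1: "t c \<in> t ` C" "t d \<in> t ` C" using cd by auto
    have 2: "clopenin Y (W \<inter> W')" "C \<subseteq> W \<inter> W'" "min e e' > 0" using W W' by auto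
    obtain D a b where D: "D \<in> connected_components_of Y" "D \<subseteq> W \<inter> W'" "t ` D = {a..b}" "a < b"
      "\<bar>a - t c\<bar> < min e e'" "\<bar>b - t d\<bar> < min e e'"
      by (rule dense_arcsE[OF assms C 1 cd(5) 2])
    have "a \<in> t ` D" "b \<in> t ` D" using D by auto
    then obtain p q where pq: "p \<in> D" "q \<in> D" "t p = a" "t q = b" by blast
    have "p \<in> U" "q \<in> V" using W(4)[of p] W'(4)[of q] D pq by auto
    then show ?thesis using arc_endpointsI[OF D(1,3,4) pq] by blast
  qed
  fix U V C
  assume U: "openin Y U" "openin Y V" and C: "C \<in> connected_components_of Y" "C \<inter> U \<noteq> {}" "C \<inter> V \<noteq> {}"
  obtain c d where cd: "c \<in> C" "c \<in> U" "d \<in> C" "d \<in> V" using C by blast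
  show "\<exists>K p q. arc_component Y K \<and> arc_endpoints Y K p q \<and> p \<in> U \<and> q \<in> V"
  proof (cases "t c \<le> t d")
    case True
    then show ?thesis using main[OF U C(1) cd] by blast
  next
    case False
    then show ?thesis using main[OF U(2,1) C(1) cd(3,4,1,2)] by (meson linear)
  qed
qed

end

section \<open>Existence of a height and uniqueness of the fence\<close>

lemma smooth_fence_height:
  assumes "smooth_fence Y"
  obtains t where "fence_height Y t"
proof -
  have f: "fence Y" using assms by (simp add: smooth_fence_def)
  have Y: "compact_space Y" "Hausdorff_space Y" "metrizable_space Y"
    using f by (auto simp: fence_def metrizable_imp_Hausdorff_space)
  obtain r where r: "closedin (prod_topology Y Y) r" "partial_order_on (topspace Y) r"
      "\<And>C. C \<in> connected_components_of Y \<Longrightarrow> total_on C r"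
    using assms by (auto simp: smooth_fence_def)
  have o: "refl_on (topspace Y) r" "trans r" "antisym r"
    using r(2) by (auto simp: partial_order_on_def preorder_on_def)
  interpret compact_preorder Y r
    by unfold_locales (use Y r(1) o in \<open>auto simp: refl_on_def elim: transE\<close>)
  obtain t where t: "continuous_map Y euclideanreal t" 
      "\<And>u v. (u, v) \<in> r \<Longrightarrow> (v, u) \<notin> r \<Longrightarrow> t u < t v"
    using strict_monotone_fun compact_metrizable_subcover[OF Y(1,3)] by metis
  have "inj_on t C" if C: "C \<in> connected_components_of Y" for C
  proof (rule inj_onI, rule ccontr)
    fix u v assume uv: "u \<in> C" "v \<in> C" "t u = t v" "u \<noteq> v"
    then have "(u, v) \<in> r \<or> (v, u) \<in> r" using r(3)[OF C] by (auto simp: total_on_def)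
    moreover have "\<not> ((u, v) \<in> r \<and> (v, u) \<in> r)" using o(3) uv(4) by (auto simp: antisym_def)
    ultimately show False using t(2)[of u v] t(2)[of v u] uv(3) by auto
  qed
  then have "fence_height Y t" by (intro fence_height.intro Y t(1))
  then show thesis by (rule that)
qed

text \<open>Countably many clopen sets distinguish components and the height distinguishes points
  within one; together they meet the separation hypotheses of \<open>homeomorphic\<close>.\<close>

theorem fence_uniqueness:
  assumes t: "fence_height X t" "dense_arcs X t" "topspace X \<noteq> {}"
    and s: "fence_height Y s" "dense_arcs Y s" "topspace Y \<noteq> {}"
    and LX: "\<And>\<U>. \<forall>U\<in>\<U>. openin (prod_topology X X) U \<Longrightarrow> \<exists>\<V>\<subseteq>\<U>. countable \<V> \<and> \<Union>\<V> = \<Union>\<U>"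
    and LY: "\<And>\<U>. \<forall>U\<in>\<U>. openin (prod_topology Y Y) U \<Longrightarrow> \<exists>\<V>\<subseteq>\<U>. countable \<V> \<and> \<Union>\<V> = \<Union>\<U>"
  shows "X homeomorphic_space Y"
proof -
  interpret X: fence_height X t by (rule t)
  interpret Y: fence_height Y s by (rule s)
  interpret fence_pair X t Y s by unfold_locales (rule X.comp X.haus Y.comp Y.haus)+
  have sep: "\<exists>A :: nat \<Rightarrow> 'z set. (\<forall>n. clopenin Z (A n)) \<and>
      (\<forall>x\<in>topspace Z. \<forall>x'\<in>topspace Z. h x = h x' \<longrightarrow> (\<forall>n. x \<in> A n \<longleftrightarrow> x' \<in> A n) \<longrightarrow> x = x')"
    if Z: "fence_height Z h" and L: "\<And>\<U>. \<forall>U\<in>\<U>. openin (prod_topology Z Z) U \<Longrightarrow> \<exists>\<V>\<subseteq>\<U>. countable \<V> \<and> \<Union>\<V> = \<Union>\<U>"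
    for Z :: "'z topology" and h
  proof -
    interpret Z: fence_height Z h by (rule Z)
    obtain A :: "nat \<Rightarrow> 'z set" where A: "\<And>n. clopenin Z (A n)" and
      sep: "\<And>C D x y. C \<in> connected_components_of Z \<Longrightarrow> D \<in> connected_components_of Z \<Longrightarrow> C \<noteq> D \<Longrightarrow>
       x \<in> C \<Longrightarrow> y \<in> D \<Longrightarrow> \<exists>n. x \<in> A n \<and> y \<notin> A n"
      using countable_clopen_separation[OF Z.comp Z.haus L] by metis
    have "x = x'" if x: "x \<in> topspace Z" "x' \<in> topspace Z" "h x = h x'" "\<And>n. x \<in> A n \<longleftrightarrow> x' \<in> A n" for x x'
    proof -
      obtain C where C: "C \<in> connected_components_of Z" "x \<in> C" by (rule ex_component[OF x(1)])
      obtain D where D: "D \<in> connected_components_of Z" "x' \<in> D" by (rule ex_component[OF x(2)])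
      have "C = D" using sep[OF C(1) D(1) _ C(2) D(2)] x(4) by blast
      then show ?thesis using Z.inj[OF C(1)] C(2) D(2) x(3) by (auto simp: inj_on_def)
    qed
    then show ?thesis using A by blast
  qed
  obtain A :: "nat \<Rightarrow> 'a set" where A: "\<And>n. clopenin X (A n)"
     "\<And>x x'. x \<in> topspace X \<Longrightarrow> x' \<in> topspace X \<Longrightarrow> t x = t x' \<Longrightarrow> (\<And>n. x \<in> A n \<longleftrightarrow> x' \<in> A n) \<Longrightarrow> x = x'"
    using sep[OF t(1) LX] by metis
  obtain B :: "nat \<Rightarrow> 'b set" where B: "\<And>n. clopenin Y (B n)"
     "\<And>x x'. x \<in> topspace Y \<Longrightarrow> x' \<in> topspace Y \<Longrightarrow> s x = s x' \<Longrightarrow> (\<And>n. x \<in> B n \<longleftrightarrow> x' \<in> B n) \<Longrightarrow> x = x'"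
    using sep[OF s(1) LY] by metis
  show ?thesis
    by (rule homeomorphic[OF X.cont t(2,3) Y.cont s(2,3) A(1) B(1) A(2) B(2)])
qed

lemma homeomorphic_space_joins_arcs:
  assumes "X homeomorphic_space Y" "joins_arcs X"
  shows "joins_arcs Y"
  unfolding joins_arcs_def
proof (intro allI impI; elim conjE bexE)
  obtain h g where hg: "homeomorphic_maps X Y h g" using assms(1) by (auto simp: homeomorphic_space_def)
  then have h: "homeomorphic_map X Y h" by (auto simp: homeomorphic_map_maps)
  have ch: "continuous_map X Y h" by (rule homeomorphic_imp_continuous_map[OF h])
  fix U V C
  assume U: "openin Y U" "openin Y V" and C: "C \<in> connected_components_of Y" "C \<inter> U \<noteq> {}" "C \<inter> V \<noteq> {}"
  have comps: "connected_components_of Y = (image h) ` (connected_components_of X)"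
    by (rule homeomorphic_map_connected_components_of[OF h])
  define pre where "pre W = {x \<in> topspace X. h x \<in> W}" for W
  have o: "openin X (pre U)" "openin X (pre V)" unfolding pre_def
    using openin_continuous_map_preimage[OF ch] U by auto
  obtain C' where C': "C' \<in> connected_components_of X" "C = h ` C'" using C(1) comps by blast
  have "C' \<subseteq> topspace X" by (rule connected_components_of_subset[OF C'(1)])
  then have "C' \<inter> pre U \<noteq> {}" "C' \<inter> pre V \<noteq> {}" using C(2,3) C'(2) unfolding pre_def by blast+
  then obtain K p q where K: "arc_component X K" "arc_endpoints X K p q" "p \<in> pre U" "q \<in> pre V"
    using assms(2) o C'(1) unfolding joins_arcs_def by metis
  have Kc: "K \<in> connected_components_of X" using K(1) by (simp add: arc_component_def)
  have KX: "K \<subseteq> topspace X" by (rule connected_components_of_subset[OF Kc])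
  have hK: "homeomorphic_map (subtopology X K) (subtopology Y (h ` K)) h"
    by (rule homeomorphic_map_subtopologies[OF h]) (use KX homeomorphic_imp_surjective_map[OF h] in blast)
  obtain \<gamma> where \<gamma>: "homeomorphic_map (top_of_set {0..1::real}) (subtopology X K) \<gamma>" "\<gamma> 0 = p" "\<gamma> 1 = q"
    using K(2) by (auto simp: arc_endpoints_def)
  have 1: "homeomorphic_map (top_of_set {0..1::real}) (subtopology Y (h ` K)) (h \<circ> \<gamma>)"
    by (rule homeomorphic_map_compose[OF \<gamma>(1) hK])
  have "arc_endpoints Y (h ` K) (h p) (h q)"
    unfolding arc_endpoints_def using 1 \<gamma> by (metis comp_apply)
  moreover have "arc_component Y (h ` K)"
    unfolding arc_component_def
  proof
    show "h ` K \<in> connected_components_of Y" using comps Kc by blast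
    show "subtopology Y (h ` K) homeomorphic_space top_of_set {0..1::real}"
      using 1 by (meson homeomorphic_map_imp_homeomorphic_space homeomorphic_space_sym)
  qed
  ultimately show "\<exists>K p q. arc_component Y K \<and> arc_endpoints Y K p q \<and> p \<in> U \<and> q \<in> V"
    using K(3,4) unfolding pre_def by blast
qed

section \<open>Covering Hasse forests by chains\<close>

text \<open>\<open>ch\<close> labels the chain of a point and \<open>rk\<close> counts from its
  bottom. The last clause excludes gaps, so immediate successors are exactly consecutive ranks and
  questions about chains become arithmetic.\<close>

definition chain_forest :: "'a lr_structure \<Rightarrow> ('a \<Rightarrow> nat) \<Rightarrow> ('a \<Rightarrow> nat) \<Rightarrow> bool" where
  "chain_forest B ch rk \<longleftrightarrow> (\<exists>T. finite T \<and> T \<noteq> {} \<and> space_of B = discrete_topology T \<and>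
     le_of B = {(x, y). x \<in> T \<and> y \<in> T \<and> ch x = ch y \<and> rk x \<le> rk y} \<and>
     rel_of B = {(x, y). x \<in> T \<and> y \<in> T \<and> ch x = ch y \<and> rk x \<le> Suc (rk y) \<and> rk y \<le> Suc (rk x)} \<and>
     (\<forall>x\<in>T. \<forall>y\<in>T. ch x = ch y \<longrightarrow> rk x = rk y \<longrightarrow> x = y) \<and>
     (\<forall>x\<in>T. \<forall>k<rk x. \<exists>y\<in>T. ch y = ch x \<and> rk y = k))"

lemma finite_discrete_topological_structure:
  assumes "finite T" "space_of B = discrete_topology T" "rel_of B \<subseteq> T \<times> T" "le_of B \<subseteq> T \<times> T"
  shows "topological_structure B"
proof -
  have "prod_topology (discrete_topology T) (discrete_topology T) = discrete_topology (T \<times> T)"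
    by (simp add: prod_topology_discrete_topology)
  moreover have "zero_dimensional_space (discrete_topology T)"
    unfolding zero_dimensional_space_def
  proof (intro allI impI)
    fix U x assume "openin (discrete_topology T) U \<and> x \<in> U"
    then show "\<exists>V. openin (discrete_topology T) V \<and> closedin (discrete_topology T) V \<and> x \<in> V \<and> V \<subseteq> U"
      by (intro exI[of _ U]) simp
  qed
  ultimately show ?thesis using assms
    by (simp add: topological_structure_def compact_space_discrete_topology metrizable_space_discrete_topology)
qed

lemma finite_hasse_forest_if_chain_forest:
  assumes "chain_forest B ch rk"
  shows "finite_hasse_forest B"
proof -
  obtain T where T: "finite T" "T \<noteq> {}" "space_of B = discrete_topology T"
     and le: "le_of B = {(x, y). x \<in> T \<and> y \<in> T \<and> ch x = ch y \<and> rk x \<le> rk y}"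
     and rel: "rel_of B = {(x, y). x \<in> T \<and> y \<in> T \<and> ch x = ch y \<and> rk x \<le> Suc (rk y) \<and> rk y \<le> Suc (rk x)}"
     and inj': "\<forall>x\<in>T. \<forall>y\<in>T. ch x = ch y \<longrightarrow> rk x = rk y \<longrightarrow> x = y"
     and full': "\<forall>x\<in>T. \<forall>k<rk x. \<exists>y\<in>T. ch y = ch x \<and> rk y = k"
    using assms unfolding chain_forest_def by (elim exE conjE) (rule that; assumption)
  have inj: "\<And>x y. x \<in> T \<Longrightarrow> y \<in> T \<Longrightarrow> ch x = ch y \<Longrightarrow> rk x = rk y \<Longrightarrow> x = y"
    and full: "\<And>x k. x \<in> T \<Longrightarrow> k < rk x \<Longrightarrow> \<exists>y\<in>T. ch y = ch x \<and> rk y = k"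
    using inj' full' by simp_all
  have imm: "immediate_successor (le_of B) x y \<longleftrightarrow> x \<in> T \<and> y \<in> T \<and> ch x = ch y \<and> rk y = Suc (rk x)" for x y
  proof
    assume i: "immediate_successor (le_of B) x y"
    then have xy: "x \<in> T" "y \<in> T" "ch x = ch y" "rk x \<le> rk y" "x \<noteq> y"
      by (auto simp: immediate_successor_def le)
    then have "rk x < rk y" using inj by (metis le_neq_implies_less)
    moreover have False if lt: "Suc (rk x) < rk y"
    proof -
      obtain z where z: "z \<in> T" "ch z = ch y" "rk z = Suc (rk x)" using full[OF xy(2) lt] by blast
      then have "(x, z) \<in> le_of B" "(z, y) \<in> le_of B" "z \<noteq> x" "z \<noteq> y" using xy lt by (auto simp: le)
      then show False using i unfolding immediate_successor_def by blast
    qed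
    ultimately have "rk y = Suc (rk x)" by (cases "Suc (rk x) < rk y") auto
    then show "x \<in> T \<and> y \<in> T \<and> ch x = ch y \<and> rk y = Suc (rk x)" using xy by simp
  next
    assume xy: "x \<in> T \<and> y \<in> T \<and> ch x = ch y \<and> rk y = Suc (rk x)"
    have nb: False if "(x, c) \<in> le_of B" "(c, y) \<in> le_of B" "c \<noteq> x" "c \<noteq> y" for c
    proof -
      have c: "c \<in> T" "ch c = ch x" "rk x \<le> rk c" "rk c \<le> Suc (rk x)" using that xy by (auto simp: le)
      then have "rk c = rk x \<or> rk c = rk y" using xy by auto
      then show False using inj[OF c(1), of x] inj[OF c(1), of y] c(2) xy that(3,4) by metis
    qed
    have "(x, y) \<in> le_of B" "x \<noteq> y" using xy by (auto simp: le)
    then show "immediate_successor (le_of B) x y" unfolding immediate_successor_def using nb by metis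
  qed
  have po: "partial_order_on T (le_of B)"
    unfolding partial_order_on_def preorder_on_def refl_on_def trans_def antisym_def
    using inj by (auto simp: le)
  have edge: "hasse_edge (le_of B) x y \<longleftrightarrow>
     x \<in> T \<and> y \<in> T \<and> ch x = ch y \<and> (rk y = Suc (rk x) \<or> rk x = Suc (rk y))" for x y
    unfolding hasse_edge_def imm by auto
  have relh: "rel_of B = {(a, b). a \<in> T \<and> b \<in> T \<and> (a = b \<or> hasse_edge (le_of B) a b)}"
  proof -
    have "(a = b \<or> ch a = ch b \<and> (rk b = Suc (rk a) \<or> rk a = Suc (rk b))) \<longleftrightarrow>
        ch a = ch b \<and> rk a \<le> Suc (rk b) \<and> rk b \<le> Suc (rk a)" if "a \<in> T" "b \<in> T" for a b
      using inj[OF that] by (auto simp: le_Suc_eq)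
    then show ?thesis unfolding rel edge by auto
  qed
  have "\<not> hasse_cycle (le_of B) xs" for xs
  proof
    assume cyc: "hasse_cycle (le_of B) xs"
    define n where "n = length xs"
    have n: "n \<ge> 3" "distinct xs" and ed: "\<And>i. i < n \<Longrightarrow> hasse_edge (le_of B) (xs ! i) (xs ! (Suc i mod n))"
      using cyc by (auto simp: hasse_cycle_def n_def)
    \<comment> \<open>At a vertex of largest rank both neighbours on the cycle have rank one less in
      the same chain, so they coincide; a cycle of length at least 3 does not allow this.\<close>
    define m where "m = (ARG_MAX (\<lambda>i. rk (xs ! i)) i. i < n)"
    have "\<exists>b. \<forall>i. i < n \<longrightarrow> rk (xs ! i) < b"
      using finite_nat_set_iff_bounded[of "(\<lambda>i. rk (xs ! i)) ` {..<n}"] by auto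
    then obtain b where b: "\<forall>i. i < n \<longrightarrow> rk (xs ! i) < b" by blast
    have m: "m < n" "\<And>i. i < n \<Longrightarrow> rk (xs ! i) \<le> rk (xs ! m)"
      using arg_max_nat_lemma[of "\<lambda>i. i < n" 0 "\<lambda>i. rk (xs ! i)" b] b n(1) by (auto simp: m_def)
    define i where "i = (if Suc m = n then 0 else Suc m)"
    define j where "j = (if m = 0 then n - 1 else m - 1)"
    have ij: "i < n" "j < n" "i \<noteq> j" using m(1) n(1) by (auto simp: i_def j_def)
    have "Suc m mod n = i" using m(1) by (auto simp: i_def)
    then have ei: "hasse_edge (le_of B) (xs ! m) (xs ! i)" using ed[OF m(1)] by simp
    have "Suc j mod n = m" using m(1) n(1) by (auto simp: j_def)
    then have ej: "hasse_edge (le_of B) (xs ! j) (xs ! m)" using ed[OF ij(2)] by simp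
    have "xs ! i = xs ! j"
    proof (rule inj)
      show "xs ! i \<in> T" "xs ! j \<in> T" "ch (xs ! i) = ch (xs ! j)" using ei ej unfolding edge by auto
      show "rk (xs ! i) = rk (xs ! j)" using ei ej m(2)[OF ij(1)] m(2)[OF ij(2)] unfolding edge by auto
    qed
    then show False using ij n(2) by (simp add: nth_eq_iff_index_eq n_def)
  qed
  moreover have "topological_structure B"
    by (rule finite_discrete_topological_structure[OF T(1,3)]) (auto simp: le rel)
  ultimately show ?thesis
    unfolding finite_hasse_forest_def using T po relh by simp
qed

text \<open>Induction on the size of the interval: an intermediate \<open>c\<close> splits it into
  two proper subintervals, one missing \<open>b\<close> and the other missing
  \<open>a\<close>.\<close>

lemma saturated_chain:
  assumes "finite T" "partial_order_on T r" "(a, b) \<in> r"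
  shows "\<exists>n p. p 0 = a \<and> p n = b \<and> (\<forall>i<n. immediate_successor r (p i) (p (Suc i)))"
  using assms(3)
proof (induction "card {c. (a, c) \<in> r \<and> (c, b) \<in> r}" arbitrary: a b rule: less_induct)
  case less
  have sub: "r \<subseteq> T \<times> T" and tr: "trans r" and as: "antisym r" and rf: "refl_on T r"
    using assms(2) by (auto simp: partial_order_on_def preorder_on_def)
  have fin: "finite {c. (x, c) \<in> r \<and> (c, y) \<in> r}" for x y
    by (rule finite_subset[OF _ assms(1)]) (use sub in auto)
  have ab: "(a, a) \<in> r" "(b, b) \<in> r" using rf sub less.prems by (auto simp: refl_on_def)
  consider "a = b" | "immediate_successor r a b" |
    c where "a \<noteq> b" "(a, c) \<in> r" "(c, b) \<in> r" "c \<noteq> a" "c \<noteq> b"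
    using less.prems unfolding immediate_successor_def by blast
  then show ?case
  proof cases
    case 1
    then show ?thesis by (intro exI[of _ 0] exI[of _ "\<lambda>_. a"]) simp
  next
    case 2
    then show ?thesis by (intro exI[of _ 1] exI[of _ "\<lambda>i. if i = 0 then a else b"]) simp
  next
    case 3
    have "(b, c) \<notin> r" "(c, a) \<notin> r" using 3 as by (auto simp: antisym_def)
    have "{d. (a, d) \<in> r \<and> (d, c) \<in> r} \<subset> {d. (a, d) \<in> r \<and> (d, b) \<in> r}"
    proof
      show "{d. (a, d) \<in> r \<and> (d, c) \<in> r} \<subseteq> {d. (a, d) \<in> r \<and> (d, b) \<in> r}" using 3(3) tr by (blast elim: transE)
      show "{d. (a, d) \<in> r \<and> (d, c) \<in> r} \<noteq> {d. (a, d) \<in> r \<and> (d, b) \<in> r}"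
        using less.prems ab \<open>(b, c) \<notin> r\<close> by blast
    qed
    then have "card {d. (a, d) \<in> r \<and> (d, c) \<in> r} < card {d. (a, d) \<in> r \<and> (d, b) \<in> r}"
      by (rule psubset_card_mono[OF fin])
    from less.hyps[OF this 3(2)] obtain n p where p: "p 0 = a" "p n = c" "\<forall>i<n. immediate_successor r (p i) (p (Suc i))"
      by blast
    have "{d. (c, d) \<in> r \<and> (d, b) \<in> r} \<subset> {d. (a, d) \<in> r \<and> (d, b) \<in> r}"
    proof
      show "{d. (c, d) \<in> r \<and> (d, b) \<in> r} \<subseteq> {d. (a, d) \<in> r \<and> (d, b) \<in> r}" using 3(2) tr by (blast elim: transE)
      show "{d. (c, d) \<in> r \<and> (d, b) \<in> r} \<noteq> {d. (a, d) \<in> r \<and> (d, b) \<in> r}"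
        using less.prems ab \<open>(c, a) \<notin> r\<close> by blast
    qed
    then have "card {d. (c, d) \<in> r \<and> (d, b) \<in> r} < card {d. (a, d) \<in> r \<and> (d, b) \<in> r}"
      by (rule psubset_card_mono[OF fin])
    from less.hyps[OF this 3(3)] obtain m q where q: "q 0 = c" "q m = b" "\<forall>i<m. immediate_successor r (q i) (q (Suc i))"
      by blast
    define s where "s i = (if i \<le> n then p i else q (i - n))" for i
    have "s 0 = a" "s (n + m) = b" using p q by (auto simp: s_def)
    moreover have "immediate_successor r (s i) (s (Suc i))" if "i < n + m" for i
    proof -
      consider "i < n" | "i = n" | "n < i" by linarith
      then show ?thesis
      proof cases
        case 1 then show ?thesis using p by (simp add: s_def)
      next
        case 2 then show ?thesis using p q that by (auto simp: s_def)
      next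
        case 3
        then have "Suc i - n = Suc (i - n)" "i - n < m" using that by auto
        then show ?thesis using 3 q by (simp add: s_def)
      qed
    qed
    ultimately show ?thesis by blast
  qed
qed

text \<open>The clause on consecutive related pairs bounds the classes of \<open>R\<close> in
  \<open>rel_two_points\<close>. The last clause produces arcs: \<open>p\<close> and
  \<open>q\<close> are the bottom and the top of a chain, which controls the ends of the arc, and
  being unrelated they are not collapsed in the quotient.\<close>

definition chain_covering ::
    "'a lr_structure \<Rightarrow> 'b lr_structure \<Rightarrow> ('b \<Rightarrow> nat) \<Rightarrow> ('b \<Rightarrow> nat) \<Rightarrow> ('b \<Rightarrow> 'a) \<Rightarrow> bool" where
  "chain_covering A B ch rk \<pi> \<longleftrightarrow> chain_forest B ch rk \<and> epimorphism B A \<pi> \<and>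
     (\<forall>p q s. (p, q) \<in> rel_of B \<longrightarrow> (q, s) \<in> rel_of B \<longrightarrow> p = s \<or> \<pi> p = \<pi> q \<or> \<pi> q = \<pi> s) \<and>
     (\<forall>a b. (a, b) \<in> le_of A \<longrightarrow> (\<exists>p q. (p, q) \<in> le_of B \<and> (p, q) \<notin> rel_of B \<and> \<pi> p = a \<and> \<pi> q = b \<and>
       (\<forall>s. (s, p) \<in> le_of B \<longrightarrow> s = p) \<and> (\<forall>s. (q, s) \<in> le_of B \<longrightarrow> s = q)))"

text \<open>Every step of a saturated chain is repeated three times, so that two consecutive moves in the
  cover never both change the image, and the two ends of a chain of the cover are never related.\<close>

lemma chain_cover:
  fixes A :: "nat lr_structure"
  assumes A: "finite_hasse_forest A"
  obtains B :: "nat lr_structure" and ch rk \<pi> where "chain_covering A B ch rk \<pi>"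
proof -
  let ?T = "topspace (space_of A)"
  have fT: "finite ?T" "?T \<noteq> {}" and po: "partial_order_on ?T (le_of A)"
    and rel: "rel_of A = {(a, b). a \<in> ?T \<and> b \<in> ?T \<and> (a = b \<or> hasse_edge (le_of A) a b)}"
    using A by (auto simp: finite_hasse_forest_def)
  have sub: "le_of A \<subseteq> ?T \<times> ?T" and rf: "refl_on ?T (le_of A)" and tr: "trans (le_of A)"
    using po by (auto simp: partial_order_on_def preorder_on_def)
  have "\<forall>a b. \<exists>n p. (a, b) \<in> le_of A \<longrightarrow> p 0 = a \<and> p n = b \<and> (\<forall>i<n. immediate_successor (le_of A) (p i) (p (Suc i)))"
    using saturated_chain[OF fT(1) po] by blast
  then obtain n p where p: "\<And>a b. (a, b) \<in> le_of A \<Longrightarrow> p a b 0 = a \<and> p a b (n a b) = b \<and>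
      (\<forall>i<n a b. immediate_successor (le_of A) (p a b i) (p a b (Suc i)))" by metis
  \<comment> \<open>Three copies are taken rather than two on account of \<open>a = b\<close>: the
    saturated chain is then one point, and the ends of its cover, at ranks 0 and 2, have to be
    unrelated.\<close>
  define L where "L a b = 3 * Suc (n a b)" for a b
  \<comment> \<open>There is one chain for each comparable pair. Pair and position are coded into
    one number because universality is stated for forests of natural numbers.\<close>
  define e where "e a b k = prod_encode (prod_encode (a, b), k)" for a b k
  define U where "U = {e a b k | a b k. (a, b) \<in> le_of A \<and> k < L a b}"
  define ch where "ch x = fst (prod_decode x)" for x
  define rk where "rk x = snd (prod_decode x)" for x
  define \<pi> where "\<pi> x = p (fst (prod_decode (ch x))) (snd (prod_decode (ch x))) (rk x div 3)" for x
  have [simp]: "ch (e a b k) = prod_encode (a, b)" "rk (e a b k) = k" "\<pi> (e a b k) = p a b (k div 3)" for a b k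
    by (simp_all add: ch_def rk_def \<pi>_def e_def)
  have UE: "\<exists>a b k. x = e a b k \<and> (a, b) \<in> le_of A \<and> k < L a b" if "x \<in> U" for x
    using that by (auto simp: U_def)
  have UI: "e a b k \<in> U" if "(a, b) \<in> le_of A" "k < L a b" for a b k
    using that by (auto simp: U_def)
  define B where "B = \<lparr>space_of = discrete_topology U,
     rel_of = {(x, y). x \<in> U \<and> y \<in> U \<and> ch x = ch y \<and> rk x \<le> Suc (rk y) \<and> rk y \<le> Suc (rk x)},
     le_of = {(x, y). x \<in> U \<and> y \<in> U \<and> ch x = ch y \<and> rk x \<le> rk y}\<rparr>"
  have Bs: "space_of B = discrete_topology U"
    and Br: "rel_of B = {(x, y). x \<in> U \<and> y \<in> U \<and> ch x = ch y \<and> rk x \<le> Suc (rk y) \<and> rk y \<le> Suc (rk x)}"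
    and Bl: "le_of B = {(x, y). x \<in> U \<and> y \<in> U \<and> ch x = ch y \<and> rk x \<le> rk y}"
    by (simp_all add: B_def)
  have "U = (\<Union>(a, b)\<in>le_of A. (\<lambda>k. e a b k) ` {..<L a b})" by (auto simp: U_def)
  moreover have "finite (le_of A)" using finite_subset[OF sub] fT(1) by simp
  ultimately have finU: "finite U" by auto
  obtain a0 where "a0 \<in> ?T" using fT(2) by blast
  then have "e a0 a0 0 \<in> U" using rf by (intro UI) (auto simp: refl_on_def L_def)
  then have neU: "U \<noteq> {}" by blast
  have ch: "chain_forest B ch rk"
    unfolding chain_forest_def
  proof (intro exI[of _ U] conjI ballI allI impI finU neU Bs Br Bl)
    fix x y assume "x \<in> U" "y \<in> U" "ch x = ch y" "rk x = rk y"
    then show "x = y" by (auto dest!: UE)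
  next
    fix x k assume "x \<in> U" and k: "k < rk x"
    then obtain a b j where x: "x = e a b j" "(a, b) \<in> le_of A" "j < L a b" using UE by blast
    then have "e a b k \<in> U" using k by (intro UI) auto
    then show "\<exists>y\<in>U. ch y = ch x \<and> rk y = k" using x by (intro bexI[of _ "e a b k"]) auto
  qed
  have le_path: "(p a b i, p a b j) \<in> le_of A \<and> p a b i \<in> ?T" if ab: "(a, b) \<in> le_of A" and ij: "i \<le> j" "j \<le> n a b" for a b i j
  proof -
    have T: "p a b i \<in> ?T" if "i \<le> n a b" for i
    proof (cases i)
      case 0 then show ?thesis using p[OF ab] ab sub by auto
    next
      case (Suc k)
      then have "immediate_successor (le_of A) (p a b k) (p a b i)" using p[OF ab] that by auto
      then show ?thesis using sub by (auto simp: immediate_successor_def)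
    qed
    have "(p a b i, p a b j) \<in> le_of A" using ij
    proof (induction j rule: dec_induct)
      case base then show ?case using T[of i] rf by (auto simp: refl_on_def)
    next
      case (step j)
      then have "(p a b i, p a b j) \<in> le_of A" "(p a b j, p a b (Suc j)) \<in> le_of A"
        using p[OF ab] by (auto simp: immediate_successor_def)
      then show ?case using tr by (blast elim: transE)
    qed
    then show ?thesis using T ij by simp
  qed
  have div3: "k div 3 \<le> n a b" if "k < L a b" for a b k using that by (simp add: L_def)
  have ends: "(e a b 0, e a b (L a b - 1)) \<in> le_of B" "(e a b 0, e a b (L a b - 1)) \<notin> rel_of B"
    "\<pi> (e a b 0) = a" "\<pi> (e a b (L a b - 1)) = b" if ab: "(a, b) \<in> le_of A" for a b
  proof -
    have "(L a b - 1) div 3 = n a b" by (simp add: L_def)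
    then show "\<pi> (e a b 0) = a" "\<pi> (e a b (L a b - 1)) = b" using p[OF ab] by simp_all
    show "(e a b 0, e a b (L a b - 1)) \<in> le_of B" "(e a b 0, e a b (L a b - 1)) \<notin> rel_of B"
      using UI[OF ab] by (auto simp: Bl Br L_def)
  qed
  have leB: "\<exists>a b i j. x = e a b i \<and> y = e a b j \<and> (a, b) \<in> le_of A \<and> i < L a b \<and> j < L a b"
    if "x \<in> U" "y \<in> U" "ch x = ch y" for x y
    using UE[OF that(1)] UE[OF that(2)] that(3) by force
  have "\<pi> ` U = ?T"
  proof
    show "\<pi> ` U \<subseteq> ?T"
    proof (rule image_subsetI)
      fix x assume "x \<in> U"
      then obtain a b k where "x = e a b k" "(a, b) \<in> le_of A" "k < L a b" using UE by blast
      then show "\<pi> x \<in> ?T" using le_path[of a b "k div 3" "k div 3"] div3[of k a b] by simp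
    qed
    show "?T \<subseteq> \<pi> ` U"
    proof
      fix a assume "a \<in> ?T"
      then have aa: "(a, a) \<in> le_of A" using rf by (auto simp: refl_on_def)
      then show "a \<in> \<pi> ` U" using ends(3)[OF aa] UI[OF aa, of 0] by (force simp: L_def)
    qed
  qed
  moreover have "le_of A = map_prod \<pi> \<pi> ` le_of B"
  proof
    show "le_of A \<subseteq> map_prod \<pi> \<pi> ` le_of B"
    proof
      fix z assume z: "z \<in> le_of A"
      obtain a b where "z = (a, b)" by (cases z)
      then show "z \<in> map_prod \<pi> \<pi> ` le_of B" using ends[of a b] z
        by (intro image_eqI[of _ _ "(e a b 0, e a b (L a b - 1))"]) auto
    qed
    show "map_prod \<pi> \<pi> ` le_of B \<subseteq> le_of A"
    proof (rule image_subsetI, clarify)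
      fix x y assume xy: "(x, y) \<in> le_of B"
      then obtain a b i j where "x = e a b i" "y = e a b j" "(a, b) \<in> le_of A" "i < L a b" "j < L a b"
        using leB[of x y] unfolding Bl by blast
      then show "map_prod \<pi> \<pi> (x, y) \<in> le_of A"
        using xy le_path[of a b "i div 3" "j div 3"] div3[of j a b] by (simp add: Bl div_le_mono)
    qed
  qed
  moreover have "rel_of A = map_prod \<pi> \<pi> ` rel_of B"
  proof
    have succ: "\<exists>x y. (x, y) \<in> rel_of B \<and> (y, x) \<in> rel_of B \<and> \<pi> x = a \<and> \<pi> y = b"
      if i: "immediate_successor (le_of A) a b" for a b
    proof -
      have ab: "(a, b) \<in> le_of A" "a \<noteq> b" using i by (auto simp: immediate_successor_def)
      have "n a b \<noteq> 0" using p[OF ab(1)] ab(2) by metis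
      then have i0: "immediate_successor (le_of A) a (p a b 1)" using p[OF ab(1)] by (metis One_nat_def gr0I)
      have "(p a b 1, b) \<in> le_of A" using le_path[OF ab(1), of 1 "n a b"] p[OF ab(1)] \<open>n a b \<noteq> 0\<close> by auto
      moreover have "(a, p a b 1) \<in> le_of A" "p a b 1 \<noteq> a" using i0 by (auto simp: immediate_successor_def)
      moreover have "c = a \<or> c = b" if "(a, c) \<in> le_of A" "(c, b) \<in> le_of A" for c
        using i that unfolding immediate_successor_def by metis
      \<comment> \<open>A saturated chain starting at \<open>a\<close> reaches its immediate
        successor \<open>b\<close> in one step, so rank 2 is the last copy of \<open>a\<close> and
        rank 3 the first copy of \<open>b\<close>.\<close>
      ultimately have "p a b 1 = b" by metis
      then have "\<pi> (e a b 2) = a" "\<pi> (e a b 3) = b" using p[OF ab(1)] by simp_all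
      moreover have "3 < L a b" using \<open>n a b \<noteq> 0\<close> by (simp add: L_def)
      then have "(e a b 2, e a b 3) \<in> rel_of B" "(e a b 3, e a b 2) \<in> rel_of B"
        using UI[OF ab(1)] by (auto simp: Br)
      ultimately show ?thesis by blast
    qed
    show "rel_of A \<subseteq> map_prod \<pi> \<pi> ` rel_of B"
    proof clarify
      fix a b assume "(a, b) \<in> rel_of A"
      then have ab: "a \<in> ?T" "b \<in> ?T" "a = b \<or> immediate_successor (le_of A) a b \<or> immediate_successor (le_of A) b a"
        by (auto simp: rel hasse_edge_def)
      have "(a, a) \<in> le_of A" using rf ab(1) by (auto simp: refl_on_def)
      then have "\<pi> (e a a 0) = a" "(e a a 0, e a a 0) \<in> rel_of B"
        using ends(3) UI[of a a 0] by (auto simp: Br L_def)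
      then have "\<exists>x y. (x, y) \<in> rel_of B \<and> \<pi> x = a \<and> \<pi> y = b"
        using ab(3) succ by metis
      then show "(a, b) \<in> map_prod \<pi> \<pi> ` rel_of B" by force
    qed
    show "map_prod \<pi> \<pi> ` rel_of B \<subseteq> rel_of A"
    proof (rule image_subsetI, clarify)
      fix x y assume xy: "(x, y) \<in> rel_of B"
      then obtain a b i j where e: "x = e a b i" "y = e a b j" and ab: "(a, b) \<in> le_of A" and ij: "i < L a b" "j < L a b"
        using leB[of x y] unfolding Br by blast
      have d: "i \<le> Suc j" "j \<le> Suc i" using xy e by (auto simp: Br)
      let ?i = "i div 3" and ?j = "j div 3"
      have T: "p a b ?i \<in> ?T" "p a b ?j \<in> ?T"
        using le_path[OF ab, of ?i ?i] le_path[OF ab, of ?j ?j] div3 ij by auto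
      have "?i = ?j \<or> ?j = Suc ?i \<or> ?i = Suc ?j" using d by linarith
      then have "p a b ?i = p a b ?j \<or> hasse_edge (le_of A) (p a b ?i) (p a b ?j)"
        using p[OF ab] div3[OF ij(1)] div3[OF ij(2)] by (auto simp: hasse_edge_def)
      then show "map_prod \<pi> \<pi> (x, y) \<in> rel_of A" using T by (auto simp: rel e)
    qed
  qed
  moreover have "continuous_map (space_of B) (space_of A) \<pi>"
    using calculation(1) by (auto simp: Bs)
  ultimately have epi: "epimorphism B A \<pi>" by (simp add: epimorphism_def Bs)
  have steps: "x = z \<or> \<pi> x = \<pi> y \<or> \<pi> y = \<pi> z" if xy: "(x, y) \<in> rel_of B" and yz: "(y, z) \<in> rel_of B" for x y z
  proof -
    obtain a b i j where e1: "x = e a b i" "y = e a b j" using xy leB[of x y] unfolding Br by blast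
    obtain a' b' j' k where e2: "y = e a' b' j'" "z = e a' b' k" using yz leB[of y z] unfolding Br by blast
    have "a' = a" "b' = b" "j' = j" using e1(2) e2(1) by (auto simp: e_def)
    then have z: "z = e a b k" using e2 by simp
    have d: "i \<le> Suc j" "j \<le> Suc i" "j \<le> Suc k" "k \<le> Suc j" using xy yz by (auto simp: Br e1 z)
    \<comment> \<open>Of two consecutive unit steps at most one passes a multiple of 3.\<close>
    have *: "m div 3 = Suc m div 3 \<or> Suc m div 3 = Suc (Suc m) div 3" for m :: nat by presburger
    have "i = j \<or> k = j \<or> i = k \<or> (j = Suc i \<and> k = Suc j) \<or> (i = Suc j \<and> j = Suc k)" using d by auto
    then have "i = k \<or> i div 3 = j div 3 \<or> j div 3 = k div 3" using *[of i] *[of k] by auto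
    then show ?thesis by (auto simp: e1 z)
  qed
  have extreme: "\<exists>x y. (x, y) \<in> le_of B \<and> (x, y) \<notin> rel_of B \<and> \<pi> x = a \<and> \<pi> y = b \<and>
       (\<forall>s. (s, x) \<in> le_of B \<longrightarrow> s = x) \<and> (\<forall>s. (y, s) \<in> le_of B \<longrightarrow> s = y)" if ab: "(a, b) \<in> le_of A" for a b
  proof (intro exI conjI allI impI)
    show "(e a b 0, e a b (L a b - 1)) \<in> le_of B" "(e a b 0, e a b (L a b - 1)) \<notin> rel_of B"
      "\<pi> (e a b 0) = a" "\<pi> (e a b (L a b - 1)) = b" by (rule ends[OF ab])+
    show "s = e a b 0" if "(s, e a b 0) \<in> le_of B" for s
      using that UE[of s] by (auto simp: Bl)
    show "s = e a b (L a b - 1)" if "(e a b (L a b - 1), s) \<in> le_of B" for s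
    proof -
      have s: "s \<in> U" "ch s = prod_encode (a, b)" "L a b - 1 \<le> rk s" using that by (auto simp: Bl)
      obtain a' b' k where k: "s = e a' b' k" "k < L a' b'" using UE[OF s(1)] by blast
      then have ab': "a' = a" "b' = b" using s(2) by auto
      then have "k = L a b - 1" using k s(3) by auto
      then show ?thesis using k ab' by simp
    qed
  qed
  show thesis
    by (rule that[of B ch rk \<pi>]) (unfold chain_covering_def, intro conjI allI impI ch epi steps extreme)
qed

section \<open>The projective limit and its quotient\<close>

lemma epimorphism_compose:
  assumes f: "epimorphism A B f" and g: "epimorphism B C g"
  shows "epimorphism A C (g \<circ> f)"
proof -
  have "map_prod (g \<circ> f) (g \<circ> f) ` R = map_prod g g ` map_prod f f ` R" for R
    by (metis image_comp map_prod_compose)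
  moreover have "continuous_map (space_of A) (space_of C) (g \<circ> f)"
    using f g unfolding epimorphism_def by (meson continuous_map_compose)
  moreover have "(g \<circ> f) ` topspace (space_of A) = topspace (space_of C)"
    using f g unfolding epimorphism_def by (metis image_comp)
  ultimately show ?thesis using f g by (simp add: epimorphism_def)
qed

section \<open>Lifting, and approximation by finite quotients\<close>

locale fraisse_limit =
  fixes F :: "'a lr_structure"
  assumes limit: "projective_fraisse_limit F"
begin

abbreviation X :: "'a topology" where "X \<equiv> space_of F"
abbreviation T :: "'a set" where "T \<equiv> topspace X"

lemma limit_structure: "zero_dimensional_space X" "compact_space X" "metrizable_space X" "Hausdorff_space X"
    "closedin (prod_topology X X) (rel_of F)" "closedin (prod_topology X X) (le_of F)"
  using limit metrizable_imp_Hausdorff_space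
  by (auto simp: projective_fraisse_limit_def topological_structure_def)

lemmas limit_parts = limit[unfolded projective_fraisse_limit_def]

lemma universal:
  fixes A :: "nat lr_structure"
  assumes "finite_hasse_forest A" shows "\<exists>\<phi>. epimorphism F A \<phi>"
  using conjunct1[OF conjunct2[OF limit_parts], rule_format, OF assms] .

lemma homogeneous:
  fixes A :: "nat lr_structure"
  assumes "finite_hasse_forest A" "epimorphism F A \<phi>\<^sub>1" "epimorphism F A \<phi>\<^sub>2"
  shows "\<exists>\<psi>. automorphism F \<psi> \<and> (\<forall>x\<in>T. \<phi>\<^sub>2 x = \<phi>\<^sub>1 (\<psi> x))"
  using conjunct2[OF conjunct2[OF conjunct2[OF limit_parts]], rule_format, of A \<phi>\<^sub>1 \<phi>\<^sub>2] assms by simp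

lemma refining:
  assumes "\<And>U. U \<in> \<U> \<Longrightarrow> clopenin X U" "\<Union>\<U> = T"
  shows "\<exists>(A :: nat lr_structure) \<phi>. finite_hasse_forest A \<and> epimorphism F A \<phi> \<and>
           (\<forall>a \<in> topspace (space_of A). \<exists>U \<in> \<U>. {x \<in> T. \<phi> x = a} \<subseteq> U)"
  using conjunct1[OF conjunct2[OF conjunct2[OF limit_parts]], rule_format, of \<U>] assms by simp

text \<open>Any epimorphism \<open>\<theta>\<close> onto \<open>B\<close> gives a second epimorphism
  \<open>\<pi> \<circ> \<theta>\<close> onto \<open>A\<close>; composing \<open>\<theta>\<close>
  with the automorphism that carries this one to \<open>\<phi>\<close> yields the lift.\<close>

lemma lift:
  fixes A B :: "nat lr_structure"
  assumes A: "finite_hasse_forest A" "epimorphism F A \<phi>" and B: "finite_hasse_forest B" "epimorphism B A \<pi>"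
  shows "\<exists>\<phi>'. epimorphism F B \<phi>' \<and> (\<forall>x\<in>T. \<phi> x = \<pi> (\<phi>' x))"
proof -
  obtain \<theta> where \<theta>: "epimorphism F B \<theta>" using universal[OF B(1)] by blast
  obtain \<psi> where \<psi>: "automorphism F \<psi>" "\<forall>x\<in>T. \<phi> x = (\<pi> \<circ> \<theta>) (\<psi> x)"
    using homogeneous[OF A(1) epimorphism_compose[OF \<theta> B(2)] A(2)] by blast
  have "epimorphism F F \<psi>" using \<psi>(1) by (simp add: automorphism_def)
  then have "epimorphism F B (\<theta> \<circ> \<psi>)" by (rule epimorphism_compose[OF _ \<theta>])
  then show ?thesis using \<psi>(2) by (intro exI[of _ "\<theta> \<circ> \<psi>"]) simp
qed

text \<open>Each member of \<open>\<S>\<close> is a union of fibres of \<open>\<phi>\<close>; a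
  finite family of clopen sets thus expresses how fine \<open>\<phi>\<close> has to be.\<close>

definition adapted :: "'a set set \<Rightarrow> ('a \<Rightarrow> nat) \<Rightarrow> bool" where
  "adapted \<S> \<phi> \<longleftrightarrow> (\<forall>U\<in>\<S>. \<forall>x\<in>T. \<forall>y\<in>T. \<phi> x = \<phi> y \<longrightarrow> (x \<in> U \<longleftrightarrow> y \<in> U))"

definition clopens :: "'a set set \<Rightarrow> bool" where
  "clopens \<S> \<longleftrightarrow> finite \<S> \<and> (\<forall>U\<in>\<S>. clopenin X U)"

lemma adaptedD:
  assumes "adapted \<S> \<phi>" "U \<in> \<S>" "x \<in> T" "y \<in> T" "\<phi> x = \<phi> y"
  shows "x \<in> U \<longleftrightarrow> y \<in> U"
  using assms unfolding adapted_def by metis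

lemma adapted_Un: "adapted (\<S> \<union> \<T>) \<phi> \<longleftrightarrow> adapted \<S> \<phi> \<and> adapted \<T> \<phi>"
  by (auto simp: adapted_def)

lemma clopens_Un: "clopens (\<S> \<union> \<T>) \<longleftrightarrow> clopens \<S> \<and> clopens \<T>"
  by (auto simp: clopens_def)

lemma rel_topspace:
  "(x, y) \<in> rel_of F \<Longrightarrow> x \<in> T" "(x, y) \<in> rel_of F \<Longrightarrow> y \<in> T"
  "(x, y) \<in> le_of F \<Longrightarrow> x \<in> T" "(x, y) \<in> le_of F \<Longrightarrow> y \<in> T"
  using closedin_subset[OF limit_structure(5)] closedin_subset[OF limit_structure(6)] by auto

text \<open>The refined cover consists of all clopen sets that no member of \<open>\<S>\<close>
  cuts. It exhausts the space because every point lies in an atom of the algebra generated by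
  \<open>\<S>\<close>.\<close>

lemma ex_adapted:
  assumes "clopens \<S>"
  obtains A :: "nat lr_structure" and \<phi> where "finite_hasse_forest A" "epimorphism F A \<phi>" "adapted \<S> \<phi>"
proof -
  define \<U> where "\<U> = {V. clopenin X V \<and> (\<forall>U\<in>\<S>. V \<subseteq> U \<or> V \<inter> U = {})}"
  have fin: "finite \<S>" and cl: "\<And>U. U \<in> \<S> \<Longrightarrow> clopenin X U" using assms by (auto simp: clopens_def)
  have "T \<subseteq> \<Union>\<U>"
  proof
    fix x assume x: "x \<in> T"
    define V where "V = (T \<inter> \<Inter>{U \<in> \<S>. x \<in> U}) - \<Union>{U \<in> \<S>. x \<notin> U}"
    have "V = (\<Inter>(insert T {U \<in> \<S>. x \<in> U})) - \<Union>{U \<in> \<S>. x \<notin> U}" by (auto simp: V_def)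
    moreover have "openin X (\<Inter>(insert T {U \<in> \<S>. x \<in> U}))" "closedin X (\<Inter>(insert T {U \<in> \<S>. x \<in> U}))"
      by (rule openin_Inter; use fin cl in auto) (rule closedin_Inter; use cl in auto)
    moreover have "openin X (\<Union>{U \<in> \<S>. x \<notin> U})" "closedin X (\<Union>{U \<in> \<S>. x \<notin> U})"
      using fin cl by (auto intro!: openin_Union closedin_Union)
    ultimately have "clopenin X V" by (auto intro!: openin_diff closedin_diff)
    moreover have "V \<subseteq> U \<or> V \<inter> U = {}" if "U \<in> \<S>" for U
      using that by (cases "x \<in> U") (auto simp: V_def)
    ultimately have "V \<in> \<U>" by (simp add: \<U>_def)
    moreover have "x \<in> V" using x by (auto simp: V_def)
    ultimately show "x \<in> \<Union>\<U>" by blast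
  qed
  moreover have "\<Union>\<U> \<subseteq> T" using openin_subset by (auto simp: \<U>_def)
  ultimately have "\<Union>\<U> = T" by blast
  then obtain A :: "nat lr_structure" and \<phi> where A: "finite_hasse_forest A" "epimorphism F A \<phi>"
    and f: "\<And>a. a \<in> topspace (space_of A) \<Longrightarrow> \<exists>U \<in> \<U>. {x \<in> T. \<phi> x = a} \<subseteq> U"
    using refining[of \<U>] by (auto simp: \<U>_def)
  have "adapted \<S> \<phi>"
    unfolding adapted_def
  proof (intro ballI impI)
    fix U x y assume U: "U \<in> \<S>" and xy: "x \<in> T" "y \<in> T" "\<phi> x = \<phi> y"
    have "\<phi> x \<in> topspace (space_of A)" using A(2) xy(1) by (auto simp: epimorphism_def)
    then obtain V where V: "V \<in> \<U>" "{z \<in> T. \<phi> z = \<phi> x} \<subseteq> V" using f by blast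
    then have "x \<in> V" "y \<in> V" using xy by auto
    moreover have "V \<subseteq> U \<or> V \<inter> U = {}" using V(1) U by (simp add: \<U>_def)
    ultimately show "x \<in> U \<longleftrightarrow> y \<in> U" by blast
  qed
  then show thesis using A that by blast
qed

text \<open>\<open>\<phi>'\<close> is adapted because each of its fibres lies in a fibre of
  \<open>\<phi>\<close>. Both maps are kept: relations are read off in \<open>B\<close>, while the
  conditions on a covering compare images in \<open>A\<close>.\<close>

lemma approximation:
  assumes "clopens \<S>"
  obtains A B :: "nat lr_structure" and \<phi> \<phi>' ch rk \<pi> where
    "finite_hasse_forest A" "epimorphism F A \<phi>" "adapted \<S> \<phi>" "chain_covering A B ch rk \<pi>"
    "chain_forest B ch rk" "epimorphism F B \<phi>'" "adapted \<S> \<phi>'" "\<And>x. x \<in> T \<Longrightarrow> \<phi> x = \<pi> (\<phi>' x)"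
proof -
  obtain A :: "nat lr_structure" and \<phi> where A: "finite_hasse_forest A" "epimorphism F A \<phi>" "adapted \<S> \<phi>"
    using ex_adapted[OF assms] by blast
  obtain B :: "nat lr_structure" and ch rk \<pi> where c: "chain_covering A B ch rk \<pi>"
    by (rule chain_cover[OF A(1)])
  then have B: "chain_forest B ch rk" "epimorphism B A \<pi>" by (simp_all add: chain_covering_def)
  obtain \<phi>' where \<phi>': "epimorphism F B \<phi>'" "\<And>x. x \<in> T \<Longrightarrow> \<phi> x = \<pi> (\<phi>' x)"
    using lift[OF A(1,2) finite_hasse_forest_if_chain_forest[OF B(1)] B(2)] by blast
  have "adapted \<S> \<phi>'" using A(3) \<phi>'(2) unfolding adapted_def by metis
  then show thesis by (rule that[OF A c B(1) \<phi>'(1) _ \<phi>'(2)])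
qed

lemma epi_le:
  fixes B :: "nat lr_structure"
  assumes "epimorphism F B \<phi>"
  shows "(x, y) \<in> le_of F \<Longrightarrow> (\<phi> x, \<phi> y) \<in> le_of B" "(x, y) \<in> rel_of F \<Longrightarrow> (\<phi> x, \<phi> y) \<in> rel_of B"
    "(a, b) \<in> le_of B \<Longrightarrow> \<exists>u v. (u, v) \<in> le_of F \<and> \<phi> u = a \<and> \<phi> v = b"
    "(a, b) \<in> rel_of B \<Longrightarrow> \<exists>u v. (u, v) \<in> rel_of F \<and> \<phi> u = a \<and> \<phi> v = b"
    "x \<in> T \<Longrightarrow> \<phi> x \<in> topspace (space_of B)"
  using assms by (force simp: epimorphism_def)+

lemma clopen_base:
  assumes "openin X W" "x \<in> W"
  obtains V where "clopenin X V" "x \<in> V" "V \<subseteq> W"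
proof -
  have "\<exists>V. openin X V \<and> closedin X V \<and> x \<in> V \<and> V \<subseteq> W"
    using limit_structure(1)[unfolded zero_dimensional_space_def, rule_format, of W x] assms by simp
  then show thesis using that by blast
qed

lemma separate_closed:
  assumes Q: "closedin (prod_topology X X) Q" and xy: "x \<in> T" "y \<in> T" "(x, y) \<notin> Q"
  obtains U V where "clopenin X U" "clopenin X V" "x \<in> U" "y \<in> V" "U \<times> V \<inter> Q = {}"
proof -
  have "openin (prod_topology X X) (T \<times> T - Q)" using Q by (metis closedin_def topspace_prod_topology)
  then obtain U V where UV: "openin X U" "openin X V" "x \<in> U" "y \<in> V" "U \<times> V \<subseteq> T \<times> T - Q"
    using xy unfolding openin_prod_topology_alt by (metis DiffI SigmaI)
  obtain U' where U': "clopenin X U'" "x \<in> U'" "U' \<subseteq> U" by (rule clopen_base[OF UV(1,3)])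
  obtain V' where V': "clopenin X V'" "y \<in> V'" "V' \<subseteq> V" by (rule clopen_base[OF UV(2,4)])
  have "U' \<times> V' \<inter> Q = {}" using UV(5) U'(3) V'(3) by blast
  then show thesis using that U' V' by blast
qed

text \<open>A product of clopen sets around the excluded pair misses \<open>Q\<close>; adaptedness
  to the two factors makes the product of the fibres of \<open>x\<close> and \<open>y\<close> miss
  \<open>Q\<close> too.\<close>

lemma detect:
  assumes Q: "closedin (prod_topology X X) Q" and xy: "x \<in> T" "y \<in> T" "(x, y) \<notin> Q"
  obtains \<S> where "clopens \<S>"
    "\<And>\<phi> u v. adapted \<S> \<phi> \<Longrightarrow> (u, v) \<in> Q \<Longrightarrow> \<phi> u = \<phi> x \<Longrightarrow> \<phi> v \<noteq> \<phi> y"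
proof -
  obtain U V where UV: "clopenin X U" "clopenin X V" "x \<in> U" "y \<in> V" "U \<times> V \<inter> Q = {}"
    by (rule separate_closed[OF Q xy])
  have "\<phi> v \<noteq> \<phi> y" if ad: "adapted {U, V} \<phi>" and uv: "(u, v) \<in> Q" "\<phi> u = \<phi> x" for \<phi> u v
  proof
    assume v: "\<phi> v = \<phi> y"
    have T: "u \<in> T" "v \<in> T" using closedin_subset[OF Q] uv(1) by auto
    have "u \<in> U" "v \<in> V"
      using adaptedD[OF ad _ T(1) xy(1) uv(2), of U] adaptedD[OF ad _ T(2) xy(2) v, of V] UV(3,4) by auto
    then show False using UV(5) uv(1) by blast
  qed
  moreover have "clopens {U, V}" using UV by (simp add: clopens_def)
  ultimately show thesis using that by blast
qed

text \<open>This is how properties pass from the finite quotients to the limit: a pair outside the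
  closed \<open>Q\<close> would be detected by a sufficiently fine epimorphism.\<close>

lemma limit_pair:
  assumes Q: "closedin (prod_topology X X) Q" and xy: "x \<in> T" "y \<in> T"
    and A: "\<And>(A :: nat lr_structure) \<phi>. finite_hasse_forest A \<Longrightarrow> epimorphism F A \<phi> \<Longrightarrow>
      \<exists>u v. (u, v) \<in> Q \<and> \<phi> u = \<phi> x \<and> \<phi> v = \<phi> y"
  shows "(x, y) \<in> Q"
proof (rule ccontr)
  assume "(x, y) \<notin> Q"
  then obtain \<S> where S: "clopens \<S>"
    "\<And>\<phi> u v. adapted \<S> \<phi> \<Longrightarrow> (u, v) \<in> Q \<Longrightarrow> \<phi> u = \<phi> x \<Longrightarrow> \<phi> v \<noteq> \<phi> y"
    using detect[OF Q xy] by metis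
  obtain A :: "nat lr_structure" and \<phi> where "finite_hasse_forest A" "epimorphism F A \<phi>" and ad: "adapted \<S> \<phi>"
    by (rule ex_adapted[OF S(1)])
  then obtain u v where "(u, v) \<in> Q" "\<phi> u = \<phi> x" "\<phi> v = \<phi> y" using A by metis
  then show False using S(2)[OF ad] by blast
qed

lemma detect_neq:
  assumes "x \<in> T" "y \<in> T" "x \<noteq> y"
  obtains \<S> where "clopens \<S>" "\<And>\<phi>. adapted \<S> \<phi> \<Longrightarrow> \<phi> x \<noteq> \<phi> y"
proof -
  have "openin X (T - {y})" using limit_structure(4) assms(2) by (simp add: closedin_Hausdorff_sing_eq openin_diff)
  moreover have "x \<in> T - {y}" using assms by simp
  ultimately obtain U where U: "clopenin X U" "x \<in> U" "U \<subseteq> T - {y}" by (rule clopen_base)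
  have "\<phi> x \<noteq> \<phi> y" if "adapted {U} \<phi>" for \<phi>
    using that U assms unfolding adapted_def by blast
  moreover have "clopens {U}" using U by (simp add: clopens_def)
  ultimately show thesis using that by blast
qed

section \<open>Order, comparability and \<open>R\<close> on the limit\<close>

lemma forest_order:
  assumes "finite_hasse_forest A"
  shows "a \<in> topspace (space_of A) \<Longrightarrow> (a, a) \<in> le_of A"
    "(a, b) \<in> le_of A \<Longrightarrow> (b, a) \<in> le_of A \<Longrightarrow> a = b"
    "(a, b) \<in> le_of A \<Longrightarrow> (b, c) \<in> le_of A \<Longrightarrow> (a, c) \<in> le_of A"
    "a \<in> topspace (space_of A) \<Longrightarrow> (a, a) \<in> rel_of A"
    "(a, b) \<in> rel_of A \<Longrightarrow> (b, a) \<in> rel_of A"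
  using assms unfolding finite_hasse_forest_def
  by (auto simp: partial_order_on_def preorder_on_def refl_on_def antisym_def hasse_edge_def elim: transE)

lemma le_refl: "(x, x) \<in> le_of F" if x: "x \<in> T"
proof (rule limit_pair[OF limit_structure(6) x x])
  fix A :: "nat lr_structure" and \<phi> assume A: "finite_hasse_forest A" "epimorphism F A \<phi>"
  show "\<exists>u v. (u, v) \<in> le_of F \<and> \<phi> u = \<phi> x \<and> \<phi> v = \<phi> x"
    by (rule epi_le(3)[OF A(2) forest_order(1)[OF A(1) epi_le(5)[OF A(2) x]]])
qed

lemma rel_refl: "(x, x) \<in> rel_of F" if x: "x \<in> T"
proof (rule limit_pair[OF limit_structure(5) x x])
  fix A :: "nat lr_structure" and \<phi> assume A: "finite_hasse_forest A" "epimorphism F A \<phi>"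
  show "\<exists>u v. (u, v) \<in> rel_of F \<and> \<phi> u = \<phi> x \<and> \<phi> v = \<phi> x"
    by (rule epi_le(4)[OF A(2) forest_order(4)[OF A(1) epi_le(5)[OF A(2) x]]])
qed

lemma rel_sym: "(y, x) \<in> rel_of F" if xy: "(x, y) \<in> rel_of F"
proof (rule limit_pair[OF limit_structure(5) rel_topspace(2,1)[OF xy]])
  fix A :: "nat lr_structure" and \<phi> assume A: "finite_hasse_forest A" "epimorphism F A \<phi>"
  show "\<exists>u v. (u, v) \<in> rel_of F \<and> \<phi> u = \<phi> y \<and> \<phi> v = \<phi> x"
    by (rule epi_le(4)[OF A(2) forest_order(5)[OF A(1) epi_le(2)[OF A(2) xy]]])
qed

lemma le_antisym: "x = y" if xy: "(x, y) \<in> le_of F" "(y, x) \<in> le_of F"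
proof (rule ccontr)
  assume "x \<noteq> y"
  then obtain \<S> where S: "clopens \<S>" "\<And>\<phi>. adapted \<S> \<phi> \<Longrightarrow> \<phi> x \<noteq> \<phi> y"
    using detect_neq[OF rel_topspace(3,4)[OF xy(1)]] by metis
  obtain A :: "nat lr_structure" and \<phi> where A: "finite_hasse_forest A" "epimorphism F A \<phi>" "adapted \<S> \<phi>"
    by (rule ex_adapted[OF S(1)])
  show False using S(2)[OF A(3)] forest_order(2)[OF A(1) epi_le(1)[OF A(2) xy(1)] epi_le(1)[OF A(2) xy(2)]] by blast
qed

lemma le_trans: "(x, z) \<in> le_of F" if xy: "(x, y) \<in> le_of F" and yz: "(y, z) \<in> le_of F"
proof (rule limit_pair[OF limit_structure(6) rel_topspace(3)[OF xy] rel_topspace(4)[OF yz]])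
  fix A :: "nat lr_structure" and \<phi> assume A: "finite_hasse_forest A" "epimorphism F A \<phi>"
  show "\<exists>u v. (u, v) \<in> le_of F \<and> \<phi> u = \<phi> x \<and> \<phi> v = \<phi> z"
    by (rule epi_le(3)[OF A(2) forest_order(3)[OF A(1) epi_le(1)[OF A(2) xy] epi_le(1)[OF A(2) yz]]])
qed

lemma chain_forest_iff:
  assumes "chain_forest B ch rk"
  shows "(p, q) \<in> le_of B \<longleftrightarrow> p \<in> topspace (space_of B) \<and> q \<in> topspace (space_of B) \<and> ch p = ch q \<and> rk p \<le> rk q"
    "(p, q) \<in> rel_of B \<longleftrightarrow> p \<in> topspace (space_of B) \<and> q \<in> topspace (space_of B) \<and> ch p = ch q \<and>
       rk p \<le> Suc (rk q) \<and> rk q \<le> Suc (rk p)"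
    "p \<in> topspace (space_of B) \<Longrightarrow> q \<in> topspace (space_of B) \<Longrightarrow> ch p = ch q \<Longrightarrow> rk p = rk q \<Longrightarrow> p = q"
    "p \<in> topspace (space_of B) \<Longrightarrow> k < rk p \<Longrightarrow> \<exists>q\<in>topspace (space_of B). ch q = ch p \<and> rk q = k"
    "openin (space_of B) S \<longleftrightarrow> S \<subseteq> topspace (space_of B)"
  using assms unfolding chain_forest_def by auto

definition comparable :: "'a \<Rightarrow> 'a \<Rightarrow> bool" where
  "comparable x y \<longleftrightarrow> (x, y) \<in> le_of F \<or> (y, x) \<in> le_of F"

text \<open>In a chain forest, points are comparable exactly when they share a chain. A quotient
  fine enough to detect that both closed conditions fail must therefore send the points to different
  chains.\<close>

lemma detect_incomparable:
  assumes xy: "x \<in> T" "y \<in> T" "\<not> comparable x y"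
  obtains \<S> where "clopens \<S>"
    "\<And>(B :: nat lr_structure) ch rk \<phi>. chain_forest B ch rk \<Longrightarrow> epimorphism F B \<phi> \<Longrightarrow> adapted \<S> \<phi> \<Longrightarrow> ch (\<phi> x) \<noteq> ch (\<phi> y)"
proof -
  have n: "(x, y) \<notin> le_of F" "(y, x) \<notin> le_of F" using xy by (auto simp: comparable_def)
  obtain \<S> where S: "clopens \<S>"
    "\<And>\<phi> u v. adapted \<S> \<phi> \<Longrightarrow> (u, v) \<in> le_of F \<Longrightarrow> \<phi> u = \<phi> x \<Longrightarrow> \<phi> v \<noteq> \<phi> y"
    using detect[OF limit_structure(6) xy(1,2) n(1)] by metis
  obtain \<S>' where S': "clopens \<S>'"
    "\<And>\<phi> u v. adapted \<S>' \<phi> \<Longrightarrow> (u, v) \<in> le_of F \<Longrightarrow> \<phi> u = \<phi> y \<Longrightarrow> \<phi> v \<noteq> \<phi> x"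
    using detect[OF limit_structure(6) xy(2,1) n(2)] by metis
  have "ch (\<phi> x) \<noteq> ch (\<phi> y)"
    if "chain_forest B ch rk" "epimorphism F B \<phi>" "adapted (\<S> \<union> \<S>') \<phi>" for B :: "nat lr_structure" and ch rk \<phi>
  proof -
    have "adapted \<S> \<phi>" "adapted \<S>' \<phi>" using that(3) by (auto simp: adapted_Un)
    then have "(\<phi> x, \<phi> y) \<notin> le_of B" "(\<phi> y, \<phi> x) \<notin> le_of B"
      using S(2) S'(2) epi_le(3)[OF that(2)] by metis+
    then show ?thesis using epi_le(5)[OF that(2)] xy(1,2) by (auto simp: chain_forest_iff(1)[OF that(1)])
  qed
  moreover have "clopens (\<S> \<union> \<S>')" using S(1) S'(1) by (simp add: clopens_Un)
  ultimately show thesis using that by blast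
qed

lemma comparable_chain:
  fixes B :: "nat lr_structure"
  assumes "chain_forest B ch rk" "epimorphism F B \<phi>" "comparable x y"
  shows "ch (\<phi> x) = ch (\<phi> y)"
  using assms(3) epi_le(1)[OF assms(2), of x y] epi_le(1)[OF assms(2), of y x] chain_forest_iff(1)[OF assms(1)]
  by (auto simp: comparable_def)

lemma comparable_T: "comparable x y \<Longrightarrow> x \<in> T" "comparable x y \<Longrightarrow> y \<in> T"
  using rel_topspace by (auto simp: comparable_def)

text \<open>Equality of chain labels is transitive; were \<open>x\<close> and \<open>z\<close>
  incomparable, a fine chain quotient would give them different labels.\<close>

lemma comparable_trans: "comparable x z" if xy: "comparable x y" "comparable y z"
proof (rule ccontr)
  assume n: "\<not> comparable x z"
  obtain \<S> where S: "clopens \<S>" "\<And>(B :: nat lr_structure) ch rk \<phi>. chain_forest B ch rk \<Longrightarrow> epimorphism F B \<phi> \<Longrightarrow>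
      adapted \<S> \<phi> \<Longrightarrow> ch (\<phi> x) \<noteq> ch (\<phi> z)"
    using detect_incomparable[OF comparable_T(1)[OF xy(1)] comparable_T(2)[OF xy(2)] n] by metis
  show False
  proof (rule approximation[OF S(1)])
    fix A B :: "nat lr_structure" and \<phi> \<phi>' ch rk \<pi>
    assume B: "chain_forest B ch rk" "epimorphism F B \<phi>'" "adapted \<S> \<phi>'"
    show False using S(2)[OF B] comparable_chain[OF B(1,2) xy(1)] comparable_chain[OF B(1,2) xy(2)] by simp
  qed
qed

lemma rel_comparable: "comparable x y" if xy: "(x, y) \<in> rel_of F"
proof (rule ccontr)
  assume n: "\<not> comparable x y"
  obtain \<S> where S: "clopens \<S>" "\<And>(B :: nat lr_structure) ch rk \<phi>. chain_forest B ch rk \<Longrightarrow> epimorphism F B \<phi> \<Longrightarrow>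
      adapted \<S> \<phi> \<Longrightarrow> ch (\<phi> x) \<noteq> ch (\<phi> y)"
    using detect_incomparable[OF rel_topspace(1,2)[OF xy] n] by metis
  show False
  proof (rule approximation[OF S(1)])
    fix A B :: "nat lr_structure" and \<phi> \<phi>' ch rk \<pi>
    assume B: "chain_forest B ch rk" "epimorphism F B \<phi>'" "adapted \<S> \<phi>'"
    show False using S(2)[OF B] epi_le(2)[OF B(2) xy] by (simp add: chain_forest_iff(2)[OF B(1)])
  qed
qed

text \<open>For three distinct points an adapted \<open>\<phi>\<close> would have distinct images in
  \<open>A\<close>, against the clause of \<open>chain_covering\<close> on two consecutive
  moves.\<close>

lemma rel_two_points: "x = y \<or> y = z \<or> x = z" if xy: "(x, y) \<in> rel_of F" and yz: "(y, z) \<in> rel_of F"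
proof (rule ccontr)
  assume n: "\<not> (x = y \<or> y = z \<or> x = z)"
  have xT: "x \<in> T" "y \<in> T" "z \<in> T" using rel_topspace xy yz by auto
  obtain \<S>1 where S1: "clopens \<S>1" "\<And>\<phi>. adapted \<S>1 \<phi> \<Longrightarrow> \<phi> x \<noteq> \<phi> y" using detect_neq[OF xT(1,2)] n by metis
  obtain \<S>2 where S2: "clopens \<S>2" "\<And>\<phi>. adapted \<S>2 \<phi> \<Longrightarrow> \<phi> y \<noteq> \<phi> z" using detect_neq[OF xT(2,3)] n by metis
  obtain \<S>3 where S3: "clopens \<S>3" "\<And>\<phi>. adapted \<S>3 \<phi> \<Longrightarrow> \<phi> x \<noteq> \<phi> z" using detect_neq[OF xT(1,3)] n by metis
  have "clopens (\<S>1 \<union> \<S>2 \<union> \<S>3)" using S1 S2 S3 by (simp add: clopens_Un)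
  then show False
  proof (rule approximation)
    fix A B :: "nat lr_structure" and \<phi> \<phi>' ch rk \<pi>
    assume r: "adapted (\<S>1 \<union> \<S>2 \<union> \<S>3) \<phi>" and B: "epimorphism F B \<phi>'"
      and \<pi>: "\<And>x. x \<in> T \<Longrightarrow> \<phi> x = \<pi> (\<phi>' x)"
      and c: "chain_covering A B ch rk \<pi>"
    have st: "p = s \<or> \<pi> p = \<pi> q \<or> \<pi> q = \<pi> s" if "(p, q) \<in> rel_of B" "(q, s) \<in> rel_of B" for p q s
      using c that unfolding chain_covering_def by blast
    have "\<phi> x \<noteq> \<phi> y" "\<phi> y \<noteq> \<phi> z" "\<phi> x \<noteq> \<phi> z" using r S1(2) S2(2) S3(2) by (auto simp: adapted_Un)
    then show False using st[OF epi_le(2)[OF B xy] epi_le(2)[OF B yz]] \<pi> xT by metis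
  qed
qed

lemma rel_trans: "(x, z) \<in> rel_of F" if "(x, y) \<in> rel_of F" "(y, z) \<in> rel_of F"
  using rel_two_points[OF that] that rel_refl rel_topspace by metis

text \<open>Ranks of related points differ by at most 1 in every chain quotient and leave no rank
  strictly between them, so no quotient tells \<open>w\<close> apart from both.\<close>

lemma rel_convex: "w = x \<or> w = y" if xy: "(x, y) \<in> rel_of F" and w: "(x, w) \<in> le_of F" "(w, y) \<in> le_of F"
proof (rule ccontr)
  assume n: "\<not> (w = x \<or> w = y)"
  have xT: "x \<in> T" "y \<in> T" "w \<in> T" using rel_topspace xy w by auto
  obtain \<S>1 where S1: "clopens \<S>1" "\<And>\<phi>. adapted \<S>1 \<phi> \<Longrightarrow> \<phi> w \<noteq> \<phi> x" using detect_neq[OF xT(3,1)] n by metis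
  obtain \<S>2 where S2: "clopens \<S>2" "\<And>\<phi>. adapted \<S>2 \<phi> \<Longrightarrow> \<phi> w \<noteq> \<phi> y" using detect_neq[OF xT(3,2)] n by metis
  have "clopens (\<S>1 \<union> \<S>2)" using S1 S2 by (simp add: clopens_Un)
  then show False
  proof (rule approximation)
    fix A B :: "nat lr_structure" and \<phi> \<phi>' ch rk \<pi>
    assume B: "chain_forest B ch rk" "epimorphism F B \<phi>'" and r: "adapted (\<S>1 \<union> \<S>2) \<phi>'"
    have n: "\<phi>' w \<noteq> \<phi>' x" "\<phi>' w \<noteq> \<phi>' y" using r S1(2) S2(2) by (auto simp: adapted_Un)
    have a: "rk (\<phi>' x) \<le> rk (\<phi>' w)" "rk (\<phi>' w) \<le> rk (\<phi>' y)" "ch (\<phi>' w) = ch (\<phi>' x)" "ch (\<phi>' w) = ch (\<phi>' y)"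
      "rk (\<phi>' y) \<le> Suc (rk (\<phi>' x))"
      using epi_le(1)[OF B(2) w(1)] epi_le(1)[OF B(2) w(2)] epi_le(2)[OF B(2) xy]
      by (simp_all add: chain_forest_iff(1,2)[OF B(1)])
    have t: "\<phi>' x \<in> topspace (space_of B)" "\<phi>' y \<in> topspace (space_of B)" "\<phi>' w \<in> topspace (space_of B)"
      using epi_le(5)[OF B(2)] xT by auto
    have "rk (\<phi>' w) = rk (\<phi>' x) \<or> rk (\<phi>' w) = rk (\<phi>' y)" using a by linarith
    then show False using chain_forest_iff(3)[OF B(1) t(3,1) a(3)] chain_forest_iff(3)[OF B(1) t(3,2) a(4)] n by blast
  qed
qed

section \<open>Clopen unions of \<open>R\<close>-classes and the height on the limit\<close>

definition saturated :: "'a set \<Rightarrow> bool" where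
  "saturated P \<longleftrightarrow> clopenin X P \<and> (\<forall>u v. (u, v) \<in> rel_of F \<longrightarrow> u \<in> P \<longrightarrow> v \<in> P)"

text \<open>The preimage of a whole chain is closed under \<open>R\<close>, because related points
  are comparable and share the chain label.\<close>

lemma incomparable_saturated:
  assumes "x \<in> T" "y \<in> T" "\<not> comparable x y"
  obtains P where "saturated P" "x \<in> P" "y \<notin> P"
proof -
  obtain \<S> where S: "clopens \<S>" "\<And>(B :: nat lr_structure) ch rk \<phi>. chain_forest B ch rk \<Longrightarrow> epimorphism F B \<phi> \<Longrightarrow>
      adapted \<S> \<phi> \<Longrightarrow> ch (\<phi> x) \<noteq> ch (\<phi> y)"
    using detect_incomparable[OF assms] by metis
  show thesis
  proof (rule approximation[OF S(1)])
    fix A B :: "nat lr_structure" and \<phi> \<phi>' ch rk \<pi>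
    assume B: "chain_forest B ch rk" "epimorphism F B \<phi>'" "adapted \<S> \<phi>'"
    define P where "P = {u \<in> T. \<phi>' u \<in> {b \<in> topspace (space_of B). ch b = ch (\<phi>' x)}}"
    have cm: "continuous_map X (space_of B) \<phi>'" using B(2) by (simp add: epimorphism_def)
    have cl: "closedin (space_of B) S" if "S \<subseteq> topspace (space_of B)" for S
      unfolding closedin_def chain_forest_iff(5)[OF B(1)] using that by blast
    have "openin X P" unfolding P_def
      by (rule openin_continuous_map_preimage[OF cm]) (auto simp: chain_forest_iff(5)[OF B(1)])
    moreover have "closedin X P" unfolding P_def
      by (rule closedin_continuous_map_preimage[OF cm]) (rule cl, blast)
    moreover have "v \<in> P" if uv: "(u, v) \<in> rel_of F" and u: "u \<in> P" for u v
      using comparable_chain[OF B(1,2) rel_comparable[OF uv]] u rel_topspace(2)[OF uv] epi_le(5)[OF B(2)]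
      by (auto simp: P_def)
    ultimately have "saturated P" by (auto simp: saturated_def)
    moreover have "x \<in> P" using assms(1) epi_le(5)[OF B(2)] by (auto simp: P_def)
    moreover have "y \<notin> P" using S(2)[OF B] by (auto simp: P_def)
    ultimately show thesis by (rule that)
  qed
qed

text \<open>The chain is climbed one rank at a time: consecutive points of \<open>B\<close> are the
  images of some related \<open>u'\<close> and \<open>w\<close> in \<open>F\<close>. As
  \<open>P\<close> is a union of fibres and closed under \<open>R\<close>, membership passes from
  \<open>u\<close> to \<open>u'\<close>, to \<open>w\<close> and on to the next rank.\<close>

lemma saturated_step:
  fixes B :: "nat lr_structure"
  assumes P: "saturated P" and B: "chain_forest B ch rk" "epimorphism F B \<phi>" "adapted {P} \<phi>"
    and uv: "u \<in> T" "v \<in> T" "ch (\<phi> u) = ch (\<phi> v)" "rk (\<phi> v) = rk (\<phi> u) + d"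
  shows "u \<in> P \<longleftrightarrow> v \<in> P"
  using uv
proof (induction d arbitrary: u)
  case 0
  then have "\<phi> u = \<phi> v" using chain_forest_iff(3)[OF B(1)] epi_le(5)[OF B(2)] by simp
  then show ?case using adaptedD[OF B(3) singletonI 0(1,2)] by simp
next
  case (Suc d)
  have t: "\<phi> u \<in> topspace (space_of B)" "\<phi> v \<in> topspace (space_of B)" using epi_le(5)[OF B(2)] Suc.prems by auto
  have "\<exists>b\<in>topspace (space_of B). ch b = ch (\<phi> v) \<and> rk b = Suc (rk (\<phi> u))"
  proof (cases "d = 0")
    case True then show ?thesis using t(2) Suc.prems by auto
  next
    case False then show ?thesis using chain_forest_iff(4)[OF B(1) t(2)] Suc.prems by auto
  qed
  then obtain b where b: "b \<in> topspace (space_of B)" "ch b = ch (\<phi> v)" "rk b = Suc (rk (\<phi> u))" by blast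
  then have "(\<phi> u, b) \<in> rel_of B" using t Suc.prems by (simp add: chain_forest_iff(2)[OF B(1)])
  then obtain u' w where w: "(u', w) \<in> rel_of F" "\<phi> u' = \<phi> u" "\<phi> w = b" using epi_le(4)[OF B(2)] by blast
  have "u \<in> P \<longleftrightarrow> u' \<in> P" using adaptedD[OF B(3) singletonI Suc.prems(1) rel_topspace(1)[OF w(1)]] w(2) by simp
  also have "\<dots> \<longleftrightarrow> w \<in> P" using P w(1) rel_sym unfolding saturated_def by blast
  also have "\<dots> \<longleftrightarrow> v \<in> P"
    by (rule Suc.IH) (use w b Suc.prems rel_topspace(2)[OF w(1)] in auto)
  finally show ?case .
qed

text \<open>In the quotient this keeps comparable points in one component, see
  \<open>same_component_iff\<close>.\<close>

lemma saturated_comparable: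
  assumes P: "saturated P" and xy: "comparable x y"
  shows "x \<in> P \<longleftrightarrow> y \<in> P"
proof -
  have T: "x \<in> T" "y \<in> T" using comparable_T xy by auto
  have "clopens {P}" using P by (simp add: clopens_def saturated_def)
  then show ?thesis
  proof (rule approximation)
    fix A B :: "nat lr_structure" and \<phi> \<phi>' ch rk \<pi>
    assume B: "chain_forest B ch rk" "epimorphism F B \<phi>'" "adapted {P} \<phi>'"
    have c: "ch (\<phi>' x) = ch (\<phi>' y)" by (rule comparable_chain[OF B(1,2) xy])
    show ?thesis
    proof (cases "rk (\<phi>' x) \<le> rk (\<phi>' y)")
      case True
      then show ?thesis using saturated_step[OF P B T c, of "rk (\<phi>' y) - rk (\<phi>' x)"] by simp
    next
      case False
      then show ?thesis using saturated_step[OF P B T(2,1) c[symmetric], of "rk (\<phi>' x) - rk (\<phi>' y)"] by simp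
    qed
  qed
qed

text \<open>A closed preorder with symmetric part \<open>R\<close>: a strictly monotone function for
  it is constant on \<open>R\<close>-classes and increases strictly along all other comparable
  pairs, so it descends to the quotient and separates the points of a component.\<close>

definition weak_le :: "('a \<times> 'a) set" where "weak_le = le_of F \<union> rel_of F"

lemma weak_le_trans: "(x, z) \<in> weak_le" if xy: "(x, y) \<in> weak_le" and yz: "(y, z) \<in> weak_le"
proof -
  consider "(x, y) \<in> le_of F" "(y, z) \<in> le_of F" | "(x, y) \<in> rel_of F" "(y, z) \<in> rel_of F"
    | "(x, y) \<in> le_of F" "(y, z) \<in> rel_of F" | "(x, y) \<in> rel_of F" "(y, z) \<in> le_of F"
    using xy yz by (auto simp: weak_le_def)
  then show ?thesis
  proof cases
    case 1 then show ?thesis using le_trans by (auto simp: weak_le_def)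
  next
    case 2 then show ?thesis using rel_trans by (auto simp: weak_le_def)
  next
    \<comment> \<open>By comparability either \<open>x\<close> is below \<open>z\<close>, as wanted,
      or \<open>x\<close> lies between the related points \<open>z\<close> and \<open>y\<close> and
      equals one of them by \<open>rel_convex\<close>. The next case is dual.\<close>
    case 3
    have "comparable x z"
      using comparable_trans[of x y z] rel_comparable[OF 3(2)] 3(1) by (auto simp: comparable_def)
    then show ?thesis
      using rel_convex[OF rel_sym[OF 3(2)], of x] 3 rel_refl[OF rel_topspace(3)[OF 3(1)]] rel_sym[OF 3(2)]
      by (auto simp: comparable_def weak_le_def)
  next
    case 4
    have "comparable x z"
      using comparable_trans[of x y z] rel_comparable[OF 4(1)] 4(2) by (auto simp: comparable_def)
    then show ?thesis
      using rel_convex[OF rel_sym[OF 4(1)], of z] 4 rel_refl[OF rel_topspace(4)[OF 4(2)]]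
      by (auto simp: comparable_def weak_le_def)
  qed
qed

lemma ex_height:
  obtains t where "continuous_map X euclideanreal t" "\<And>u v. (u, v) \<in> rel_of F \<Longrightarrow> t u = t v"
    "\<And>u v. (u, v) \<in> le_of F \<Longrightarrow> t u \<le> t v"
    "\<And>u v. (u, v) \<in> le_of F \<Longrightarrow> (u, v) \<notin> rel_of F \<Longrightarrow> t u < (t v :: real)"
proof -
  interpret compact_preorder X weak_le
  proof
    show "closedin (prod_topology X X) weak_le" using limit_structure by (simp add: weak_le_def closedin_Un)
    show "(x, x) \<in> weak_le" if "x \<in> T" for x using le_refl[OF that] by (simp add: weak_le_def)
  qed (use limit_structure weak_le_trans in auto)
  obtain t where t: "continuous_map X euclideanreal t" "\<And>u v. (u, v) \<in> weak_le \<Longrightarrow> t u \<le> t v"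
    "\<And>u v. (u, v) \<in> weak_le \<Longrightarrow> (v, u) \<notin> weak_le \<Longrightarrow> t u < (t v :: real)"
    using strict_monotone_fun compact_metrizable_subcover[OF limit_structure(2,3)] by metis
  show thesis
  proof (rule that[OF t(1)])
    show "t u = t v" if "(u, v) \<in> rel_of F" for u v
      using t(2)[of u v] t(2)[of v u] rel_sym[OF that] that by (auto simp: weak_le_def)
    show "t u \<le> t v" if "(u, v) \<in> le_of F" for u v using t(2) that by (simp add: weak_le_def)
    show "t u < t v" if uv: "(u, v) \<in> le_of F" "(u, v) \<notin> rel_of F" for u v
    proof (rule t(3))
      show "(u, v) \<in> weak_le" using uv by (simp add: weak_le_def)
      have "u \<noteq> v" using uv(2) rel_refl[OF rel_topspace(3)[OF uv(1)]] by auto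
      then show "(v, u) \<notin> weak_le" using uv le_antisym rel_sym by (auto simp: weak_le_def)
    qed
  qed
qed

section \<open>The quotient space\<close>

abbreviation Z :: "'a set topology" where "Z \<equiv> fraisse_fence F"
abbreviation q :: "'a \<Rightarrow> 'a set" where "q x \<equiv> rel_of F `` {x}"

lemma q_eq: "q x = q y \<longleftrightarrow> (x, y) \<in> rel_of F" if "x \<in> T" "y \<in> T"
  using rel_refl[OF that(1)] rel_refl[OF that(2)] rel_sym rel_trans by blast

lemma Z_topspace: "topspace Z = q ` T"
  by (auto simp: fraisse_fence_def topspace_quotient_space quotient_def)

lemma Z_open: "openin Z U \<longleftrightarrow> U \<subseteq> q ` T \<and> openin X {x \<in> T. q x \<in> U}"
  by (auto simp: fraisse_fence_def openin_quotient_space quotient_def)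

lemma q_quotient: "quotient_map X Z q"
  unfolding fraisse_fence_def by (rule quotient_map_quotient_space)

lemma q_continuous: "continuous_map X Z q"
  by (rule quotient_imp_continuous_map[OF q_quotient])

lemma Z_compact: "compact_space Z"
  using image_compactin[OF _ q_continuous, of T] limit_structure(2) by (simp add: compact_space_def Z_topspace)

lemma clopen_preimage:
  assumes "clopenin Z U" shows "saturated {x \<in> T. q x \<in> U}"
proof -
  have "v \<in> {x \<in> T. q x \<in> U}" if "(u, v) \<in> rel_of F" "u \<in> {x \<in> T. q x \<in> U}" for u v
    using that q_eq[of u v] rel_topspace[of u v] by auto
  then show ?thesis
    using assms openin_continuous_map_preimage[OF q_continuous] closedin_continuous_map_preimage[OF q_continuous]
    by (simp add: saturated_def)
qed

lemma saturated_image_mem: "q x \<in> q ` P \<longleftrightarrow> x \<in> P" if P: "saturated P" and x: "x \<in> T"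
proof
  assume "q x \<in> q ` P"
  then obtain y where y: "y \<in> P" "q x = q y" by blast
  then have "y \<in> T" using P openin_subset by (auto simp: saturated_def)
  then have "(y, x) \<in> rel_of F" using q_eq[of y x] x y(2) by simp
  then show "x \<in> P" using P y(1) unfolding saturated_def by blast
qed blast

lemma saturated_Compl:
  assumes P: "saturated P" shows "saturated (T - P)"
proof -
  have "v \<in> T - P" if uv: "(u, v) \<in> rel_of F" "u \<in> T - P" for u v
    using P rel_sym[OF uv(1)] uv(2) rel_topspace(2)[OF uv(1)] unfolding saturated_def by blast
  then show ?thesis using P by (auto simp: saturated_def)
qed

lemma saturated_image_clopen:
  assumes P: "saturated P" shows "clopenin Z (q ` P)"
proof
  have o: "openin Z (q ` R)" if R: "saturated R" for R
  proof -
    have RT: "R \<subseteq> T" using R openin_subset by (auto simp: saturated_def)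
    then have "{x \<in> T. q x \<in> q ` R} = R" using saturated_image_mem[OF R] by blast
    then show ?thesis using RT R by (auto simp: Z_open saturated_def)
  qed
  show "openin Z (q ` P)" by (rule o[OF P])
  have PT: "P \<subseteq> T" using P openin_subset by (auto simp: saturated_def)
  have "topspace Z - q ` P = q ` (T - P)"
    using saturated_image_mem[OF P] unfolding Z_topspace by blast
  then show "closedin Z (q ` P)"
    using o[OF saturated_Compl[OF P]] PT by (auto simp: closedin_def Z_topspace)
qed

lemma T_nonempty: "T \<noteq> {}"
proof -
  obtain A :: "nat lr_structure" and \<phi> where "finite_hasse_forest A" "epimorphism F A \<phi>"
    using ex_adapted[of "{}"] unfolding clopens_def by blast
  then have "topspace (space_of A) \<noteq> {}" "\<phi> ` T = topspace (space_of A)"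
    unfolding finite_hasse_forest_def epimorphism_def by blast+
  then show ?thesis by blast
qed

text \<open>The square of \<open>Z\<close> is a continuous image of the square of the limit, and
  countable subcovers are inherited by continuous images. This serves in place of a metric on
  \<open>Z\<close>.\<close>

lemma Z_subcover:
  assumes "\<forall>U\<in>\<U>. openin (prod_topology Z Z) U"
  shows "\<exists>\<V>\<subseteq>\<U>. countable \<V> \<and> \<Union>\<V> = \<Union>\<U>"
proof -
  define g where "g z = (q (fst z), q (snd z))" for z
  define P where "P U = {z \<in> topspace (prod_topology X X). g z \<in> U}" for U
  have g: "continuous_map (prod_topology X X) (prod_topology Z Z) g"
    unfolding g_def
    by (intro continuous_map_pairedI continuous_map_compose[OF continuous_map_fst q_continuous, unfolded o_def]
        continuous_map_compose[OF continuous_map_snd q_continuous, unfolded o_def])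
  have "\<forall>V\<in>P ` \<U>. openin (prod_topology X X) V"
    using assms openin_continuous_map_preimage[OF g] by (auto simp: P_def)
  then obtain \<V> where V: "\<V> \<subseteq> P ` \<U>" "countable \<V>" "\<Union>\<V> = \<Union>(P ` \<U>)"
    using compact_metrizable_subcover[OF limit_structure(2,3), of "P ` \<U>"] by blast
  obtain \<G> where G: "\<G> \<subseteq> \<U>" "countable \<G>" "\<V> = P ` \<G>"
    using V(1,2) countable_subset_image[of \<V> P \<U>] by auto
  have "\<Union>\<U> \<subseteq> \<Union>\<G>"
  proof
    fix w assume "w \<in> \<Union>\<U>"
    then obtain U where U: "U \<in> \<U>" "w \<in> U" by blast
    then have "w \<in> topspace (prod_topology Z Z)" using assms openin_subset by blast
    then obtain x y where xy: "x \<in> T" "y \<in> T" "w = (q x, q y)" by (auto simp: Z_topspace)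
    then have "(x, y) \<in> P U" using U(2) by (simp add: P_def g_def)
    then have "(x, y) \<in> \<Union>(P ` \<G>)" using V(3) G(3) U(1) by blast
    then obtain V where V: "V \<in> \<G>" "(x, y) \<in> P V" by blast
    then have "w \<in> V" using xy(3) by (simp add: P_def g_def)
    then show "w \<in> \<Union>\<G>" using V(1) by blast
  qed
  then have "\<Union>\<G> = \<Union>\<U>" using G(1) by blast
  then show ?thesis using G by blast
qed

text \<open>Clopen sets separate the components of \<open>Z\<close>, and they correspond to the
  saturated sets of the limit. Such sets separate incomparable points and never comparable
  ones.\<close>

lemma same_component_iff:
  assumes H: "Hausdorff_space Z" and xy: "x \<in> T" "y \<in> T" and C: "C \<in> connected_components_of Z" "q x \<in> C"
  shows "q y \<in> C \<longleftrightarrow> comparable x y"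
proof
  assume y: "q y \<in> C"
  show "comparable x y"
  proof (rule ccontr)
    assume "\<not> comparable x y"
    then obtain P where P: "saturated P" "x \<in> P" "y \<notin> P" using incomparable_saturated[OF xy] by blast
    have "q y \<notin> q ` P" using saturated_image_mem[OF P(1) xy(2)] P(3) by blast
    moreover have "q x \<in> q ` P" using P(2) by blast
    ultimately show False
      using component_clopen_cases[OF C(1) saturated_image_clopen[OF P(1)]] C(2) y by blast
  qed
next
  assume c: "comparable x y"
  have "q y \<in> topspace Z" using xy(2) by (simp add: Z_topspace)
  then obtain D where D: "D \<in> connected_components_of Z" "q y \<in> D" by (rule ex_component)
  show "q y \<in> C"
  proof (rule ccontr)
    assume n: "q y \<notin> C"
    then have "C \<inter> D = {}" using components_disjoint[OF C(1) D(1)] D(2) by blast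
    then have CD: "C \<subseteq> topspace Z - D" using connected_components_of_subset[OF C(1)] by blast
    have o: "openin Z (topspace Z - D)"
      using closedin_connected_components_of[OF D(1)] by (simp add: openin_diff)
    obtain U where U: "clopenin Z U" "C \<subseteq> U" "U \<subseteq> topspace Z - D"
      by (rule clopen_nbhd_of_component[OF Z_compact H C(1) o CD])
    have "x \<in> {z \<in> T. q z \<in> U}" "y \<notin> {z \<in> T. q z \<in> U}" using U C(2) D(2) xy(1) by auto
    then show False using saturated_comparable[OF clopen_preimage[OF U(1)] c] by blast
  qed
qed

lemma fraisse_fence_height:
  obtains h where "fence_height Z h" "dense_arcs Z h"
proof -
  obtain t where ct: "continuous_map X euclideanreal t" and tR: "\<And>u v. (u, v) \<in> rel_of F \<Longrightarrow> t u = t v"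
    and tm: "\<And>u v. (u, v) \<in> le_of F \<Longrightarrow> t u \<le> t v"
    and ts: "\<And>u v. (u, v) \<in> le_of F \<Longrightarrow> (u, v) \<notin> rel_of F \<Longrightarrow> t u < (t v :: real)"
    by (rule ex_height) (rule that)
  \<comment> \<open>The choice of the representative is immaterial, since \<open>t\<close> is
    constant on \<open>R\<close>-classes.\<close>
  define h where "h c = t (SOME x. x \<in> c)" for c
  have h: "h (q x) = t x" if x: "x \<in> T" for x
  proof -
    have "(SOME y. y \<in> q x) \<in> q x" by (rule someI[of _ x]) (use rel_refl[OF x] in blast)
    then show ?thesis using tR[of x "SOME y. y \<in> q x"] by (simp add: h_def)
  qed
  have "continuous_map X euclideanreal (h \<circ> q)"
    by (rule continuous_map_eq[OF ct]) (simp add: h)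
  then have ch: "continuous_map Z euclideanreal h"
    by (rule continuous_compose_quotient_map[OF q_quotient])
  have teq: "(x, y) \<in> rel_of F" if c: "comparable x y" and "t x = t y" for x y
    using c ts[of x y] ts[of y x] \<open>t x = t y\<close> rel_sym unfolding comparable_def by (metis less_irrefl)
  \<comment> \<open>Distinct images of comparable points differ in \<open>h\<close>; incomparable
    points are separated by a saturated set and its complement.\<close>
  have haus: "Hausdorff_space Z"
    unfolding Hausdorff_space_def
  proof (intro allI impI)
    fix a b assume "a \<in> topspace Z \<and> b \<in> topspace Z \<and> a \<noteq> b"
    then obtain x y where xy: "x \<in> T" "y \<in> T" "a = q x" "b = q y" "q x \<noteq> q y" by (auto simp: Z_topspace)
    show "\<exists>U V. openin Z U \<and> openin Z V \<and> a \<in> U \<and> b \<in> V \<and> disjnt U V"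
    proof (cases "comparable x y")
      case True
      then have "t x \<noteq> t y" using teq xy q_eq by blast
      then obtain A B where AB: "open A" "open B" "t x \<in> A" "t y \<in> B" "A \<inter> B = {}" using hausdorff by metis
      have "openin Z {z \<in> topspace Z. h z \<in> A}" "openin Z {z \<in> topspace Z. h z \<in> B}"
        by (rule openin_continuous_map_preimage[OF ch]; use AB in simp)+
      then show ?thesis
        using AB xy h[OF xy(1)] h[OF xy(2)]
        by (intro exI[of _ "{z \<in> topspace Z. h z \<in> A}"] exI[of _ "{z \<in> topspace Z. h z \<in> B}"])
           (auto simp: disjnt_def Z_topspace)
    next
      case False
      then obtain P where P: "saturated P" "x \<in> P" "y \<notin> P" using incomparable_saturated[OF xy(1,2)] by blast
      have "y \<in> T - P" using P(3) xy(2) by blast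
      moreover have "q ` P \<inter> q ` (T - P) = {}"
        using saturated_image_mem[OF P(1)] by blast
      ultimately show ?thesis
        using saturated_image_clopen[OF P(1)] saturated_image_clopen[OF saturated_Compl[OF P(1)]] P(2) xy(3,4)
        by (intro exI[of _ "q ` P"] exI[of _ "q ` (T - P)"]) (auto simp: disjnt_def)
    qed
  qed
  note same = same_component_iff[OF haus]
  have lift: "\<exists>x\<in>T. c = q x" if "C \<in> connected_components_of Z" "c \<in> C" for C c
    using connected_components_of_subset[OF that(1)] that(2) by (auto simp: Z_topspace)
  have "inj_on h C" if C: "C \<in> connected_components_of Z" for C
  proof (rule inj_onI)
    fix a b assume ab: "a \<in> C" "b \<in> C" "h a = h b"
    obtain x where x: "x \<in> T" "a = q x" using lift[OF C ab(1)] by blast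
    obtain y where y: "y \<in> T" "b = q y" using lift[OF C ab(2)] by blast
    have "comparable x y" using same[OF x(1) y(1) C] ab x y by blast
    then have "(x, y) \<in> rel_of F" using teq ab(3) x y h by simp
    then show "a = b" using q_eq x y by simp
  qed
  then have fh: "fence_height Z h" by (intro fence_height.intro Z_compact haus ch)
  have "dense_arcs Z h"
    unfolding dense_arcs_def
  proof (intro ballI allI impI; elim conjE)
    fix C x y U and e :: real
    assume C: "C \<in> connected_components_of Z" and x: "x \<in> h ` C" and y: "y \<in> h ` C"
      and xy: "x \<le> y" and U: "openin Z U" "closedin Z U" "C \<subseteq> U" and e: "0 < e"
    obtain c where c: "c \<in> C" "x = h c" using x by blast
    obtain d where d: "d \<in> C" "y = h d" using y by blast
    obtain u where u: "u \<in> T" "c = q u" using lift[OF C c(1)] by blast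
    obtain v' where v': "v' \<in> T" "d = q v'" using lift[OF C d(1)] by blast
    \<comment> \<open>For \<open>x = y\<close> the points \<open>u\<close> and \<open>v'\<close> may
      be two related points in the wrong order; taking \<open>u\<close> twice still gives a pair in
      the order.\<close>
    define v where "v = (if x = y then u else v')"
    have v: "v \<in> T" "q v \<in> C" "t v = y" using u v' c d h by (auto simp: v_def)
    have uC: "q u \<in> C" "t u = x" using u c h by auto
    have uv: "(u, v) \<in> le_of F"
    proof (cases "x = y")
      case True then show ?thesis using le_refl[OF u(1)] by (simp add: v_def)
    next
      case False
      have "comparable u v" using same[OF u(1) v(1) C uC(1)] v(2) by blast
      then show ?thesis using tm[of v u] False xy v(3) uC(2) by (auto simp: comparable_def)
    qed
    define P where "P = {z \<in> T. q z \<in> U}"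
    have P: "saturated P" unfolding P_def by (rule clopen_preimage) (use U in simp)
    \<comment> \<open>On a fibre of a map adapted to finitely many such \<open>N z\<close> covering
      the space, \<open>t\<close> varies by less than \<open>e\<close>; adaptedness to
      \<open>P\<close> will keep the arc inside \<open>U\<close>.\<close>
    have "\<exists>N. clopenin X N \<and> z \<in> N \<and> (\<forall>w\<in>N. \<bar>t w - t z\<bar> < e / 2)" if z: "z \<in> T" for z
    proof -
      have "openin X {w \<in> T. t w \<in> {t z - e / 2<..<t z + e / 2}}"
        by (rule openin_continuous_map_preimage[OF ct]) simp
      moreover have "z \<in> {w \<in> T. t w \<in> {t z - e / 2<..<t z + e / 2}}" using z e by simp
      ultimately obtain N where N: "clopenin X N" "z \<in> N" "N \<subseteq> {w \<in> T. t w \<in> {t z - e / 2<..<t z + e / 2}}"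
        by (rule clopen_base)
      have "\<bar>t w - t z\<bar> < e / 2" if "w \<in> N" for w
      proof -
        have "t w \<in> {t z - e / 2<..<t z + e / 2}" using N(3) that by blast
        then show ?thesis unfolding greaterThanLessThan_iff by linarith
      qed
      then show ?thesis using N by blast
    qed
    then obtain N where N: "\<And>z. z \<in> T \<Longrightarrow> clopenin X (N z) \<and> z \<in> N z \<and> (\<forall>w\<in>N z. \<bar>t w - t z\<bar> < e / 2)" by metis
    have "\<forall>V\<in>N ` T. openin X V" "T \<subseteq> \<Union>(N ` T)" using N by auto
    then obtain \<F> where F: "finite \<F>" "\<F> \<subseteq> N ` T" "T \<subseteq> \<Union>\<F>"
      using limit_structure(2) unfolding compact_space_def compactin_def by metis
    have "clopens (insert P \<F>)" using F N P by (auto simp: clopens_def saturated_def)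
    then show "\<exists>D a b. D \<in> connected_components_of Z \<and> D \<subseteq> U \<and> h ` D = {a..b} \<and> a < b \<and> \<bar>a - x\<bar> < e \<and> \<bar>b - y\<bar> < e"
    proof (rule approximation)
      fix A B :: "nat lr_structure" and \<phi> \<phi>' ch rk \<pi>
      assume A: "epimorphism F A \<phi>" and r: "adapted (insert P \<F>) \<phi>"
        and B: "chain_forest B ch rk" "epimorphism F B \<phi>'"
        and \<pi>: "\<And>x. x \<in> T \<Longrightarrow> \<phi> x = \<pi> (\<phi>' x)"
        and c: "chain_covering A B ch rk \<pi>"
      have osc: "\<bar>t z - t w\<bar> < e" if zw: "z \<in> T" "w \<in> T" "\<phi> z = \<phi> w" for z w
      proof -
        obtain V where V: "V \<in> \<F>" "z \<in> V" using F(3) zw(1) by blast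
        then have "w \<in> V" using r zw unfolding adapted_def by (metis insertI2)
        moreover obtain k where "k \<in> T" "V = N k" using V(1) F(2) by blast
        ultimately have "\<bar>t z - t k\<bar> < e / 2" "\<bar>t w - t k\<bar> < e / 2" using N V(2) by auto
        then show ?thesis by linarith
      qed
      \<comment> \<open>A whole chain lies over the images of \<open>u\<close> and \<open>v\<close>.
        Points \<open>w\<close> and \<open>w'\<close> of the limit over its bottom and top lie in
        one component \<open>D\<close>, which is not degenerate because \<open>p\<close> and
        \<open>p'\<close> are unrelated.\<close>
      obtain p p' where p: "(p, p') \<in> le_of B" "(p, p') \<notin> rel_of B" "\<pi> p = \<phi> u" "\<pi> p' = \<phi> v"
        "\<And>s. (s, p) \<in> le_of B \<Longrightarrow> s = p" "\<And>s. (p', s) \<in> le_of B \<Longrightarrow> s = p'"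
        using c epi_le(1)[OF A uv] unfolding chain_covering_def by metis
      obtain w w' where w: "(w, w') \<in> le_of F" "\<phi>' w = p" "\<phi>' w' = p'" using epi_le(3)[OF B(2) p(1)] by blast
      have wT: "w \<in> T" "w' \<in> T" using rel_topspace(3,4)[OF w(1)] by auto
      have \<phi>w: "\<phi> w = \<phi> u" "\<phi> w' = \<phi> v" using \<pi> wT w p by auto
      have "(w, w') \<notin> rel_of F" using epi_le(2)[OF B(2), of w w'] w p(2) by auto
      then have tw: "t w < t w'" using ts w(1) by blast
      have "q w \<in> topspace Z" using wT(1) by (simp add: Z_topspace)
      then obtain D where D: "D \<in> connected_components_of Z" "q w \<in> D" by (rule ex_component)
      have "comparable w w'" using w(1) by (simp add: comparable_def)
      then have w'D: "q w' \<in> D" using same[OF wT D] by blast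
      have "u \<in> P" using uC u(1) U(3) by (auto simp: P_def)
      then have "w \<in> P" using r \<phi>w(1) wT(1) u(1) unfolding adapted_def by (metis insertI1)
      then have "q w \<in> U" by (simp add: P_def)
      then have DU: "D \<subseteq> U" using component_clopen_cases[OF D(1), of U] U D(2) by blast
      obtain a b where ab: "a \<le> b" "h ` D = {a..b}" by (rule component_image_interval[OF Z_compact D(1) ch])
      have mem: "t w \<in> {a..b}" "t w' \<in> {a..b}"
        using ab(2) D(2) w'D h[OF wT(1)] h[OF wT(2)] by (metis imageI)+
      have "a \<in> h ` D" "b \<in> h ` D" using ab by auto
      then obtain m m' where m: "m \<in> T" "q m \<in> D" "t m = a" and m': "m' \<in> T" "q m' \<in> D" "t m' = b"
        using lift[OF D(1)] h by (metis imageE)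
      have "comparable w m" "comparable w' m'"
        using same[OF wT(1) m(1) D] m(2) same[OF wT(2) m'(1) D(1) w'D] m'(2) by auto
      \<comment> \<open>\<open>D\<close> may extend below \<open>w\<close>, but any point below
        \<open>w\<close> is also sent to \<open>p\<close>, the bottom of its chain. So the lower end
        of \<open>D\<close> has the same image in \<open>A\<close> as \<open>u\<close>, and its
        height is within \<open>e\<close> of \<open>x\<close>. The upper end is treated
        dually.\<close>
      have "\<bar>a - x\<bar> < e"
      proof (cases "t m = t w")
        case True
        then show ?thesis using osc[OF wT(1) u(1) \<phi>w(1)] m(3) uC(2) by simp
      next
        case False
        then have "t m < t w" using mem(1) m(3) by auto
        then have "(m, w) \<in> le_of F" using \<open>comparable w m\<close> tm[of w m] by (auto simp: comparable_def)
        then have "\<phi>' m = p" using epi_le(1)[OF B(2)] w(2) p(5) by blast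
        then have "\<phi> m = \<phi> u" using \<pi>[OF m(1)] p(3) by simp
        then show ?thesis using osc[OF m(1) u(1)] m(3) uC(2) by simp
      qed
      moreover have "\<bar>b - y\<bar> < e"
      proof (cases "t m' = t w'")
        case True
        then show ?thesis using osc[OF wT(2) v(1) \<phi>w(2)] m'(3) v(3) by simp
      next
        case False
        then have "t w' < t m'" using mem(2) m'(3) by auto
        then have "(w', m') \<in> le_of F" using \<open>comparable w' m'\<close> tm[of m' w'] by (auto simp: comparable_def)
        then have "\<phi>' m' = p'" using epi_le(1)[OF B(2)] w(3) p(6) by blast
        then have "\<phi> m' = \<phi> v" using \<pi>[OF m'(1)] p(4) by simp
        then show ?thesis using osc[OF m'(1) v(1)] m'(3) v(3) by simp
      qed
      moreover have "a < b" using mem tw by auto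
      ultimately show ?thesis using D(1) DU ab(2) by blast
    qed
  qed
  then show thesis using that fh by blast
qed

end

theorem theorem5p3:
  fixes F :: "'a lr_structure" and Y :: "'b topology"
  assumes "projective_fraisse_limit F"
    and "smooth_fence Y"
  shows "Y homeomorphic_space fraisse_fence F \<longleftrightarrow>
    (\<forall>U V. openin Y U \<and> openin Y V \<and>
           (\<exists>C \<in> connected_components_of Y. C \<inter> U \<noteq> {} \<and> C \<inter> V \<noteq> {}) \<longrightarrow>
       (\<exists>K p q. arc_component Y K \<and> arc_endpoints Y K p q \<and> p \<in> U \<and> q \<in> V))"
  unfolding joins_arcs_def[symmetric]
proof
  interpret fraisse_limit F by unfold_locales (rule assms(1))
  obtain h where h: "fence_height Z h" "dense_arcs Z h" by (rule fraisse_fence_height)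
  have jZ: "joins_arcs Z" by (rule fence_height.joins_arcsI[OF h])
  show "joins_arcs Y" if "Y homeomorphic_space fraisse_fence F"
    using homeomorphic_space_joins_arcs[OF _ jZ] that homeomorphic_space_sym by blast
  assume jY: "joins_arcs Y"
  have Y: "compact_space Y" "metrizable_space Y" "topspace Y \<noteq> {}"
    using assms(2) by (auto simp: smooth_fence_def fence_def)
  obtain t where t: "fence_height Y t" by (rule smooth_fence_height[OF assms(2)])
  show "Y homeomorphic_space fraisse_fence F"
  proof (rule fence_uniqueness[OF t fence_height.dense_arcsI[OF t jY] Y(3) h])
    show "topspace Z \<noteq> {}" using T_nonempty by (simp add: Z_topspace)
    show "\<And>\<U>. \<forall>U\<in>\<U>. openin (prod_topology Y Y) U \<Longrightarrow> \<exists>\<V>\<subseteq>\<U>. countable \<V> \<and> \<Union>\<V> = \<Union>\<U>"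
      by (rule compact_metrizable_subcover[OF Y(1,2)])
    show "\<And>\<U>. \<forall>U\<in>\<U>. openin (prod_topology Z Z) U \<Longrightarrow> \<exists>\<V>\<subseteq>\<U>. countable \<V> \<and> \<Union>\<V> = \<Union>\<U>"
      by (rule Z_subcover)
  qed
qed

end
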